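(* Let $(M,g,\bar\nabla)$ be a metric-affine space such that $(M,g)$ is a complete open (non-compact, without boundary) or closed (compact, without boundary) Riemannian manifold, endowed with complementary orthogonal harmonic foliations; that is, $M$ carries complementary orthogonal integrable distributions $\mathcal D^\top,\mathcal D^\bot$ with $H^\top=0$ and $H^\bot=0$. Suppose that (i) $\mathcal T_XY=0=\mathcal T_YX$ and $\mathcal T^*_XY=0=\mathcal T^*_YX$ for all $X\in\mathcal D^\top$, $Y\in\mathcal D^\bot$; (ii) $\|\xi\|_g\in L^1(M,g)$, where $\xi=\frac12(H^\top_{\mathcal T}-H^\top_{\mathcal T^*})^\bot+\frac12(H^\bot_{\mathcal T}-H^\bot_{\mathcal T^*})^\top$; (iii) $g(H^\top_{\mathcal T},H^\bot_{\mathcal T^*})+g(H^\bot_{\mathcal T},H^\top_{\mathcal T^*})=0$. If $\bar{\rm S}_{\rm mix}\ge0$, then $M$ splits, i.e. $M$ is locally isometric to a product with canonical foliations tangent to $\mathcal D^\top$ and $\mathcal D^\bot$.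
   Context: $M$ is a connected smooth manifold of dimension $n+p$ with Riemannian metric $g$ and Levi-Civita connection $\nabla$; $\mathcal D^\top$ (rank $n$) and $\mathcal D^\bot$ (rank $p$) are complementary $g$-orthogonal distributions, with orthogonal decomposition $X=X^\top+X^\bot$. A metric-affine space is $(M,g,\bar\nabla)$ with $\bar\nabla$ any linear connection on $TM$. $\{E_a\}_{1\le a\le n}$, $\{\mathcal E_i\}_{1\le i\le p}$ are local orthonormal frames of $\mathcal D^\top$, $\mathcal D^\bot$; an index $a$ or $i$ stands for $E_a$ or $\mathcal E_i$. The mean curvature vectors are $H^\top=\sum_a(\nabla_{E_a}E_a)^\bot$ and $H^\bot=\sum_i(\nabla_{\mathcal E_i}\mathcal E_i)^\top$. The contorsion tensor is $\mathcal T=\bar\nabla-\nabla$, written $\mathcal T_XY$, and $\mathcal T^*$ is defined by $g(\mathcal T^*_XY,Z)=g(\mathcal T_XZ,Y)$. For $\mathcal S\in\{\mathcal T,\mathcal T^*\}$: $H^\top_{\mathcal S}=\sum_a\mathcal S_aE_a$, $H^\bot_{\mathcal S}=\sum_i\mathcal S_i\mathcal E_i$. With $\bar R_{X,Y}=[\bar\nabla_Y,\bar\nabla_X]+\bar\nabla_{[X,Y]}$, the mixed scalar curvature of $\bar\nabla$ is $\bar{\rm S}_{\rm mix}=\frac12\sum_{a,i}\big(g(\bar R_{a,i}E_a,\mathcal E_i)+g(\bar R_{i,a}\mathcal E_i,E_a)\big)$. *)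

theory Defs
  imports "HOL-Analysis.Analysis"
begin

section \<open>Smooth maps between open subsets of normed spaces\<close>

text \<open>All sets \<open>S\<close> to which the following two notions are applied are open.\<close>

primrec Ck_on :: "nat \<Rightarrow> 'a::real_normed_vector set \<Rightarrow> ('a \<Rightarrow> 'b::real_normed_vector) \<Rightarrow> bool" where
  "Ck_on 0 S f \<longleftrightarrow> continuous_on S f"
| "Ck_on (Suc k) S f \<longleftrightarrow> (\<forall>x\<in>S. f differentiable (at x)) \<and>
     (\<forall>v. Ck_on k S (\<lambda>x. frechet_derivative f (at x) v))"

definition smooth_on :: "'a::real_normed_vector set \<Rightarrow> ('a \<Rightarrow> 'b::real_normed_vector) \<Rightarrow> bool" where
  "smooth_on S f \<longleftrightarrow> (\<forall>k. Ck_on k S f)"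


section \<open>Smooth manifolds\<close>

text \<open>The underlying space of a manifold is a type \<open>'m\<close>, which is required to be Hausdorff and
  second countable; the model space is a Euclidean space \<open>'e\<close>. A chart is a pair of
  a domain and a coordinate map.\<close>

type_synonym ('m, 'e) chart = "'m set \<times> ('m \<Rightarrow> 'e)"

definition cinv :: "('m, 'e) chart \<Rightarrow> 'e \<Rightarrow> 'm" where
  "cinv c = inv_into (fst c) (snd c)"

definition is_chart :: "('m::topological_space, 'e::euclidean_space) chart \<Rightarrow> bool" where
  "is_chart c \<longleftrightarrow> open (fst c) \<and> open (snd c ` fst c) \<and>
     homeomorphism (fst c) (snd c ` fst c) (snd c) (cinv c)"

definition smooth_transition ::
    "('m, 'e::euclidean_space) chart \<Rightarrow> ('m, 'e) chart \<Rightarrow> bool" where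
  "smooth_transition c c' \<longleftrightarrow> smooth_on (snd c ` (fst c \<inter> fst c')) (snd c' \<circ> cinv c)"

definition smooth_atlas :: "('m::topological_space, 'e::euclidean_space) chart set \<Rightarrow> bool" where
  "smooth_atlas A \<longleftrightarrow> (\<forall>c\<in>A. is_chart c) \<and> (\<Union>c\<in>A. fst c) = UNIV \<and>
     (\<forall>c\<in>A. \<forall>c'\<in>A. smooth_transition c c')"

text \<open>Membership in the maximal atlas determined by \<open>A\<close>.\<close>

definition smooth_chart ::
    "('m::topological_space, 'e::euclidean_space) chart set \<Rightarrow> ('m, 'e) chart \<Rightarrow> bool" where
  "smooth_chart A c \<longleftrightarrow> is_chart c \<and>
     (\<forall>c'\<in>A. smooth_transition c c' \<and> smooth_transition c' c)"

definition smooth_fun ::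
    "('m, 'e::euclidean_space) chart set \<Rightarrow> 'm set \<Rightarrow> ('m \<Rightarrow> real) \<Rightarrow> bool" where
  "smooth_fun A U f \<longleftrightarrow> (\<forall>c\<in>A. smooth_on (snd c ` (U \<inter> fst c)) (f \<circ> cinv c))"


section \<open>Tangent vectors and vector fields\<close>

text \<open>Every tangent space is modelled on \<open>'e\<close>: one chart \<open>pref A p\<close> around each point \<open>p\<close> is
  singled out, and a tangent vector at \<open>p\<close> is given by its components in that chart. A vector field
  is thus a function \<open>'m \<Rightarrow> 'e\<close>, but smoothness refers to its components in a fixed chart,
  not to this function itself, since \<open>pref A p\<close> may jump with \<open>p\<close>. A field that is only
  defined on an open set is represented by any function that has the right values there.\<close>

definition pref :: "('m, 'e) chart set \<Rightarrow> 'm \<Rightarrow> ('m, 'e) chart" where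
  "pref A p = (SOME c. c \<in> A \<and> p \<in> fst c)"

text \<open>Components in the chart \<open>c\<close> of a tangent vector at \<open>p\<close>, and conversely the tangent vector
  at \<open>p\<close> with given components in \<open>c\<close>.\<close>

definition coord ::
    "('m, 'e::euclidean_space) chart set \<Rightarrow> ('m, 'e) chart \<Rightarrow> 'm \<Rightarrow> 'e \<Rightarrow> 'e" where
  "coord A c p = frechet_derivative (snd c \<circ> cinv (pref A p)) (at (snd (pref A p) p))"

definition tvec ::
    "('m, 'e::euclidean_space) chart set \<Rightarrow> ('m, 'e) chart \<Rightarrow> 'm \<Rightarrow> 'e \<Rightarrow> 'e" where
  "tvec A c p = frechet_derivative (snd (pref A p) \<circ> cinv c) (at (snd c p))"

definition rep ::
    "('m, 'e::euclidean_space) chart set \<Rightarrow> ('m, 'e) chart \<Rightarrow> ('m \<Rightarrow> 'e) \<Rightarrow> 'e \<Rightarrow> 'e" where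
  "rep A c X x = coord A c (cinv c x) (X (cinv c x))"

definition smooth_vf ::
    "('m, 'e::euclidean_space) chart set \<Rightarrow> 'm set \<Rightarrow> ('m \<Rightarrow> 'e) \<Rightarrow> bool" where
  "smooth_vf A U X \<longleftrightarrow> (\<forall>c\<in>A. smooth_on (snd c ` (U \<inter> fst c)) (rep A c X))"

text \<open>The derivative of a function along a tangent vector \<open>v\<close> at \<open>p\<close>.\<close>

definition vderiv ::
    "('m, 'e::euclidean_space) chart set \<Rightarrow> 'm \<Rightarrow> 'e \<Rightarrow> ('m \<Rightarrow> real) \<Rightarrow> real" where
  "vderiv A p v f = frechet_derivative (f \<circ> cinv (pref A p)) (at (snd (pref A p) p)) v"

definition lie_bracket ::
    "('m, 'e::euclidean_space) chart set \<Rightarrow> ('m \<Rightarrow> 'e) \<Rightarrow> ('m \<Rightarrow> 'e) \<Rightarrow> 'm \<Rightarrow> 'e" where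
  "lie_bracket A X Y p =
     (let c = pref A p; x = snd c p
      in frechet_derivative (rep A c Y) (at x) (X p) - frechet_derivative (rep A c X) (at x) (Y p))"


section \<open>Riemannian metrics and connections\<close>

definition inner_form :: "('e::euclidean_space \<Rightarrow> 'e \<Rightarrow> real) \<Rightarrow> bool" where
  "inner_form h \<longleftrightarrow> bilinear h \<and> (\<forall>v w. h v w = h w v) \<and> (\<forall>v. v \<noteq> 0 \<longrightarrow> h v v > 0)"

definition riemannian_metric ::
    "('m::topological_space, 'e::euclidean_space) chart set \<Rightarrow> ('m \<Rightarrow> 'e \<Rightarrow> 'e \<Rightarrow> real) \<Rightarrow> bool" where
  "riemannian_metric A g \<longleftrightarrow> (\<forall>p. inner_form (g p)) \<and>
     (\<forall>U X Y. open U \<and> smooth_vf A U X \<and> smooth_vf A U Y \<longrightarrow>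
        smooth_fun A U (\<lambda>p. g p (X p) (Y p)))"

text \<open>A linear connection is taken as an operator on local vector fields: \<open>nb X Y\<close> stands for the
  covariant derivative of \<open>Y\<close> along \<open>X\<close>, and is meaningful wherever both are smooth. Locality
  follows from the axioms, because \<open>f\<close> and the fields are arbitrary outside \<open>U\<close>: if \<open>X = X'\<close> on \<open>U\<close>,
  write \<open>X = f (X - X') + X'\<close> with \<open>f = 0\<close> on \<open>U\<close> and \<open>f = 1\<close> elsewhere.\<close>

definition linear_connection ::
    "('m::topological_space, 'e::euclidean_space) chart set \<Rightarrow>
     (('m \<Rightarrow> 'e) \<Rightarrow> ('m \<Rightarrow> 'e) \<Rightarrow> 'm \<Rightarrow> 'e) \<Rightarrow> bool" where
  "linear_connection A nb \<longleftrightarrow>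
     (\<forall>U X X' Y Y' f. open U \<and> smooth_vf A U X \<and> smooth_vf A U X' \<and>
        smooth_vf A U Y \<and> smooth_vf A U Y' \<and> smooth_fun A U f \<longrightarrow>
        smooth_vf A U (nb X Y) \<and>
        (\<forall>p\<in>U. nb (\<lambda>q. f q *\<^sub>R X q + X' q) Y p = f p *\<^sub>R nb X Y p + nb X' Y p \<and>
           nb X (\<lambda>q. Y q + Y' q) p = nb X Y p + nb X Y' p \<and>
           nb X (\<lambda>q. f q *\<^sub>R Y q) p = vderiv A p (X p) f *\<^sub>R Y p + f p *\<^sub>R nb X Y p))"

definition levi_civita ::
    "('m::topological_space, 'e::euclidean_space) chart set \<Rightarrow> ('m \<Rightarrow> 'e \<Rightarrow> 'e \<Rightarrow> real) \<Rightarrow>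
     (('m \<Rightarrow> 'e) \<Rightarrow> ('m \<Rightarrow> 'e) \<Rightarrow> 'm \<Rightarrow> 'e) \<Rightarrow> bool" where
  "levi_civita A g nb \<longleftrightarrow> linear_connection A nb \<and>
     (\<forall>U X Y Z. open U \<and> smooth_vf A U X \<and> smooth_vf A U Y \<and> smooth_vf A U Z \<longrightarrow>
        (\<forall>p\<in>U. nb X Y p - nb Y X p = lie_bracket A X Y p \<and>
           vderiv A p (X p) (\<lambda>q. g q (Y q) (Z q)) = g p (nb X Y p) (Z p) + g p (Y p) (nb X Z p)))"

text \<open>Sign convention: \<open>R(X,Y) = [nb_Y, nb_X] + nb_[X,Y]\<close>.\<close>

definition curv ::
    "('m, 'e::euclidean_space) chart set \<Rightarrow> (('m \<Rightarrow> 'e) \<Rightarrow> ('m \<Rightarrow> 'e) \<Rightarrow> 'm \<Rightarrow> 'e) \<Rightarrow>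
     ('m \<Rightarrow> 'e) \<Rightarrow> ('m \<Rightarrow> 'e) \<Rightarrow> ('m \<Rightarrow> 'e) \<Rightarrow> 'm \<Rightarrow> 'e" where
  "curv A nb X Y Z p = nb Y (nb X Z) p - nb X (nb Y Z) p + nb (lie_bracket A X Y) Z p"


section \<open>Riemannian distance, completeness, integrability of functions\<close>

definition piecewise_C1_curve ::
    "('m::topological_space, 'e::euclidean_space) chart set \<Rightarrow> (real \<Rightarrow> 'm) \<Rightarrow> bool" where
  "piecewise_C1_curve A \<gamma> \<longleftrightarrow> continuous_on {0..1} \<gamma> \<and>
     (\<forall>c\<in>A. \<forall>s t. 0 \<le> s \<and> s \<le> t \<and> t \<le> 1 \<and> \<gamma> ` {s..t} \<subseteq> fst c \<longrightarrow>
        (snd c \<circ> \<gamma>) piecewise_C1_differentiable_on {s..t})"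

definition velocity ::
    "('m, 'e::euclidean_space) chart set \<Rightarrow> (real \<Rightarrow> 'm) \<Rightarrow> real \<Rightarrow> 'e" where
  "velocity A \<gamma> t = vector_derivative (snd (pref A (\<gamma> t)) \<circ> \<gamma>) (at t within {0..1})"

definition curve_length ::
    "('m, 'e::euclidean_space) chart set \<Rightarrow> ('m \<Rightarrow> 'e \<Rightarrow> 'e \<Rightarrow> real) \<Rightarrow> (real \<Rightarrow> 'm) \<Rightarrow> real" where
  "curve_length A g \<gamma> =
     integral {0..1} (\<lambda>t. sqrt (g (\<gamma> t) (velocity A \<gamma> t) (velocity A \<gamma> t)))"

definition riemannian_dist ::
    "('m::topological_space, 'e::euclidean_space) chart set \<Rightarrow> ('m \<Rightarrow> 'e \<Rightarrow> 'e \<Rightarrow> real) \<Rightarrow>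
     'm \<Rightarrow> 'm \<Rightarrow> real" where
  "riemannian_dist A g p q =
     Inf {curve_length A g \<gamma> | \<gamma>. piecewise_C1_curve A \<gamma> \<and> \<gamma> 0 = p \<and> \<gamma> 1 = q}"

definition complete_metric ::
    "('m::topological_space, 'e::euclidean_space) chart set \<Rightarrow> ('m \<Rightarrow> 'e \<Rightarrow> 'e \<Rightarrow> real) \<Rightarrow> bool" where
  "complete_metric A g \<longleftrightarrow>
     (\<forall>s::nat \<Rightarrow> 'm. (\<forall>e>0. \<exists>N. \<forall>m\<ge>N. \<forall>n\<ge>N. riemannian_dist A g (s m) (s n) < e) \<longrightarrow>
        (\<exists>p. (\<lambda>n. riemannian_dist A g (s n) p) \<longlonglongrightarrow> 0))"

text \<open>Determinant of the Gram matrix of the standard basis of the model space, by the Leibniz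
  formula (the library determinant only covers matrices indexed by a finite type).\<close>

definition gram_det :: "('e::euclidean_space \<Rightarrow> 'e \<Rightarrow> real) \<Rightarrow> real" where
  "gram_det h = (\<Sum>\<pi> | \<pi> permutes Basis. of_int (sign \<pi>) * (\<Prod>b\<in>Basis. h b (\<pi> b)))"

definition chart_metric ::
    "('m, 'e::euclidean_space) chart set \<Rightarrow> ('m \<Rightarrow> 'e \<Rightarrow> 'e \<Rightarrow> real) \<Rightarrow> ('m, 'e) chart \<Rightarrow>
     'e \<Rightarrow> 'e \<Rightarrow> 'e \<Rightarrow> real" where
  "chart_metric A g c x v w = (let q = cinv c x in g q (tvec A c q v) (tvec A c q w))"

text \<open>This determines \<open>\<mu>\<close> uniquely, as countably many charts cover the manifold.\<close>

definition riemannian_volume ::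
    "('m::topological_space, 'e::euclidean_space) chart set \<Rightarrow> ('m \<Rightarrow> 'e \<Rightarrow> 'e \<Rightarrow> real) \<Rightarrow>
     'm measure \<Rightarrow> bool" where
  "riemannian_volume A g \<mu> \<longleftrightarrow> sets \<mu> = sets borel \<and>
     (\<forall>c\<in>A. \<forall>B\<in>sets borel. B \<subseteq> fst c \<longrightarrow>
        emeasure \<mu> B =
          (\<integral>\<^sup>+x. ennreal (sqrt (gram_det (chart_metric A g c x))) * indicator (snd c ` B) x \<partial>lborel))"

definition L1_riemannian ::
    "('m::topological_space, 'e::euclidean_space) chart set \<Rightarrow> ('m \<Rightarrow> 'e \<Rightarrow> 'e \<Rightarrow> real) \<Rightarrow>
     ('m \<Rightarrow> real) \<Rightarrow> bool" where
  "L1_riemannian A g f \<longleftrightarrow> (\<exists>\<mu>. riemannian_volume A g \<mu> \<and> integrable \<mu> f)"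


section \<open>Distributions\<close>

definition smooth_distribution ::
    "('m::topological_space, 'e::euclidean_space) chart set \<Rightarrow> nat \<Rightarrow> ('m \<Rightarrow> 'e set) \<Rightarrow> bool" where
  "smooth_distribution A k D \<longleftrightarrow>
     (\<forall>p. subspace (D p) \<and> dim (D p) = k \<and>
        (\<exists>U (X :: nat \<Rightarrow> 'm \<Rightarrow> 'e). open U \<and> p \<in> U \<and> (\<forall>a\<in>{1..k}. smooth_vf A U (X a)) \<and>
           (\<forall>q\<in>U. span ((\<lambda>a. X a q) ` {1..k}) = D q)))"

definition complementary_orthogonal ::
    "('m \<Rightarrow> 'e::euclidean_space \<Rightarrow> 'e \<Rightarrow> real) \<Rightarrow> ('m \<Rightarrow> 'e set) \<Rightarrow> ('m \<Rightarrow> 'e set) \<Rightarrow> bool" where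
  "complementary_orthogonal g D D' \<longleftrightarrow>
     (\<forall>p. D p \<inter> D' p = {0} \<and> {x + y | x y. x \<in> D p \<and> y \<in> D' p} = UNIV \<and>
        (\<forall>x\<in>D p. \<forall>y\<in>D' p. g p x y = 0))"

text \<open>\<open>D\<close> is tangent to a foliation: around every point some chart turns \<open>D\<close> into a constant
  subspace \<open>W\<close>, so that the leaves are locally given by the affine subspaces parallel to \<open>W\<close>.\<close>

definition integrable_distribution ::
    "('m::topological_space, 'e::euclidean_space) chart set \<Rightarrow> ('m \<Rightarrow> 'e set) \<Rightarrow> bool" where
  "integrable_distribution A D \<longleftrightarrow>
     (\<forall>p. \<exists>c W. smooth_chart A c \<and> p \<in> fst c \<and> subspace W \<and>
        (\<forall>q\<in>fst c. coord A c q ` D q = W))"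

text \<open>Orthogonal projection onto \<open>D\<close>.\<close>

definition proj ::
    "('m \<Rightarrow> 'e::euclidean_space \<Rightarrow> 'e \<Rightarrow> real) \<Rightarrow> ('m \<Rightarrow> 'e set) \<Rightarrow> 'm \<Rightarrow> 'e \<Rightarrow> 'e" where
  "proj g D p v = (THE u. u \<in> D p \<and> (\<forall>w\<in>D p. g p (v - u) w = 0))"

definition orthonormal_frame ::
    "('m::topological_space, 'e::euclidean_space) chart set \<Rightarrow> ('m \<Rightarrow> 'e \<Rightarrow> 'e \<Rightarrow> real) \<Rightarrow>
     ('m \<Rightarrow> 'e set) \<Rightarrow> 'm \<Rightarrow> (nat \<Rightarrow> 'm \<Rightarrow> 'e) \<Rightarrow> bool" where
  "orthonormal_frame A g D p E \<longleftrightarrow>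
     (\<exists>U. open U \<and> p \<in> U \<and> (\<forall>a\<in>{1..dim (D p)}. smooth_vf A U (E a)) \<and>
        (\<forall>q\<in>U. \<forall>a\<in>{1..dim (D p)}. E a q \<in> D q \<and>
           (\<forall>b\<in>{1..dim (D p)}. g q (E a q) (E b q) = (if a = b then 1 else 0))))"

text \<open>Some local orthonormal frame of \<open>D\<close> around \<open>p\<close>; the quantities defined below through
  \<open>frame\<close> do not depend on the choice.\<close>

definition frame ::
    "('m::topological_space, 'e::euclidean_space) chart set \<Rightarrow> ('m \<Rightarrow> 'e \<Rightarrow> 'e \<Rightarrow> real) \<Rightarrow>
     ('m \<Rightarrow> 'e set) \<Rightarrow> 'm \<Rightarrow> nat \<Rightarrow> 'm \<Rightarrow> 'e" where
  "frame A g D p = (SOME E. orthonormal_frame A g D p E)"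

text \<open>Mean curvature vector of \<open>D\<close>, where \<open>D'\<close> is the orthogonal complement of \<open>D\<close>.\<close>

definition mean_curvature ::
    "('m::topological_space, 'e::euclidean_space) chart set \<Rightarrow> ('m \<Rightarrow> 'e \<Rightarrow> 'e \<Rightarrow> real) \<Rightarrow>
     (('m \<Rightarrow> 'e) \<Rightarrow> ('m \<Rightarrow> 'e) \<Rightarrow> 'm \<Rightarrow> 'e) \<Rightarrow> ('m \<Rightarrow> 'e set) \<Rightarrow> ('m \<Rightarrow> 'e set) \<Rightarrow> 'm \<Rightarrow> 'e" where
  "mean_curvature A g nb D D' p =
     (let E = frame A g D p in \<Sum>a=1..dim (D p). proj g D' p (nb (E a) (E a) p))"

definition mixed_scalar_curvature ::
    "('m::topological_space, 'e::euclidean_space) chart set \<Rightarrow> ('m \<Rightarrow> 'e \<Rightarrow> 'e \<Rightarrow> real) \<Rightarrow>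
     (('m \<Rightarrow> 'e) \<Rightarrow> ('m \<Rightarrow> 'e) \<Rightarrow> 'm \<Rightarrow> 'e) \<Rightarrow> ('m \<Rightarrow> 'e set) \<Rightarrow> ('m \<Rightarrow> 'e set) \<Rightarrow> 'm \<Rightarrow> real" where
  "mixed_scalar_curvature A g nb D D' p =
     (let E = frame A g D p; F = frame A g D' p
      in 1/2 * (\<Sum>a=1..dim (D p). \<Sum>i=1..dim (D' p).
           g p (curv A nb (E a) (F i) (E a) p) (F i p) +
           g p (curv A nb (F i) (E a) (F i) p) (E a p)))"


section \<open>The contorsion tensor\<close>

text \<open>The difference of two connections is a tensor, so its value on two tangent vectors at \<open>p\<close> may
  be computed with any extensions to local vector fields. Here these are the fields with
  constant components in the chart \<open>pref A p\<close>.\<close>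

definition const_field :: "('m, 'e::euclidean_space) chart set \<Rightarrow> 'm \<Rightarrow> 'e \<Rightarrow> 'm \<Rightarrow> 'e" where
  "const_field A p v q = tvec A (pref A p) q v"

definition contorsion ::
    "('m, 'e::euclidean_space) chart set \<Rightarrow>
     (('m \<Rightarrow> 'e) \<Rightarrow> ('m \<Rightarrow> 'e) \<Rightarrow> 'm \<Rightarrow> 'e) \<Rightarrow> (('m \<Rightarrow> 'e) \<Rightarrow> ('m \<Rightarrow> 'e) \<Rightarrow> 'm \<Rightarrow> 'e) \<Rightarrow>
     'm \<Rightarrow> 'e \<Rightarrow> 'e \<Rightarrow> 'e" where
  "contorsion A nbbar nb p x y =
     nbbar (const_field A p x) (const_field A p y) p - nb (const_field A p x) (const_field A p y) p"

definition tensor_adjoint ::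
    "('m \<Rightarrow> 'e::euclidean_space \<Rightarrow> 'e \<Rightarrow> real) \<Rightarrow> ('m \<Rightarrow> 'e \<Rightarrow> 'e \<Rightarrow> 'e) \<Rightarrow> 'm \<Rightarrow> 'e \<Rightarrow> 'e \<Rightarrow> 'e" where
  "tensor_adjoint g S p x y = (THE u. \<forall>z. g p u z = g p (S p x z) y)"

definition tensor_trace ::
    "('m::topological_space, 'e::euclidean_space) chart set \<Rightarrow> ('m \<Rightarrow> 'e \<Rightarrow> 'e \<Rightarrow> real) \<Rightarrow>
     ('m \<Rightarrow> 'e set) \<Rightarrow> ('m \<Rightarrow> 'e \<Rightarrow> 'e \<Rightarrow> 'e) \<Rightarrow> 'm \<Rightarrow> 'e" where
  "tensor_trace A g D S p =
     (let E = frame A g D p in \<Sum>a=1..dim (D p). S p (E a p) (E a p))"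

definition xi_field ::
    "('m::topological_space, 'e::euclidean_space) chart set \<Rightarrow> ('m \<Rightarrow> 'e \<Rightarrow> 'e \<Rightarrow> real) \<Rightarrow>
     ('m \<Rightarrow> 'e set) \<Rightarrow> ('m \<Rightarrow> 'e set) \<Rightarrow> ('m \<Rightarrow> 'e \<Rightarrow> 'e \<Rightarrow> 'e) \<Rightarrow> 'm \<Rightarrow> 'e" where
  "xi_field A g D D' S p =
     (1/2) *\<^sub>R proj g D' p (tensor_trace A g D S p - tensor_trace A g D (tensor_adjoint g S) p) +
     (1/2) *\<^sub>R proj g D p (tensor_trace A g D' S p - tensor_trace A g D' (tensor_adjoint g S) p)"


section \<open>Local splitting\<close>

definition metric_on ::
    "'a::euclidean_space set \<Rightarrow> ('a \<Rightarrow> 'a \<Rightarrow> 'a \<Rightarrow> real) \<Rightarrow> bool" where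
  "metric_on V h \<longleftrightarrow> open V \<and> (\<forall>x\<in>V. inner_form (h x)) \<and> (\<forall>v w. smooth_on V (\<lambda>x. h x v w))"

text \<open>Every point has a neighbourhood that is isometric, by a map \<open>\<phi>\<close>, to a Riemannian product
  of \<open>(V1, g1)\<close> and \<open>(V2, g2)\<close>, with \<open>D\<close> and \<open>D'\<close> corresponding to the tangent spaces of
  the factors. The statement being local, the factors may be taken to be domains of
  charts, i.e. open subsets of Euclidean spaces; then \<open>\<phi>\<close> is a chart of \<open>M\<close>.\<close>

definition locally_splits ::
    "('m::topological_space, 'a::euclidean_space \<times> 'b::euclidean_space) chart set \<Rightarrow>
     ('m \<Rightarrow> 'a \<times> 'b \<Rightarrow> 'a \<times> 'b \<Rightarrow> real) \<Rightarrow> ('m \<Rightarrow> ('a \<times> 'b) set) \<Rightarrow> ('m \<Rightarrow> ('a \<times> 'b) set) \<Rightarrow> bool" where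
  "locally_splits A g D D' \<longleftrightarrow>
     (\<forall>p. \<exists>U \<phi> V1 V2 g1 g2. smooth_chart A (U, \<phi>) \<and> p \<in> U \<and> \<phi> ` U = V1 \<times> V2 \<and>
        metric_on V1 g1 \<and> metric_on V2 g2 \<and>
        (\<forall>q\<in>U. let d\<phi> = coord A (U, \<phi>) q in
           (\<forall>v w. g q v w = g1 (fst (\<phi> q)) (fst (d\<phi> v)) (fst (d\<phi> w)) +
                            g2 (snd (\<phi> q)) (snd (d\<phi> v)) (snd (d\<phi> w))) \<and>
           d\<phi> ` D q = UNIV \<times> {0} \<and> d\<phi> ` D' q = {0} \<times> UNIV))"

end

theory Submission
  imports Defs
begin

text \<open>Write \<open>D\<close>, \<open>D'\<close> for the two distributions. By (i), the contorsion \<open>T\<close> vanishes on mixed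
  pairs, and \<open>T x z\<close> stays in the distribution of \<open>x\<close>. Expanding the curvature of \<open>nb + T\<close> along an
  orthonormal frame, every term with \<open>T\<close> is therefore zero or pairs a vector of \<open>D\<close> (or \<open>D'\<close>) with a
  mean curvature vector, so the two connections have the same mixed scalar curvature at each point.
  For the Levi-Civita connection of two orthogonal harmonic foliations, this curvature is minus the
  sum of the squared norms of the two second fundamental forms. As it is nonnegative, both forms
  vanish. In a chart adapted to both foliations, the metric on each factor is then constant along
  the other factor, which gives the local product.\<close>

section \<open>Smooth maps\<close>

text \<open>Curvature takes two derivatives, so identities at a single point are not enough.
  Harmonicity and the conditions on the contorsion hold at every point; they are used as identities
  between fields on a neighbourhood and then differentiated. For instance, the sum of
  \<open>nb (E a) (E a)\<close> over a frame of \<open>D\<close> is a field tangent to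
  \<open>D\<close>, so its product with any field of \<open>D'\<close> vanishes identically.

  An orthonormal frame of one distribution rotates along the other. The rotation coefficients are
  antisymmetric, the second fundamental forms are symmetric by integrability, and the products of
  the two cancel in the sum over the frame. Only squares remain.

  The adjoint of the contorsion enters through \<open>g (T x z) y = g (Tadj x y) z\<close>: a
  vanishing mixed value of \<open>Tadj\<close> says that \<open>T x z\<close> has no component in
  the other distribution, whatever \<open>z\<close> is.

  Integrability supplies one chart for each distribution, not one for both. The common chart takes
  its two groups of coordinates from these two charts and rests on an inverse function theorem with
  smooth inverse, which is why the development starts with calculus of smooth maps.\<close>

lemma frechet_derivative_eqI: "(f has_derivative D) (at x) \<Longrightarrow> frechet_derivative f (at x) = D"
  by (metis frechet_derivative_at)

lemma Ck_on_subset: "Ck_on k S f \<Longrightarrow> T \<subseteq> S \<Longrightarrow> Ck_on k T f"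
  by (induction k arbitrary: f) (auto intro: continuous_on_subset)

text \<open>Since \<open>S\<close> is open, the derivative at a point of \<open>S\<close> does not
  depend on values outside \<open>S\<close>, so agreement on \<open>S\<close> passes to all
  derivatives.\<close>

lemma Ck_on_cong:
  assumes "open S" "\<And>x. x \<in> S \<Longrightarrow> f x = g x" "Ck_on k S f"
  shows "Ck_on k S g"
  using assms(2,3)
proof (induction k arbitrary: f g)
  case 0
  then show ?case using continuous_on_cong[of S S f g] by simp
next
  case (Suc k)
  have d: "(g has_derivative frechet_derivative f (at x)) (at x)" if "x \<in> S" for x
    by (rule has_derivative_transform_within_open[of f _ _ _ S])
      (use Suc.prems assms(1) that in \<open>auto simp: frechet_derivative_works\<close>)
  show ?case
    unfolding Ck_on.simps
  proof (intro conjI ballI allI)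
    fix x assume "x \<in> S" then show "g differentiable at x"
      using d differentiableI by blast
  next
    fix v
    show "Ck_on k S (\<lambda>x. frechet_derivative g (at x) v)"
    proof (rule Suc.IH[of "\<lambda>x. frechet_derivative f (at x) v"])
      show "frechet_derivative f (at x) v = frechet_derivative g (at x) v" if "x \<in> S" for x
        by (simp add: frechet_derivative_eqI[OF d[OF that]])
      show "Ck_on k S (\<lambda>x. frechet_derivative f (at x) v)"
        using Suc.prems(2) by simp
    qed
  qed
qed

lemma Ck_on_Suc_imp: "Ck_on (Suc k) S f \<Longrightarrow> Ck_on k S f"
proof (induction k arbitrary: f)
  case 0
  then show ?case
    by (auto intro!: continuous_at_imp_continuous_on differentiable_imp_continuous_within)
qed auto

text \<open>Serves to verify smoothness on an overlap of charts near one point at a time, with an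
  auxiliary chart that depends on the point.\<close>

lemma Ck_on_local:
  assumes "\<And>x. x \<in> S \<Longrightarrow> \<exists>T. open T \<and> x \<in> T \<and> Ck_on k T f"
  shows "Ck_on k S f"
  using assms
proof (induction k arbitrary: f)
  case 0
  then show ?case
    by (force intro!: continuous_at_imp_continuous_on simp: continuous_on_eq_continuous_at)
next
  case (Suc k)
  show ?case
    unfolding Ck_on.simps
  proof (intro conjI ballI allI)
    fix x assume "x \<in> S" then show "f differentiable at x"
      using Suc.prems by fastforce
  next
    fix v
    show "Ck_on k S (\<lambda>x. frechet_derivative f (at x) v)"
      using Suc.prems by (intro Suc.IH) fastforce
  qed
qed

lemma Ck_on_const [simp]: "Ck_on k S (\<lambda>x. c)"
  by (induction k arbitrary: c) auto

lemma Ck_on_add: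
  assumes "open S" "Ck_on k S f" "Ck_on k S g"
  shows "Ck_on k S (\<lambda>x. f x + g x)"
  using assms(2,3)
proof (induction k arbitrary: f g)
  case 0
  then show ?case by (auto intro: continuous_intros)
next
  case (Suc k)
  have d: "((\<lambda>x. f x + g x) has_derivative
      (\<lambda>v. frechet_derivative f (at x) v + frechet_derivative g (at x) v)) (at x)" if "x \<in> S" for x
    by (rule has_derivative_add) (use Suc.prems that in \<open>auto simp: frechet_derivative_works\<close>)
  show ?case
    unfolding Ck_on.simps
  proof (intro conjI ballI allI)
    fix x assume "x \<in> S" then show "(\<lambda>x. f x + g x) differentiable at x"
      using d differentiableI by blast
  next
    fix v
    show "Ck_on k S (\<lambda>x. frechet_derivative (\<lambda>x. f x + g x) (at x) v)"
      by (rule Ck_on_cong[OF assms(1) _ Suc.IH[of "\<lambda>x. frechet_derivative f (at x) v"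
            "\<lambda>x. frechet_derivative g (at x) v"]])
        (use Suc.prems in \<open>auto simp: frechet_derivative_eqI[OF d]\<close>)
  qed
qed

lemma Ck_on_sum:
  assumes "open S" "finite I" "\<And>i. i \<in> I \<Longrightarrow> Ck_on k S (f i)"
  shows "Ck_on k S (\<lambda>x. \<Sum>i\<in>I. f i x)"
  using assms(2,3) by (induction I) (auto intro: Ck_on_add[OF assms(1)])

lemma Ck_on_bounded_linear:
  assumes "open S" "bounded_linear L" "Ck_on k S f"
  shows "Ck_on k S (\<lambda>x. L (f x))"
  using assms(3)
proof (induction k arbitrary: f)
  case 0
  then show ?case
    by (simp add: assms(2) bounded_linear.continuous_on)
next
  case (Suc k)
  have d: "((\<lambda>x. L (f x)) has_derivative (\<lambda>v. L (frechet_derivative f (at x) v))) (at x)"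
    if "x \<in> S" for x
    by (rule bounded_linear.has_derivative[OF assms(2)])
      (use Suc.prems that in \<open>auto simp: frechet_derivative_works\<close>)
  show ?case
    unfolding Ck_on.simps
  proof (intro conjI ballI allI)
    fix x assume "x \<in> S" then show "(\<lambda>x. L (f x)) differentiable at x"
      using d differentiableI by blast
  next
    fix v
    show "Ck_on k S (\<lambda>x. frechet_derivative (\<lambda>x. L (f x)) (at x) v)"
      by (rule Ck_on_cong[OF assms(1) _ Suc.IH[of "\<lambda>x. frechet_derivative f (at x) v"]])
        (use Suc.prems in \<open>auto simp: frechet_derivative_eqI[OF d]\<close>)
  qed
qed

lemma Ck_on_bounded_bilinear:
  assumes "open S" "bounded_bilinear B" "Ck_on k S f" "Ck_on k S g"
  shows "Ck_on k S (\<lambda>x. B (f x) (g x))"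
  using assms(3,4)
proof (induction k arbitrary: f g)
  case 0
  then show ?case
    by (simp add: assms(2) bounded_bilinear.continuous_on)
next
  case (Suc k)
  have d: "((\<lambda>x. B (f x) (g x)) has_derivative (\<lambda>v. B (f x) (frechet_derivative g (at x) v)
      + B (frechet_derivative f (at x) v) (g x))) (at x)" if "x \<in> S" for x
    by (rule bounded_bilinear.FDERIV[OF assms(2)])
      (use Suc.prems that in \<open>auto simp: frechet_derivative_works\<close>)
  show ?case
    unfolding Ck_on.simps
  proof (intro conjI ballI allI)
    fix x assume "x \<in> S" then show "(\<lambda>x. B (f x) (g x)) differentiable at x"
      using d differentiableI by blast
  next
    fix v
    have "Ck_on k S (\<lambda>x. B (f x) (frechet_derivative g (at x) v)
      + B (frechet_derivative f (at x) v) (g x))"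
      using Suc.prems Ck_on_Suc_imp[OF Suc.prems(1)] Ck_on_Suc_imp[OF Suc.prems(2)]
      by (intro Ck_on_add[OF assms(1)] Suc.IH) auto
    then show "Ck_on k S (\<lambda>x. frechet_derivative (\<lambda>x. B (f x) (g x)) (at x) v)"
      by (rule Ck_on_cong[OF assms(1), rotated]) (simp add: frechet_derivative_eqI[OF d])
  qed
qed

text \<open>\<open>Ck_on\<close> speaks of derivatives in fixed directions only. This expansion
  reduces a derivative applied to a moving vector to fixed directions with scalar
  coefficients.\<close>

lemma frechet_derivative_Basis:
  fixes f :: "'a::euclidean_space \<Rightarrow> 'b::real_normed_vector"
  assumes "f differentiable at x"
  shows "frechet_derivative f (at x) v = (\<Sum>b\<in>Basis. (v \<bullet> b) *\<^sub>R frechet_derivative f (at x) b)"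
proof -
  interpret linear "frechet_derivative f (at x)"
    using assms by (rule linear_frechet_derivative)
  have "frechet_derivative f (at x) v = frechet_derivative f (at x) (\<Sum>b\<in>Basis. (v \<bullet> b) *\<^sub>R b)"
    by (simp add: euclidean_representation)
  then show ?thesis by (simp add: sum scale)
qed

text \<open>By the chain rule the derivative of \<open>g\<close> is applied to the moving vector
  \<open>frechet_derivative f (at x) v\<close>. Expanded over the basis, the result is a sum of
  products of maps of class \<open>k\<close>.\<close>

lemma Ck_on_compose:
  fixes f :: "'a::real_normed_vector \<Rightarrow> 'b::euclidean_space"
  assumes "open S" "open T" "f ` S \<subseteq> T" "Ck_on k S f" "Ck_on k T g"
  shows "Ck_on k S (\<lambda>x. g (f x))"
  using assms(4,5)
proof (induction k arbitrary: g)
  case 0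
  then show ?case
    using continuous_on_compose2[of T g S f] assms(3) by auto
next
  case (Suc k)
  have fS: "f x \<in> T" if "x \<in> S" for x using assms(3) that by auto
  have d: "((\<lambda>x. g (f x)) has_derivative
      (\<lambda>v. frechet_derivative g (at (f x)) (frechet_derivative f (at x) v))) (at x)" if "x \<in> S" for x
    by (rule has_derivative_compose[of f _ x UNIV g])
      (use Suc.prems that fS in \<open>auto simp: frechet_derivative_works\<close>)
  show ?case
    unfolding Ck_on.simps
  proof (intro conjI ballI allI)
    fix x assume "x \<in> S" then show "(\<lambda>x. g (f x)) differentiable at x"
      using d differentiableI by blast
  next
    fix v
    have "Ck_on k S (\<lambda>x. \<Sum>b\<in>Basis. (frechet_derivative f (at x) v \<bullet> b) *\<^sub>R
        frechet_derivative g (at (f x)) b)"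
    proof (intro Ck_on_sum assms(1) finite_Basis)
      fix b :: 'b
      have "Ck_on k S (\<lambda>x. frechet_derivative g (at (f x)) b)"
        using Suc.prems Ck_on_Suc_imp[OF Suc.prems(1)] by (intro Suc.IH) auto
      moreover have "Ck_on k S (\<lambda>x. frechet_derivative f (at x) v \<bullet> b)"
        using Suc.prems by (intro Ck_on_bounded_linear[OF assms(1) bounded_linear_inner_left]) auto
      ultimately show "Ck_on k S (\<lambda>x. (frechet_derivative f (at x) v \<bullet> b) *\<^sub>R
          frechet_derivative g (at (f x)) b)"
        by (rule Ck_on_bounded_bilinear[OF assms(1) bounded_bilinear_scaleR, rotated])
    qed
    then show "Ck_on k S (\<lambda>x. frechet_derivative (\<lambda>x. g (f x)) (at x) v)"
      using Suc.prems(2) fS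
      by (elim Ck_on_cong[OF assms(1), rotated])
        (simp add: frechet_derivative_eqI[OF d] flip: frechet_derivative_Basis)
  qed
qed

text \<open>With \<open>u = inverse (sqrt t)\<close> the derivative is \<open>- u^3 / 2\<close>, a
  polynomial in \<open>u\<close>, so each level follows from the one below. The function normalises
  vectors when frames are orthonormalised.\<close>

lemma Ck_on_inverse_sqrt: "Ck_on k {0<..} (\<lambda>t. inverse (sqrt t))"
proof (induction k)
  case 0
  then show ?case by (auto intro!: continuous_intros)
next
  case (Suc k)
  have d: "((\<lambda>t. inverse (sqrt t)) has_derivative
      (\<lambda>v. v * (- 1/2 * (inverse (sqrt t) * (inverse (sqrt t) * inverse (sqrt t)))))) (at t)"
    if "t \<in> {0<..}" for t
  proof -
    have "((\<lambda>t. inverse (sqrt t)) has_real_derivative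
        - (inverse (sqrt t) * (inverse (sqrt t) / 2) * inverse (sqrt t))) (at t)"
      by (rule DERIV_inverse'[OF DERIV_real_sqrt]) (use that in auto)
    then show ?thesis
      unfolding has_field_derivative_def by (rule has_derivative_eq_rhs) (auto simp: fun_eq_iff)
  qed
  show ?case
    unfolding Ck_on.simps
  proof (intro conjI ballI allI)
    fix t :: real assume "t \<in> {0<..}" then show "(\<lambda>t. inverse (sqrt t)) differentiable at t"
      using d differentiableI by blast
  next
    fix v :: real
    have "Ck_on k {0<..} (\<lambda>t. v * (- 1/2 * (inverse (sqrt t) * (inverse (sqrt t) * inverse (sqrt t)))))"
      by (intro Ck_on_bounded_bilinear[OF _ bounded_bilinear_mult] Suc) auto
    then show "Ck_on k {0<..} (\<lambda>t. frechet_derivative (\<lambda>t. inverse (sqrt t)) (at t) v)"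
      by (rule Ck_on_cong[rotated 2]) (simp_all add: frechet_derivative_eqI[OF d])
  qed
qed

section \<open>Closure properties of smooth maps\<close>

lemma smooth_on_subset: "smooth_on S f \<Longrightarrow> T \<subseteq> S \<Longrightarrow> smooth_on T f"
  unfolding smooth_on_def by (intro allI, rule Ck_on_subset) auto

lemma smooth_on_cong:
  "open S \<Longrightarrow> smooth_on S f \<Longrightarrow> (\<And>x. x \<in> S \<Longrightarrow> f x = g x) \<Longrightarrow> smooth_on S g"
  unfolding smooth_on_def by (intro allI, rule Ck_on_cong[of S f g]) auto

lemma smooth_on_local:
  assumes "\<And>x. x \<in> S \<Longrightarrow> \<exists>T. open T \<and> x \<in> T \<and> smooth_on T f"
  shows "smooth_on S f"
  unfolding smooth_on_def
proof (intro allI Ck_on_local)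
  fix k x assume "x \<in> S"
  then obtain T where "open T" "x \<in> T" "smooth_on T f" using assms by blast
  then show "\<exists>T. open T \<and> x \<in> T \<and> Ck_on k T f" by (auto simp: smooth_on_def)
qed

lemma smooth_on_const [simp]: "smooth_on S (\<lambda>x. c)"
  by (simp add: smooth_on_def)

lemma smooth_on_add:
  "open S \<Longrightarrow> smooth_on S f \<Longrightarrow> smooth_on S g \<Longrightarrow> smooth_on S (\<lambda>x. f x + g x)"
  unfolding smooth_on_def by (intro allI, rule Ck_on_add) auto

lemma smooth_on_sum:
  "open S \<Longrightarrow> finite I \<Longrightarrow> (\<And>i. i \<in> I \<Longrightarrow> smooth_on S (f i)) \<Longrightarrow> smooth_on S (\<lambda>x. \<Sum>i\<in>I. f i x)"
  unfolding smooth_on_def by (intro allI, rule Ck_on_sum) auto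

lemma smooth_on_bounded_linear:
  "open S \<Longrightarrow> bounded_linear L \<Longrightarrow> smooth_on S f \<Longrightarrow> smooth_on S (\<lambda>x. L (f x))"
  unfolding smooth_on_def by (intro allI, rule Ck_on_bounded_linear) auto

lemma smooth_on_bounded_bilinear:
  "open S \<Longrightarrow> bounded_bilinear B \<Longrightarrow> smooth_on S f \<Longrightarrow> smooth_on S g \<Longrightarrow>
    smooth_on S (\<lambda>x. B (f x) (g x))"
  unfolding smooth_on_def by (intro allI, rule Ck_on_bounded_bilinear) auto

lemma smooth_on_ident: "smooth_on S (\<lambda>x. x)"
proof -
  have "Ck_on k S (\<lambda>x. x)" for k
    by (cases k) (auto simp: continuous_on_id)
  then show ?thesis by (simp add: smooth_on_def)
qed

lemma smooth_on_compose:
  fixes f :: "'a::real_normed_vector \<Rightarrow> 'b::euclidean_space"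
  shows "open S \<Longrightarrow> open T \<Longrightarrow> smooth_on S f \<Longrightarrow> smooth_on T g \<Longrightarrow> f ` S \<subseteq> T \<Longrightarrow>
    smooth_on S (\<lambda>x. g (f x))"
  unfolding smooth_on_def by (intro allI, rule Ck_on_compose) auto

lemma smooth_on_continuous: "smooth_on S f \<Longrightarrow> continuous_on S f"
  unfolding smooth_on_def by (drule spec[of _ 0]) simp

lemma smooth_on_differentiable: "smooth_on S f \<Longrightarrow> x \<in> S \<Longrightarrow> f differentiable at x"
  unfolding smooth_on_def by (drule spec[of _ 1]) simp

lemma smooth_on_has_derivative:
  "smooth_on S f \<Longrightarrow> x \<in> S \<Longrightarrow> (f has_derivative frechet_derivative f (at x)) (at x)"
  using smooth_on_differentiable[of S f x] frechet_derivative_works[of f "at x"] by simp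

lemma smooth_on_frechet_derivative:
  "smooth_on S f \<Longrightarrow> smooth_on S (\<lambda>x. frechet_derivative f (at x) v)"
  unfolding smooth_on_def by (intro allI, drule_tac x="Suc k" in spec) simp

lemma smooth_on_Pair:
  assumes "open S" "smooth_on S f" "smooth_on S g"
  shows "smooth_on S (\<lambda>x. (f x, g x))"
proof -
  have "smooth_on S (\<lambda>x. (f x, 0) + (0, g x))"
    using assms
    by (intro smooth_on_add smooth_on_bounded_linear[OF _ bounded_linear_Pair[OF bounded_linear_ident bounded_linear_zero]]
        smooth_on_bounded_linear[OF _ bounded_linear_Pair[OF bounded_linear_zero bounded_linear_ident]])
  then show ?thesis by simp
qed

section \<open>Symmetry of second derivatives\<close>

lemma has_real_derivative_line:
  fixes f :: "'a::real_normed_vector \<Rightarrow> real"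
  assumes "(f has_derivative f') (at (p + a *\<^sub>R v))"
  shows "((\<lambda>s. f (p + s *\<^sub>R v)) has_real_derivative f' v) (at a)"
proof -
  have "((\<lambda>s. p + s *\<^sub>R v) has_derivative (\<lambda>h. h *\<^sub>R v)) (at a)"
    by (auto intro!: derivative_eq_intros)
  from has_derivative_compose[OF this assms]
  have "((\<lambda>s. f (p + s *\<^sub>R v)) has_derivative (\<lambda>h. f' (h *\<^sub>R v))) (at a)" .
  then show ?thesis
    unfolding has_field_derivative_def
    by (rule has_derivative_eq_rhs)
      (use has_derivative_bounded_linear[OF assms] in \<open>auto simp: linear_simps\<close>)
qed

text \<open>The mean value theorem is applied twice: to the difference of \<open>f\<close> in
  direction \<open>w\<close>, regarded as a function along \<open>v\<close>, and then to the
  resulting derivative along \<open>w\<close>. The second difference itself is unchanged when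
  \<open>v\<close> and \<open>w\<close> are exchanged.\<close>

lemma mixed_second_difference:
  fixes f :: "'a::real_normed_vector \<Rightarrow> real"
  assumes "smooth_on S f" "t > 0" and S: "\<And>a b. 0 \<le> a \<Longrightarrow> a \<le> t \<Longrightarrow> 0 \<le> b \<Longrightarrow> b \<le> t \<Longrightarrow> x + a *\<^sub>R v + b *\<^sub>R w \<in> S"
  shows "\<exists>a b. 0 \<le> a \<and> a \<le> t \<and> 0 \<le> b \<and> b \<le> t \<and>
     f (x + t *\<^sub>R v + t *\<^sub>R w) - f (x + t *\<^sub>R v) - f (x + t *\<^sub>R w) + f x =
     t * t * frechet_derivative (\<lambda>y. frechet_derivative f (at y) v) (at (x + a *\<^sub>R v + b *\<^sub>R w)) w"
proof -
  let ?d = "\<lambda>y. frechet_derivative f (at y) v"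
  have d1: "((\<lambda>a. f (x + b *\<^sub>R w + a *\<^sub>R v)) has_real_derivative ?d (x + b *\<^sub>R w + a *\<^sub>R v)) (at a)"
    if "0 \<le> a" "a \<le> t" "0 \<le> b" "b \<le> t" for a b
    by (intro has_real_derivative_line smooth_on_has_derivative[OF assms(1)])
      (use S[OF that] in \<open>simp add: ac_simps\<close>)
  have sd: "smooth_on S ?d" by (rule smooth_on_frechet_derivative[OF assms(1)])
  have d2: "((\<lambda>b. ?d (x + a *\<^sub>R v + b *\<^sub>R w)) has_real_derivative
     frechet_derivative ?d (at (x + a *\<^sub>R v + b *\<^sub>R w)) w) (at b)"
    if "0 \<le> a" "a \<le> t" "0 \<le> b" "b \<le> t" for a b
    by (intro has_real_derivative_line smooth_on_has_derivative[OF sd] S that)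
  define \<phi> where "\<phi> a = f (x + t *\<^sub>R w + a *\<^sub>R v) - f (x + 0 *\<^sub>R w + a *\<^sub>R v)" for a
  have "\<exists>a>0. a < t \<and> \<phi> t - \<phi> 0 = (t - 0) * (?d (x + t *\<^sub>R w + a *\<^sub>R v) - ?d (x + 0 *\<^sub>R w + a *\<^sub>R v))"
  proof (rule MVT2)
    fix a assume "0 \<le> a" "a \<le> t"
    then show "(\<phi> has_real_derivative ?d (x + t *\<^sub>R w + a *\<^sub>R v) - ?d (x + 0 *\<^sub>R w + a *\<^sub>R v)) (at a)"
      unfolding \<phi>_def using assms(2) by (intro DERIV_diff d1) auto
  qed (use assms in auto)
  then obtain a where a: "0 < a" "a < t"
    "\<phi> t - \<phi> 0 = (t - 0) * (?d (x + t *\<^sub>R w + a *\<^sub>R v) - ?d (x + 0 *\<^sub>R w + a *\<^sub>R v))" by blast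
  have "\<exists>b>0. b < t \<and> ?d (x + a *\<^sub>R v + t *\<^sub>R w) - ?d (x + a *\<^sub>R v + 0 *\<^sub>R w) =
     (t - 0) * frechet_derivative ?d (at (x + a *\<^sub>R v + b *\<^sub>R w)) w"
    by (rule MVT2[OF _ d2]) (use a assms in auto)
  then obtain b where b: "0 < b" "b < t" "?d (x + a *\<^sub>R v + t *\<^sub>R w) - ?d (x + a *\<^sub>R v + 0 *\<^sub>R w) =
     (t - 0) * frechet_derivative ?d (at (x + a *\<^sub>R v + b *\<^sub>R w)) w" by blast
  have "f (x + t *\<^sub>R v + t *\<^sub>R w) - f (x + t *\<^sub>R v) - f (x + t *\<^sub>R w) + f x = \<phi> t - \<phi> 0"
    by (simp add: \<phi>_def ac_simps)
  also have "\<dots> = t * (?d (x + a *\<^sub>R v + t *\<^sub>R w) - ?d (x + a *\<^sub>R v + 0 *\<^sub>R w))"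
    using a(3) by (simp add: ac_simps)
  also have "\<dots> = t * t * frechet_derivative ?d (at (x + a *\<^sub>R v + b *\<^sub>R w)) w"
    by (simp only: b(3)) simp
  finally show ?thesis
    using a b by (intro exI[of _ a] exI[of _ b]) simp
qed

text \<open>The second difference over a small parallelogram can be evaluated in either order, so
  one mixed derivative at some point near \<open>x\<close> equals the other at another such point.
  Continuity at \<open>x\<close> then excludes a gap.\<close>

lemma second_derivative_symmetric_real:
  fixes f :: "'a::real_normed_vector \<Rightarrow> real"
  assumes "open S" "smooth_on S f" "x \<in> S"
  shows "frechet_derivative (\<lambda>y. frechet_derivative f (at y) v) (at x) w =
         frechet_derivative (\<lambda>y. frechet_derivative f (at y) w) (at x) v" (is "?A x = ?B x")
proof (rule ccontr)
  assume ne: "?A x \<noteq> ?B x"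
  define e where "e = \<bar>?A x - ?B x\<bar> / 2"
  have e: "e > 0" using ne by (simp add: e_def)
  have cont: "isCont (\<lambda>x. frechet_derivative (\<lambda>y. frechet_derivative f (at y) v) (at x) w) x" for v w
    using smooth_on_continuous[OF smooth_on_frechet_derivative[OF smooth_on_frechet_derivative[OF assms(2)]]]
      assms(1,3) continuous_on_eq_continuous_at by blast
  obtain d1 where d1: "d1 > 0" "\<And>y. dist y x < d1 \<Longrightarrow> dist (?A y) (?A x) < e"
    using cont[of v w, unfolded continuous_at_eps_delta] e by blast
  obtain d2 where d2: "d2 > 0" "\<And>y. dist y x < d2 \<Longrightarrow> dist (?B y) (?B x) < e"
    using cont[of w v, unfolded continuous_at_eps_delta] e by blast
  obtain d3 where d3: "d3 > 0" "ball x d3 \<subseteq> S" using assms openE by blast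
  define d where "d = min d1 (min d2 d3)"
  \<comment> \<open>Keeps the parallelogram with sides \<open>t *\<^sub>R v\<close> and
    \<open>t *\<^sub>R w\<close> within distance \<open>d\<close> of \<open>x\<close>; the summand 1
    avoids a zero denominator.\<close>
  define t where "t = d / (2 * (norm v + norm w + 1))"
  have nn: "norm v + norm w + 1 > 0" using norm_ge_zero[of v] norm_ge_zero[of w] by linarith
  have t: "t > 0" using d1 d2 d3 nn by (simp add: t_def d_def)
  have near: "dist (x + a *\<^sub>R v + b *\<^sub>R w) x < d" if "0 \<le> a" "a \<le> t" "0 \<le> b" "b \<le> t" for a b
  proof -
    have "dist (x + a *\<^sub>R v + b *\<^sub>R w) x = norm (a *\<^sub>R v + b *\<^sub>R w)"
      by (simp add: dist_norm add.assoc)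
    also have "\<dots> \<le> a * norm v + b * norm w"
      using that norm_triangle_ineq[of "a *\<^sub>R v" "b *\<^sub>R w"] by simp
    also have "\<dots> \<le> t * norm v + t * norm w"
      using that by (intro add_mono mult_right_mono) auto
    also have "\<dots> < t * (2 * (norm v + norm w + 1))"
      unfolding distrib_left[symmetric] using t nn by (intro mult_strict_left_mono) auto
    also have "\<dots> = d" using nn by (simp add: t_def)
    finally show ?thesis .
  qed
  have inS: "x + a *\<^sub>R v + b *\<^sub>R w \<in> S" if "0 \<le> a" "a \<le> t" "0 \<le> b" "b \<le> t" for a b
    using near[OF that] d3 by (auto simp: d_def dist_commute)
  have sw: "x + p *\<^sub>R w + q *\<^sub>R v = x + q *\<^sub>R v + p *\<^sub>R w" for p q
    by (simp add: ac_simps)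
  have inS': "x + a *\<^sub>R w + b *\<^sub>R v \<in> S" if "0 \<le> a" "a \<le> t" "0 \<le> b" "b \<le> t" for a b
    unfolding sw by (intro inS that)
  obtain a b where ab: "0 \<le> a" "a \<le> t" "0 \<le> b" "b \<le> t"
     "f (x + t *\<^sub>R v + t *\<^sub>R w) - f (x + t *\<^sub>R v) - f (x + t *\<^sub>R w) + f x = t * t * ?A (x + a *\<^sub>R v + b *\<^sub>R w)"
    using mixed_second_difference[OF assms(2) t inS] by blast
  obtain a' b' where ab': "0 \<le> a'" "a' \<le> t" "0 \<le> b'" "b' \<le> t"
     "f (x + t *\<^sub>R w + t *\<^sub>R v) - f (x + t *\<^sub>R w) - f (x + t *\<^sub>R v) + f x = t * t * ?B (x + b' *\<^sub>R v + a' *\<^sub>R w)"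
    using mixed_second_difference[OF assms(2) t inS'] unfolding sw by blast
  have "t * t * ?A (x + a *\<^sub>R v + b *\<^sub>R w) = t * t * ?B (x + b' *\<^sub>R v + a' *\<^sub>R w)"
    using ab(5) ab'(5) unfolding sw by linarith
  then have "?A (x + a *\<^sub>R v + b *\<^sub>R w) = ?B (x + b' *\<^sub>R v + a' *\<^sub>R w)"
    using t by simp
  moreover have "dist (?A (x + a *\<^sub>R v + b *\<^sub>R w)) (?A x) < e"
    using near[OF ab(1-4)] by (intro d1) (simp add: d_def)
  moreover have "dist (?B (x + b' *\<^sub>R v + a' *\<^sub>R w)) (?B x) < e"
    using near[OF ab'(3,4,1,2)] by (intro d2) (simp add: d_def)
  \<comment> \<open>A common value cannot lie within half the gap of both limits.\<close>
  moreover have "False" if "a = b" "\<bar>a - c\<bar> < \<bar>c - d\<bar> / 2" "\<bar>b - d\<bar> < \<bar>c - d\<bar> / 2" for a b c d :: real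
    using that abs_triangle_ineq[of "c - a" "a - d"] abs_minus_commute[of a c] by auto
  ultimately show False
    unfolding e_def dist_real_def by blast
qed

lemma second_derivative_symmetric:
  fixes f :: "'a::real_normed_vector \<Rightarrow> 'b::euclidean_space"
  assumes "open S" "smooth_on S f" "x \<in> S"
  shows "frechet_derivative (\<lambda>y. frechet_derivative f (at y) v) (at x) w =
         frechet_derivative (\<lambda>y. frechet_derivative f (at y) w) (at x) v"
proof (rule euclidean_eqI)
  fix b :: 'b
  have *: "frechet_derivative (\<lambda>y. frechet_derivative f (at y) v) (at x) w \<bullet> b =
    frechet_derivative (\<lambda>y. frechet_derivative (\<lambda>y. f y \<bullet> b) (at y) v) (at x) w" for v w
  proof -
    have 1: "((\<lambda>y. f y \<bullet> b) has_derivative (\<lambda>v. frechet_derivative f (at y) v \<bullet> b)) (at y)" if "y \<in> S" for y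
      using smooth_on_has_derivative[OF assms(2) that] by (rule has_derivative_inner_left)
    have 2: "((\<lambda>y. frechet_derivative f (at y) v \<bullet> b) has_derivative
      (\<lambda>w. frechet_derivative (\<lambda>y. frechet_derivative f (at y) v) (at x) w \<bullet> b)) (at x)"
      using smooth_on_has_derivative[OF smooth_on_frechet_derivative[OF assms(2)] assms(3)]
      by (rule has_derivative_inner_left)
    have "((\<lambda>y. frechet_derivative (\<lambda>y. f y \<bullet> b) (at y) v) has_derivative
      (\<lambda>w. frechet_derivative (\<lambda>y. frechet_derivative f (at y) v) (at x) w \<bullet> b)) (at x)"
      by (rule has_derivative_transform_within_open[OF 2 assms(1,3)])
        (simp add: frechet_derivative_eqI[OF 1])
    then show ?thesis by (rule frechet_derivative_eqI[THEN fun_cong, symmetric])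
  qed
  show "frechet_derivative (\<lambda>y. frechet_derivative f (at y) v) (at x) w \<bullet> b =
         frechet_derivative (\<lambda>y. frechet_derivative f (at y) w) (at x) v \<bullet> b"
    unfolding * by (rule second_derivative_symmetric_real[OF assms(1) _ assms(3)])
      (rule smooth_on_bounded_linear[OF assms(1) bounded_linear_inner_left assms(2)])
qed

section \<open>Inverses of families of linear maps\<close>

text \<open>Near \<open>x\<close> the factor \<open>f\<close> is of first order, so replacing
  \<open>g y\<close> by \<open>g x\<close> changes the product by a term of higher order. Mere
  continuity of \<open>g\<close> suffices, and that is all that is known of an inverse family before
  its derivative is found.\<close>

lemma has_derivative_scaleR_vanishing:
  fixes f :: "'a::real_normed_vector \<Rightarrow> real" and g :: "'a \<Rightarrow> 'b::real_normed_vector"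
  assumes f: "(f has_derivative D) (at x)" and "f x = 0" and g: "isCont g x"
  shows "((\<lambda>y. f y *\<^sub>R g y) has_derivative (\<lambda>h. D h *\<^sub>R g x)) (at x)"
proof -
  have blD: "bounded_linear D" using f by (rule has_derivative_bounded_linear)
  have g0: "((\<lambda>y. g y - g x) \<longlongrightarrow> 0) (at x)"
    using g by (simp add: isCont_def LIM_zero)
  have quot: "((\<lambda>y. norm (f y - f x - D (y - x)) / norm (y - x)) \<longlongrightarrow> 0) (at x)"
    using f by (simp add: has_derivative_iff_norm)
  have "((\<lambda>y. (norm (f y - f x - D (y - x)) / norm (y - x) + onorm D) * norm (g y - g x)) \<longlongrightarrow> 0) (at x)"
    using tendsto_mult[OF tendsto_add[OF quot tendsto_const] tendsto_norm_zero[OF g0]] by simp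
  moreover have "norm (norm (f y *\<^sub>R (g y - g x) - f x *\<^sub>R (g x - g x) - 0) / norm (y - x))
      \<le> (norm (f y - f x - D (y - x)) / norm (y - x) + onorm D) * norm (g y - g x)" for y
  proof -
    have "\<bar>f y\<bar> \<le> \<bar>f y - f x - D (y - x)\<bar> + \<bar>D (y - x)\<bar>"
      using \<open>f x = 0\<close> by simp
    then have "\<bar>f y\<bar> / norm (y - x) \<le> (\<bar>f y - f x - D (y - x)\<bar> + \<bar>D (y - x)\<bar>) / norm (y - x)"
      by (rule divide_right_mono) simp
    also have "\<dots> \<le> \<bar>f y - f x - D (y - x)\<bar> / norm (y - x) + onorm D"
      using le_onorm[OF blD, of "y - x"] by (simp add: add_divide_distrib)
    finally have "\<bar>f y\<bar> / norm (y - x) * norm (g y - g x) \<le>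
       (\<bar>f y - f x - D (y - x)\<bar> / norm (y - x) + onorm D) * norm (g y - g x)"
      by (rule mult_right_mono) simp
    then show ?thesis using \<open>f x = 0\<close> by simp
  qed
  ultimately have "((\<lambda>y. norm (f y *\<^sub>R (g y - g x) - f x *\<^sub>R (g x - g x) - 0) / norm (y - x)) \<longlongrightarrow> 0) (at x)"
    by (rule Lim_null_comparison[OF always_eventually[OF allI], rotated])
  then have "((\<lambda>y. f y *\<^sub>R (g y - g x)) has_derivative (\<lambda>h. 0)) (at x)"
    by (simp add: has_derivative_iff_norm)
  moreover have "((\<lambda>y. f y *\<^sub>R g x) has_derivative (\<lambda>h. D h *\<^sub>R g x)) (at x)"
    using f by (rule has_derivative_scaleR_left)
  ultimately have "((\<lambda>y. f y *\<^sub>R g x + f y *\<^sub>R (g y - g x)) has_derivative (\<lambda>h. D h *\<^sub>R g x + 0)) (at x)"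
    by (intro has_derivative_add)
  then show ?thesis by (simp add: scaleR_diff_right)
qed

text \<open>Regularity in \<open>x\<close> is expressed vector by vector, through
  \<open>L x w\<close> with \<open>w\<close> fixed, because this is the form in which
  \<open>Ck_on\<close> delivers derivatives.\<close>

locale invertible_family =
  fixes S :: "'x::real_normed_vector set" and L M :: "'x \<Rightarrow> 'e::euclidean_space \<Rightarrow> 'e"
  assumes open_dom: "open S"
    and linL: "x \<in> S \<Longrightarrow> linear (L x)" and linM: "x \<in> S \<Longrightarrow> linear (M x)"
    and inv_left: "x \<in> S \<Longrightarrow> M x (L x w) = w" and inv_right: "x \<in> S \<Longrightarrow> L x (M x w) = w"
begin

lemma linear_Basis_sum:
  assumes "linear f" shows "f (w::'e) = (\<Sum>b\<in>Basis. (w \<bullet> b) *\<^sub>R (f b :: 'c::real_vector))"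
proof -
  interpret linear f by fact
  have "f w = f (\<Sum>b\<in>Basis. (w \<bullet> b) *\<^sub>R b)" by (simp add: euclidean_representation)
  then show ?thesis by (simp add: sum scale)
qed

text \<open>If \<open>B\<close> bounds \<open>M x0\<close> and \<open>L x\<close> is within
  \<open>1 / (2 * B)\<close> of \<open>L x0\<close>, then \<open>norm w\<close> is at most
  \<open>2 * B * norm (L x w)\<close>. This is applied to \<open>w = M x v - M x0 v\<close>, whose
  image under \<open>L x\<close> tends to zero.\<close>

lemma continuous_inverse:
  assumes cont: "\<And>w. continuous_on S (\<lambda>x. L x w)"
  shows "continuous_on S (\<lambda>x. M x v)"
proof (intro continuous_at_imp_continuous_on ballI)
  fix x0 assume x0: "x0 \<in> S"
  have contL: "((\<lambda>x. L x w - L x0 w) \<longlongrightarrow> 0) (at x0)" for w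
    using cont[of w] x0 open_dom by (intro LIM_zero) (simp add: continuous_on_eq_continuous_at isCont_def)
  obtain B where B: "B > 0" "\<And>u. norm (M x0 u) \<le> B * norm u"
    using linear_bounded_pos[OF linM[OF x0]] by blast
  \<comment> \<open>Bounds the operator norm of \<open>L x - L x0\<close>, since each coordinate of
    a vector is at most its norm.\<close>
  define \<delta> where "\<delta> x = (\<Sum>b\<in>Basis. norm (L x b - L x0 b))" for x
  have "(\<delta> \<longlongrightarrow> (\<Sum>b::'e\<in>Basis. 0)) (at x0)"
    unfolding \<delta>_def by (intro tendsto_sum tendsto_norm_zero contL)
  then have "\<forall>\<^sub>F x in at x0. \<delta> x < 1 / (2 * B)"
    using B(1) by (intro order_tendstoD) auto
  moreover have "\<forall>\<^sub>F x in at x0. x \<in> S"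
    using open_dom x0 eventually_at_topological by blast
  ultimately have bound: "\<forall>\<^sub>F x in at x0. norm (M x v - M x0 v) \<le> 2 * B * norm (L x (M x0 v) - L x0 (M x0 v))"
  proof eventually_elim
    case (elim x)
    have lin: "linear (\<lambda>w. L x w - L x0 w)"
      using linL[OF elim(2)] linL[OF x0] by (rule linear_compose_sub)
    have d: "norm (L x w - L x0 w) \<le> norm w * \<delta> x" for w
    proof -
      have "norm (L x w - L x0 w) = norm (\<Sum>b\<in>Basis. (w \<bullet> b) *\<^sub>R (L x b - L x0 b))"
        by (simp only: linear_Basis_sum[OF lin, of w])
      also have "\<dots> \<le> (\<Sum>b\<in>Basis. norm w * norm (L x b - L x0 b))"
        by (rule sum_norm_le) (simp add: mult_right_mono Basis_le_norm)
      finally show ?thesis by (simp add: \<delta>_def sum_distrib_left)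
    qed
    have inv: "norm w \<le> 2 * B * norm (L x w)" for w
    proof -
      have "norm w = norm (M x0 (L x0 w))" by (simp add: inv_left[OF x0])
      also have "\<dots> \<le> B * norm (L x0 w)" by (rule B)
      also have "norm (L x0 w) \<le> norm (L x w) + norm (L x w - L x0 w)"
        using norm_triangle_sub[of "L x0 w" "L x w"] by (simp add: norm_minus_commute)
      also have "norm (L x w - L x0 w) \<le> norm w * (1 / (2 * B))"
        using order_trans[OF d mult_left_mono[OF less_imp_le[OF elim(1)] norm_ge_zero]] .
      finally show ?thesis using B(1) by (simp add: field_simps)
    qed
    interpret lx: linear "L x" by (rule linL[OF elim(2)])
    have "L x (M x v - M x0 v) = - (L x (M x0 v) - L x0 (M x0 v))"
      by (simp add: lx.diff inv_right[OF elim(2)] inv_right[OF x0])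
    then show ?case using inv[of "M x v - M x0 v"] by (simp only: norm_minus_cancel)
  qed
  have "((\<lambda>x. M x v - M x0 v) \<longlongrightarrow> 0) (at x0)"
    by (rule Lim_null_comparison[OF bound])
      (use tendsto_mult[OF tendsto_const[of "2*B"] tendsto_norm_zero[OF contL]] in simp)
  then show "isCont (\<lambda>x. M x v) x0"
    by (simp add: isCont_def LIM_zero_iff)
qed

text \<open>Start from \<open>M y v = M x v - M y (L y (M x v) - v)\<close>. The vector in the last
  bracket vanishes at \<open>y = x\<close>, so after expanding it over the basis only the continuity
  of \<open>M\<close> at \<open>x\<close> is used.\<close>

lemma has_derivative_inverse_family:
  assumes x: "x \<in> S" and diff: "\<And>w y. y \<in> S \<Longrightarrow> (\<lambda>x. L x w) differentiable at y"
  shows "((\<lambda>x. M x v) has_derivative (\<lambda>h. - M x (frechet_derivative (\<lambda>y. L y (M x v)) (at x) h))) (at x)"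
proof -
  let ?D = "frechet_derivative (\<lambda>y. L y (M x v)) (at x)"
  have contL: "continuous_on S (\<lambda>x. L x w)" for w
    using diff by (auto intro!: continuous_at_imp_continuous_on differentiable_imp_continuous_within)
  have contM: "isCont (\<lambda>x. M x b) x" for b
    using continuous_inverse[OF contL] x open_dom continuous_on_eq_continuous_at by blast
  have D: "((\<lambda>y. L y (M x v) - v) has_derivative ?D) (at x)"
    using diff[OF x] by (auto intro!: derivative_eq_intros simp: frechet_derivative_works)
  have "((\<lambda>y. ((L y (M x v) - v) \<bullet> b) *\<^sub>R M y b) has_derivative (\<lambda>h. (?D h \<bullet> b) *\<^sub>R M x b)) (at x)" for b
    by (rule has_derivative_scaleR_vanishing[OF has_derivative_inner_left[OF D] _ contM])
      (simp add: inv_right[OF x])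
  then have "((\<lambda>y. M x v - (\<Sum>b\<in>Basis. ((L y (M x v) - v) \<bullet> b) *\<^sub>R M y b)) has_derivative
     (\<lambda>h. 0 - (\<Sum>b\<in>Basis. (?D h \<bullet> b) *\<^sub>R M x b))) (at x)"
    by (intro has_derivative_diff has_derivative_sum has_derivative_const)
  then have "((\<lambda>y. M x v - (\<Sum>b\<in>Basis. ((L y (M x v) - v) \<bullet> b) *\<^sub>R M y b)) has_derivative
     (\<lambda>h. - M x (?D h))) (at x)"
    by (simp add: linear_Basis_sum[OF linM[OF x], symmetric])
  then show ?thesis
  proof (rule has_derivative_transform_within_open[OF _ open_dom x])
    fix y assume y: "y \<in> S"
    interpret My: linear "M y" by (rule linM[OF y])
    show "M x v - (\<Sum>b\<in>Basis. ((L y (M x v) - v) \<bullet> b) *\<^sub>R M y b) = M y v"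
      by (simp add: linear_Basis_sum[OF linM[OF y], symmetric] My.diff inv_left[OF y])
  qed
qed

text \<open>The derivative of \<open>M\<close> is an expression in \<open>M\<close> itself and the
  derivative of \<open>L\<close>, so class \<open>k\<close> of \<open>M\<close> yields class
  \<open>Suc k\<close>.\<close>

lemma Ck_on_inverse_family:
  assumes "\<And>w. Ck_on k S (\<lambda>x. L x w)"
  shows "Ck_on k S (\<lambda>x. M x v)"
  using assms
proof (induction k arbitrary: v)
  case 0
  then show ?case using continuous_inverse[of v] by simp
next
  case (Suc k)
  note IH = Suc.IH[OF Ck_on_Suc_imp[OF Suc.prems]]
  have diff: "\<And>w y. y \<in> S \<Longrightarrow> (\<lambda>x. L x w) differentiable at y"
    using Suc.prems by simp
  note d = has_derivative_inverse_family[OF _ diff]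
  show ?case
    unfolding Ck_on.simps
  proof (intro conjI ballI allI)
    fix x assume "x \<in> S" then show "(\<lambda>x. M x v) differentiable at x"
      using d differentiableI by blast
  next
    fix h
    \<comment> \<open>The derivative formula, with both moving arguments expanded over the
      basis.\<close>
    have "Ck_on k S (\<lambda>x. - (\<Sum>b\<in>Basis. (M x v \<bullet> b) *\<^sub>R
        (\<Sum>c\<in>Basis. (frechet_derivative (\<lambda>y. L y b) (at x) h \<bullet> c) *\<^sub>R M x c)))"
    proof (intro Ck_on_bounded_linear[OF open_dom bounded_linear_minus[OF bounded_linear_ident]]
        Ck_on_sum[OF open_dom finite_Basis] Ck_on_bounded_bilinear[OF open_dom bounded_bilinear_scaleR] IH)
      fix b c :: 'e
      show "Ck_on k S (\<lambda>x. M x v \<bullet> b)"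
        by (rule Ck_on_bounded_linear[OF open_dom bounded_linear_inner_left IH])
      show "Ck_on k S (\<lambda>x. frechet_derivative (\<lambda>y. L y b) (at x) h \<bullet> c)"
        using Suc.prems by (intro Ck_on_bounded_linear[OF open_dom bounded_linear_inner_left]) simp
    qed
    then show "Ck_on k S (\<lambda>x. frechet_derivative (\<lambda>x. M x v) (at x) h)"
    proof (rule Ck_on_cong[OF open_dom, rotated])
      fix x assume x: "x \<in> S"
      interpret Mx: linear "M x" by (rule linM[OF x])
      have D: "frechet_derivative (\<lambda>y. L y w) (at x) h =
         (\<Sum>b\<in>Basis. (w \<bullet> b) *\<^sub>R frechet_derivative (\<lambda>y. L y b) (at x) h)" for w
      proof -
        have "((\<lambda>y. \<Sum>b\<in>Basis. (w \<bullet> b) *\<^sub>R L y b) has_derivative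
           (\<lambda>h. \<Sum>b\<in>Basis. (w \<bullet> b) *\<^sub>R frechet_derivative (\<lambda>y. L y b) (at x) h)) (at x)"
          using diff[OF x]
          by (intro has_derivative_sum has_derivative_scaleR_right) (simp add: frechet_derivative_works)
        then have "((\<lambda>y. L y w) has_derivative
           (\<lambda>h. \<Sum>b\<in>Basis. (w \<bullet> b) *\<^sub>R frechet_derivative (\<lambda>y. L y b) (at x) h)) (at x)"
          by (rule has_derivative_transform_within_open[OF _ open_dom x])
            (simp only: linear_Basis_sum[OF linL, of _ w])
        then show ?thesis by (simp add: frechet_derivative_eqI)
      qed
      show "- (\<Sum>b\<in>Basis. (M x v \<bullet> b) *\<^sub>R
        (\<Sum>c\<in>Basis. (frechet_derivative (\<lambda>y. L y b) (at x) h \<bullet> c) *\<^sub>R M x c)) =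
        frechet_derivative (\<lambda>x. M x v) (at x) h"
        by (simp only: frechet_derivative_eqI[OF d[OF x]] D[of "M x v"] Mx.sum Mx.scale
          linear_Basis_sum[OF linM[OF x], symmetric])
    qed
  qed
qed

end

section \<open>Inverse function theorem with smooth inverse\<close>

text \<open>The derivative of \<open>G\<close> at \<open>y\<close> is the inverse of the derivative
  of \<open>F\<close> at \<open>G y\<close>. When \<open>G\<close> has class \<open>k\<close>, so
  has this expression, and therefore \<open>G\<close> has class \<open>Suc k\<close>.\<close>

lemma smooth_on_homeomorphism_inverse:
  fixes F G :: "'e::euclidean_space \<Rightarrow> 'e"
  assumes hom: "homeomorphism S T F G" and "open S" "open T" and F: "smooth_on S F"
    and inj: "\<And>x. x \<in> S \<Longrightarrow> inj (frechet_derivative F (at x))"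
  shows "smooth_on T G"
proof -
  let ?L = "\<lambda>x. frechet_derivative F (at x)" and ?M = "\<lambda>x. inv (frechet_derivative F (at x))"
  have lin: "linear (?L x)" if "x \<in> S" for x
    by (rule linear_frechet_derivative[OF smooth_on_differentiable[OF F that]])
  interpret invertible_family S ?L ?M
  proof (rule invertible_family.intro)
    fix x w assume x: "x \<in> S"
    have surj: "surj (?L x)" using linear_injective_imp_surjective[OF lin[OF x] inj[OF x]] by simp
    show "?M x (?L x w) = w" using inj[OF x] by simp
    show "?L x (?M x w) = w" using surj by (simp add: surj_f_inv_f)
    show "linear (?L x)" by (rule lin[OF x])
    show "linear (?M x)" by (rule inj_linear_imp_inv_linear[OF lin[OF x] inj[OF x]])
  qed fact
  have GT: "G y \<in> S" "F (G y) = y" if "y \<in> T" for y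
    using hom that by (auto simp: homeomorphism_def)
  have GS: "G (F x) = x" if "x \<in> S" for x
    using hom that by (auto simp: homeomorphism_def)
  have d: "(G has_derivative ?M (G y)) (at y)" if "y \<in> T" for y
  proof -
    have "(G has_derivative ?M (G y)) (at (F (G y)))"
    proof (rule has_derivative_inverse_strong[OF \<open>open S\<close> GT(1)[OF that]])
      show "continuous_on S F" by (rule smooth_on_continuous[OF F])
      show "(F has_derivative ?L (G y)) (at (G y))"
        by (rule smooth_on_has_derivative[OF F GT(1)[OF that]])
      show "?L (G y) \<circ> ?M (G y) = id" using inv_right[OF GT(1)[OF that]] by (simp add: fun_eq_iff)
    qed (rule GS)
    then show ?thesis by (simp add: GT[OF that])
  qed
  have "Ck_on k T G" for k
  proof (induction k)
    case 0
    then show ?case using hom by (simp add: homeomorphism_def)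
  next
    case (Suc k)
    show ?case
      unfolding Ck_on.simps
    proof (intro conjI ballI allI)
      fix x assume "x \<in> T" then show "G differentiable at x"
        using d differentiableI by blast
    next
      fix v
      have "Ck_on k S (\<lambda>x. ?M x v)"
        using smooth_on_frechet_derivative[OF F] by (intro Ck_on_inverse_family) (simp add: smooth_on_def)
      then have "Ck_on k T (\<lambda>y. ?M (G y) v)"
        by (intro Ck_on_compose[OF \<open>open T\<close> \<open>open S\<close> _ Suc]) (use GT in blast)
      then show "Ck_on k T (\<lambda>x. frechet_derivative G (at x) v)"
        by (rule Ck_on_cong[OF \<open>open T\<close>, rotated]) (simp add: frechet_derivative_eqI[OF d])
    qed
  qed
  then show ?thesis by (simp add: smooth_on_def)
qed

text \<open>The inverse function theorem gives the homeomorphism and the bijectivity of the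
  derivative on all of \<open>U'\<close>; smoothness of the inverse is then gained level by
  level.\<close>

lemma smooth_local_inverse:
  fixes F :: "'e::euclidean_space \<Rightarrow> 'e"
  assumes "open U" "smooth_on U F" "x0 \<in> U" "inj (frechet_derivative F (at x0))"
  obtains U' V G where "open U'" "U' \<subseteq> U" "x0 \<in> U'" "open V" "homeomorphism U' V F G" "smooth_on V G"
proof -
  have d: "(F has_derivative frechet_derivative F (at x)) (at x)" if "x \<in> U" for x
    by (rule smooth_on_has_derivative[OF assms(2) that])
  \<comment> \<open>The derivative as an element of the normed space of bounded operators. Its
    continuity follows from that of its values on basis vectors.\<close>
  define f' where "f' x = Blinfun (frechet_derivative F (at x))" for x
  have f': "blinfun_apply (f' x) = frechet_derivative F (at x)" if "x \<in> U" for x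
    unfolding f'_def by (rule bounded_linear_Blinfun_apply[OF has_derivative_bounded_linear[OF d[OF that]]])
  have df: "(F has_derivative blinfun_apply (f' x)) (at x)" if "x \<in> U" for x
    using d[OF that] by (simp add: f'[OF that])
  have contf: "continuous_on U f'"
  proof (rule continuous_on_blinfun_componentwise)
    fix i :: 'e
    show "continuous_on U (\<lambda>x. blinfun_apply (f' x) i)"
      using smooth_on_continuous[OF smooth_on_frechet_derivative[OF assms(2)]]
      by (rule continuous_on_eq) (simp add: f')
  qed
  have lin: "linear (frechet_derivative F (at x0))"
    using d[OF assms(3)] has_derivative_linear by blast
  have linv: "bounded_linear (inv (frechet_derivative F (at x0)))"
    using inj_linear_imp_inv_linear[OF lin assms(4)] linear_conv_bounded_linear by blast
  have invf: "Blinfun (inv (frechet_derivative F (at x0))) o\<^sub>L f' x0 = id_blinfun"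
    by (rule blinfun_eqI) (simp add: f'[OF assms(3)] bounded_linear_Blinfun_apply[OF linv] assms(4))
  obtain U' V g where *: "open U'" "U' \<subseteq> U" "x0 \<in> U'" "open V" "F x0 \<in> V" "homeomorphism U' V F g"
    "\<And>y. y \<in> V \<Longrightarrow> bij (blinfun_apply (f'(g y)))"
    by (rule inverse_function_theorem[OF assms(1) df contf assms(3) invf]) (assumption, rule that, auto)
  have "inj (frechet_derivative F (at x))" if "x \<in> U'" for x
  proof -
    have "F x \<in> V" "g (F x) = x" using *(6) that by (auto simp: homeomorphism_def)
    then show ?thesis using *(7)[of "F x"] f'[of x] that *(2) by (auto simp: bij_def)
  qed
  then have "smooth_on V g"
    using smooth_on_homeomorphism_inverse[OF *(6,1,4)] smooth_on_subset[OF assms(2) *(2)] by blast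
  then show thesis using that[OF *(1-4,6)] by blast
qed

section \<open>Charts and vector fields\<close>

lemma is_chartD:
  assumes "is_chart c"
  shows "open (fst c)" "open (snd c ` fst c)"
    "p \<in> fst c \<Longrightarrow> cinv c (snd c p) = p"
    "x \<in> snd c ` fst c \<Longrightarrow> snd c (cinv c x) = x"
    "x \<in> snd c ` fst c \<Longrightarrow> cinv c x \<in> fst c"
    "continuous_on (fst c) (snd c)" "continuous_on (snd c ` fst c) (cinv c)"
  using assms by (auto simp: is_chart_def homeomorphism_def)

lemma chart_image_eq:
  assumes "is_chart c"
  shows "snd c ` (U \<inter> fst c) = snd c ` fst c \<inter> cinv c -` U"
  using is_chartD[OF assms] by force

lemma open_chart_image:
  assumes "is_chart c" "open U"
  shows "open (snd c ` (U \<inter> fst c))"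
  unfolding chart_image_eq[OF assms(1)]
  using is_chartD(2,7)[OF assms(1)] assms(2) by (simp add: continuous_open_preimage)

text \<open>\<open>coord\<close> and \<open>tvec\<close> compare a chart with the particular chart
  \<open>pref A p\<close>. Allowing any pair of charts gives a single cocycle rule from which the
  properties of both follow.\<close>

definition dtrans :: "('m, 'e::euclidean_space) chart \<Rightarrow> ('m, 'e) chart \<Rightarrow> 'm \<Rightarrow> 'e \<Rightarrow> 'e" where
  "dtrans c c' p = frechet_derivative (snd c' \<circ> cinv c) (at (snd c p))"

lemma coord_dtrans: "coord A c p = dtrans (pref A p) c p"
  by (simp add: coord_def dtrans_def)

lemma tvec_dtrans: "tvec A c p = dtrans c (pref A p) p"
  by (simp add: tvec_def dtrans_def)

lemma smooth_vf_subset: "smooth_vf A U X \<Longrightarrow> V \<subseteq> U \<Longrightarrow> smooth_vf A V X"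
  unfolding smooth_vf_def by (meson Int_mono image_mono smooth_on_subset subset_refl)

section \<open>Transition maps and the maximal atlas\<close>

locale smooth_mfd =
  fixes A :: "('m::topological_space, 'e::euclidean_space) chart set"
  assumes atlas: "smooth_atlas A"
begin

lemma atlas_smooth_chart: "c \<in> A \<Longrightarrow> smooth_chart A c"
  using atlas by (simp add: smooth_atlas_def smooth_chart_def)

lemma smooth_chart_is_chart: "smooth_chart A c \<Longrightarrow> is_chart c"
  by (simp add: smooth_chart_def)

lemma pref_in: "pref A p \<in> A" "p \<in> fst (pref A p)"
proof -
  have "p \<in> (\<Union>c\<in>A. fst c)" using atlas by (simp add: smooth_atlas_def)
  then have "\<exists>c. c \<in> A \<and> p \<in> fst c" by blast
  from someI_ex[OF this] show "pref A p \<in> A" "p \<in> fst (pref A p)" by (auto simp: pref_def)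
qed

lemma pref_smooth_chart: "smooth_chart A (pref A p)"
  by (rule atlas_smooth_chart[OF pref_in(1)])

lemma open_chart_dom: "smooth_chart A c \<Longrightarrow> open (fst c)"
  by (rule is_chartD(1)[OF smooth_chart_is_chart])

lemma open_image: "smooth_chart A c \<Longrightarrow> open U \<Longrightarrow> open (snd c ` (U \<inter> fst c))"
  by (rule open_chart_image[OF smooth_chart_is_chart])

lemma cinv_chart: "smooth_chart A c \<Longrightarrow> p \<in> fst c \<Longrightarrow> cinv c (snd c p) = p"
  by (rule is_chartD(3)[OF smooth_chart_is_chart])

text \<open>A chart of the maximal atlas is by definition compatible with the charts of
  \<open>A\<close> only. Near \<open>p\<close> the transition between two such charts factors
  through the atlas chart \<open>pref A p\<close>.\<close>

lemma smooth_on_transition: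
  assumes c: "smooth_chart A c" and c': "smooth_chart A c'"
  shows "smooth_on (snd c ` (fst c \<inter> fst c')) (snd c' \<circ> cinv c)"
proof (rule smooth_on_local)
  fix x assume "x \<in> snd c ` (fst c \<inter> fst c')"
  then obtain p where p: "x = snd c p" "p \<in> fst c" "p \<in> fst c'" by auto
  let ?b = "pref A p"
  let ?W = "fst c \<inter> fst c' \<inter> fst ?b"
  have oW: "open ?W"
    using open_chart_dom c c' pref_smooth_chart by (intro open_Int) auto
  have im: "open (snd d ` ?W)" if "smooth_chart A d" "d = c \<or> d = ?b" for d
  proof -
    have "snd d ` ?W = snd d ` (?W \<inter> fst d)" using that by auto
    then show ?thesis using open_image[OF that(1) oW] by simp
  qed
  have o1: "open (snd c ` ?W)" by (rule im[OF c]) simp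
  have o2: "open (snd ?b ` ?W)" by (rule im[OF pref_smooth_chart]) simp
  have s1: "smooth_on (snd c ` ?W) (snd ?b \<circ> cinv c)"
    using c pref_in(1)[of p] unfolding smooth_chart_def smooth_transition_def
    by (blast intro: smooth_on_subset)
  have s2: "smooth_on (snd ?b ` ?W) (snd c' \<circ> cinv ?b)"
    using c' pref_in(1)[of p] unfolding smooth_chart_def smooth_transition_def
    by (blast intro: smooth_on_subset)
  have "(snd ?b \<circ> cinv c) ` (snd c ` ?W) \<subseteq> snd ?b ` ?W"
    using cinv_chart[OF c] by auto
  from smooth_on_compose[OF o1 o2 s1 s2 this]
  have "smooth_on (snd c ` ?W) (\<lambda>x. (snd c' \<circ> cinv ?b) ((snd ?b \<circ> cinv c) x))" .
  then have "smooth_on (snd c ` ?W) (snd c' \<circ> cinv c)"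
    by (rule smooth_on_cong[OF o1])
      (auto simp: cinv_chart[OF c] cinv_chart[OF pref_smooth_chart])
  then show "\<exists>T. open T \<and> x \<in> T \<and> smooth_on T (snd c' \<circ> cinv c)"
    using o1 p pref_in(2)[of p] by blast
qed

lemma has_derivative_transition:
  assumes "smooth_chart A c" "smooth_chart A c'" "p \<in> fst c" "p \<in> fst c'"
  shows "((snd c' \<circ> cinv c) has_derivative dtrans c c' p) (at (snd c p))"
  unfolding dtrans_def
  by (rule smooth_on_has_derivative[OF smooth_on_transition[OF assms(1,2)]]) (use assms in auto)

lemma linear_dtrans:
  assumes "smooth_chart A c" "smooth_chart A c'" "p \<in> fst c" "p \<in> fst c'"
  shows "linear (dtrans c c' p)"
  using has_derivative_transition[OF assms] by (rule has_derivative_linear)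

lemma open_chart_inter:
  assumes "smooth_chart A c" "open W" "W \<subseteq> fst c"
  shows "open (snd c ` W)"
  using open_image[OF assms(1,2)] assms(3) by (simp add: Int_absorb2)

text \<open>Chain rule on the overlap, where the transition from \<open>c\<close> to
  \<open>c''\<close> passes through \<open>c'\<close>.\<close>

lemma dtrans_dtrans:
  assumes c: "smooth_chart A c" "p \<in> fst c" and c': "smooth_chart A c'" "p \<in> fst c'"
    and c'': "smooth_chart A c''" "p \<in> fst c''"
  shows "dtrans c' c'' p (dtrans c c' p v) = dtrans c c'' p v"
proof -
  let ?W = "fst c \<inter> fst c'"
  have 1: "(snd c' \<circ> cinv c) (snd c p) = snd c' p" using cinv_chart[OF c] by simp
  have "((\<lambda>x. (snd c'' \<circ> cinv c') ((snd c' \<circ> cinv c) x)) has_derivative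
      (\<lambda>v. dtrans c' c'' p (dtrans c c' p v))) (at (snd c p))"
    by (rule has_derivative_compose[OF has_derivative_transition[OF c(1) c'(1) c(2) c'(2)]])
      (unfold 1, rule has_derivative_transition[OF c'(1) c''(1) c'(2) c''(2)])
  then have "((snd c'' \<circ> cinv c) has_derivative (\<lambda>v. dtrans c' c'' p (dtrans c c' p v))) (at (snd c p))"
  proof (rule has_derivative_transform_within_open)
    show "open (snd c ` ?W)"
      using open_chart_dom[OF c(1)] open_chart_dom[OF c'(1)] by (intro open_chart_inter[OF c(1)]) auto
    show "snd c p \<in> snd c ` ?W" using c c' by auto
  qed (auto simp: cinv_chart[OF c(1)] cinv_chart[OF c'(1)])
  then have "(\<lambda>v. dtrans c' c'' p (dtrans c c' p v)) = dtrans c c'' p"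
    unfolding dtrans_def[of c c''] by (rule frechet_derivative_eqI[symmetric])
  then show ?thesis by metis
qed

lemma dtrans_self:
  assumes c: "smooth_chart A c" "p \<in> fst c"
  shows "dtrans c c p v = v"
proof -
  have "((snd c \<circ> cinv c) has_derivative (\<lambda>v. v)) (at (snd c p))"
    by (rule has_derivative_transform_within_open[OF has_derivative_ident, of "snd c ` fst c"])
      (use open_chart_inter[OF c(1) open_chart_dom[OF c(1)]] c in \<open>auto simp: cinv_chart[OF c(1)]\<close>)
  then show ?thesis unfolding dtrans_def by (simp add: frechet_derivative_eqI)
qed

context
  fixes c p assumes c: "smooth_chart A c" "p \<in> fst c"
begin

lemma linear_coord: "linear (coord A c p)"
  unfolding coord_dtrans by (rule linear_dtrans[OF pref_smooth_chart c(1) pref_in(2) c(2)])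

lemma linear_tvec: "linear (tvec A c p)"
  unfolding tvec_dtrans by (rule linear_dtrans[OF c(1) pref_smooth_chart c(2) pref_in(2)])

lemma coord_tvec: "coord A c p (tvec A c p v) = v"
  unfolding coord_dtrans tvec_dtrans
  by (simp add: dtrans_dtrans[OF c pref_smooth_chart pref_in(2) c] dtrans_self[OF c])

lemma tvec_coord: "tvec A c p (coord A c p v) = v"
  unfolding coord_dtrans tvec_dtrans
  by (simp add: dtrans_dtrans[OF pref_smooth_chart pref_in(2) c pref_smooth_chart pref_in(2)]
      dtrans_self[OF pref_smooth_chart pref_in(2)])

lemma inj_coord: "inj (coord A c p)"
  by (metis injI tvec_coord)

lemma rep_chart: "rep A c X (snd c p) = coord A c p (X p)"
  by (simp add: rep_def cinv_chart[OF c])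

end

lemma dtrans_coord:
  assumes "smooth_chart A c" "p \<in> fst c" "smooth_chart A c'" "p \<in> fst c'"
  shows "dtrans c c' p (coord A c p v) = coord A c' p v"
  unfolding coord_dtrans by (rule dtrans_dtrans[OF pref_smooth_chart pref_in(2) assms])

lemma coord_pref: "coord A (pref A p) p v = v"
  unfolding coord_dtrans by (rule dtrans_self[OF pref_smooth_chart pref_in(2)])

text \<open>The definition tests \<open>f\<close> in charts of \<open>A\<close>; locally
  \<open>c\<close> is linked to one of them by a smooth transition.\<close>

lemma smooth_fun_chart:
  assumes f: "smooth_fun A U f" and "open U" and c: "smooth_chart A c"
  shows "smooth_on (snd c ` (U \<inter> fst c)) (f \<circ> cinv c)"
proof (rule smooth_on_local)
  fix x assume "x \<in> snd c ` (U \<inter> fst c)"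
  then obtain p where p: "x = snd c p" "p \<in> fst c" "p \<in> U" by auto
  let ?b = "pref A p"
  let ?W = "U \<inter> fst c \<inter> fst ?b"
  have oW: "open ?W"
    using open_chart_dom[OF c] open_chart_dom[OF pref_smooth_chart] \<open>open U\<close> by (intro open_Int) auto
  have o1: "open (snd c ` ?W)" by (rule open_chart_inter[OF c oW]) auto
  have o2: "open (snd ?b ` ?W)" by (rule open_chart_inter[OF pref_smooth_chart oW]) auto
  have s1: "smooth_on (snd c ` ?W) (snd ?b \<circ> cinv c)"
    by (rule smooth_on_subset[OF smooth_on_transition[OF c pref_smooth_chart]]) auto
  have s2: "smooth_on (snd ?b ` ?W) (f \<circ> cinv ?b)"
    by (rule smooth_on_subset[OF f[unfolded smooth_fun_def, rule_format, OF pref_in(1)]]) auto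
  have "(snd ?b \<circ> cinv c) ` (snd c ` ?W) \<subseteq> snd ?b ` ?W"
    using cinv_chart[OF c] by auto
  from smooth_on_compose[OF o1 o2 s1 s2 this]
  have "smooth_on (snd c ` ?W) (\<lambda>x. (f \<circ> cinv ?b) ((snd ?b \<circ> cinv c) x))" .
  then have "smooth_on (snd c ` ?W) (f \<circ> cinv c)"
    by (rule smooth_on_cong[OF o1])
      (auto simp: cinv_chart[OF c] cinv_chart[OF pref_smooth_chart])
  then show "\<exists>T. open T \<and> x \<in> T \<and> smooth_on T (f \<circ> cinv c)"
    using o1 p pref_in(2)[of p] by blast
qed

lemma smooth_fun_if_chart:
  assumes c: "smooth_chart A c" and V: "open V" "V \<subseteq> fst c" and f: "smooth_on (snd c ` V) (f \<circ> cinv c)"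
  shows "smooth_fun A V f"
  unfolding smooth_fun_def
proof
  fix d assume "d \<in> A"
  then have d: "smooth_chart A d" by (rule atlas_smooth_chart)
  have o1: "open (snd d ` (V \<inter> fst d))" by (rule open_image[OF d V(1)])
  have o2: "open (snd c ` V)" by (rule open_chart_inter[OF c V])
  have s1: "smooth_on (snd d ` (V \<inter> fst d)) (snd c \<circ> cinv d)"
    by (rule smooth_on_subset[OF smooth_on_transition[OF d c]]) (use V in auto)
  have "(snd c \<circ> cinv d) ` (snd d ` (V \<inter> fst d)) \<subseteq> snd c ` V"
    using cinv_chart[OF d] by auto
  from smooth_on_compose[OF o1 o2 s1 f this]
  have "smooth_on (snd d ` (V \<inter> fst d)) (\<lambda>x. (f \<circ> cinv c) ((snd c \<circ> cinv d) x))" .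
  then show "smooth_on (snd d ` (V \<inter> fst d)) (f \<circ> cinv d)"
    by (rule smooth_on_cong[OF o1])
      (use V in \<open>auto simp: cinv_chart[OF d] intro!: arg_cong[of _ _ f] cinv_chart[OF c]\<close>)
qed

text \<open>Components change by the Jacobian of the transition map. In the new chart the field is a
  sum of products of old components and partial derivatives, composed with the inverse
  transition.\<close>

lemma smooth_on_rep_change:
  assumes c: "smooth_chart A c" and d: "smooth_chart A d" and W: "open W" "W \<subseteq> fst c" "W \<subseteq> fst d"
    and X: "smooth_on (snd c ` W) (rep A c X)"
  shows "smooth_on (snd d ` W) (rep A d X)"
proof -
  let ?F = "snd d \<circ> cinv c" and ?G = "snd c \<circ> cinv d"
  have o1: "open (snd d ` W)" by (rule open_chart_inter[OF d W(1,3)])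
  have o2: "open (snd c ` W)" by (rule open_chart_inter[OF c W(1,2)])
  have sF: "smooth_on (snd c ` W) ?F"
    by (rule smooth_on_subset[OF smooth_on_transition[OF c d]]) (use W in auto)
  have sG: "smooth_on (snd d ` W) ?G"
    by (rule smooth_on_subset[OF smooth_on_transition[OF d c]]) (use W in auto)
  have "smooth_on (snd c ` W) (\<lambda>x. \<Sum>b\<in>Basis. (rep A c X x \<bullet> b) *\<^sub>R frechet_derivative ?F (at x) b)"
    by (intro smooth_on_sum[OF o2 finite_Basis] smooth_on_bounded_bilinear[OF o2 bounded_bilinear_scaleR]
        smooth_on_bounded_linear[OF o2 bounded_linear_inner_left X] smooth_on_frechet_derivative[OF sF])
  moreover have "?G ` (snd d ` W) \<subseteq> snd c ` W"
    using W cinv_chart[OF d] by auto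
  ultimately have "smooth_on (snd d ` W) (\<lambda>y. \<Sum>b\<in>Basis. (rep A c X (?G y) \<bullet> b) *\<^sub>R frechet_derivative ?F (at (?G y)) b)"
    using smooth_on_compose[OF o1 o2 sG] by blast
  then show ?thesis
  proof (rule smooth_on_cong[OF o1])
    fix y assume "y \<in> snd d ` W"
    then obtain p where p: "y = snd d p" "p \<in> W" by auto
    have pc: "p \<in> fst c" "p \<in> fst d" using p W by auto
    have G: "?G y = snd c p" using p cinv_chart[OF d pc(2)] by simp
    have "(\<Sum>b\<in>Basis. (rep A c X (?G y) \<bullet> b) *\<^sub>R frechet_derivative ?F (at (?G y)) b)
      = dtrans c d p (rep A c X (snd c p))"
      unfolding G dtrans_def
      by (rule frechet_derivative_Basis[symmetric, OF smooth_on_differentiable[OF sF]]) (use p in auto)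
    also have "\<dots> = rep A d X y"
      unfolding p(1) rep_chart[OF c pc(1)] rep_chart[OF d pc(2)] by (rule dtrans_coord[OF c pc(1) d pc(2)])
    finally show "(\<Sum>b\<in>Basis. (rep A c X (?G y) \<bullet> b) *\<^sub>R frechet_derivative ?F (at (?G y)) b) = rep A d X y" .
  qed
qed

lemma smooth_vf_chart:
  assumes X: "smooth_vf A U X" and "open U" and c: "smooth_chart A c"
  shows "smooth_on (snd c ` (U \<inter> fst c)) (rep A c X)"
proof (rule smooth_on_local)
  fix x assume "x \<in> snd c ` (U \<inter> fst c)"
  then obtain p where p: "x = snd c p" "p \<in> fst c" "p \<in> U" by auto
  let ?b = "pref A p"
  let ?W = "U \<inter> fst c \<inter> fst ?b"
  have oW: "open ?W"
    using open_chart_dom[OF c] open_chart_dom[OF pref_smooth_chart] \<open>open U\<close> by (intro open_Int) auto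
  have o1: "open (snd c ` ?W)" by (rule open_chart_inter[OF c oW]) auto
  have "smooth_on (snd ?b ` ?W) (rep A ?b X)"
    by (rule smooth_on_subset[OF X[unfolded smooth_vf_def, rule_format, OF pref_in(1)]]) auto
  from smooth_on_rep_change[OF pref_smooth_chart c oW _ _ this]
  have "smooth_on (snd c ` ?W) (rep A c X)" by auto
  then show "\<exists>T. open T \<and> x \<in> T \<and> smooth_on T (rep A c X)"
    using o1 p pref_in(2)[of p] by blast
qed

lemma smooth_vf_if_chart:
  assumes c: "smooth_chart A c" and V: "open V" "V \<subseteq> fst c" and X: "smooth_on (snd c ` V) (rep A c X)"
  shows "smooth_vf A V X"
  unfolding smooth_vf_def
proof
  fix d assume "d \<in> A"
  then have d: "smooth_chart A d" by (rule atlas_smooth_chart)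
  show "smooth_on (snd d ` (V \<inter> fst d)) (rep A d X)"
    by (rule smooth_on_rep_change[OF c d _ _ _ smooth_on_subset[OF X]])
      (use V open_chart_dom[OF d] in auto)
qed

lemma smooth_fun_cong:
  assumes "open U" "smooth_fun A U f" "\<And>p. p \<in> U \<Longrightarrow> f p = g p"
  shows "smooth_fun A U g"
  unfolding smooth_fun_def
proof
  fix c assume "c \<in> A"
  then have c: "smooth_chart A c" by (rule atlas_smooth_chart)
  show "smooth_on (snd c ` (U \<inter> fst c)) (g \<circ> cinv c)"
    by (rule smooth_on_cong[OF open_image[OF c assms(1)] smooth_fun_chart[OF assms(2,1) c]])
      (auto simp: cinv_chart[OF c] assms(3))
qed

lemma smooth_vf_cong:
  assumes "open U" "smooth_vf A U X" "\<And>p. p \<in> U \<Longrightarrow> X p = Y p"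
  shows "smooth_vf A U Y"
  unfolding smooth_vf_def
proof
  fix c assume "c \<in> A"
  then have c: "smooth_chart A c" by (rule atlas_smooth_chart)
  show "smooth_on (snd c ` (U \<inter> fst c)) (rep A c Y)"
    by (rule smooth_on_cong[OF open_image[OF c assms(1)] smooth_vf_chart[OF assms(2,1) c]])
      (auto simp: rep_chart[OF c] assms(3))
qed

section \<open>Module operations on smooth vector fields\<close>

lemma smooth_fun_const: "smooth_fun A U (\<lambda>p. r)"
  by (simp add: smooth_fun_def comp_def)

context
  fixes U :: "'m set" assumes U: "open U"
begin

lemma smooth_fun_inverse_sqrt:
  assumes f: "smooth_fun A U f" and pos: "\<And>p. p \<in> U \<Longrightarrow> f p > 0"
  shows "smooth_fun A U (\<lambda>p. inverse (sqrt (f p)))"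
  unfolding smooth_fun_def
proof
  fix c assume "c \<in> A"
  then have c: "smooth_chart A c" by (rule atlas_smooth_chart)
  have "smooth_on (snd c ` (U \<inter> fst c)) (\<lambda>x. inverse (sqrt ((f \<circ> cinv c) x)))"
  proof (rule smooth_on_compose[OF open_image[OF c U] open_greaterThan smooth_fun_chart[OF f U c]])
    show "smooth_on {0<..} (\<lambda>t. inverse (sqrt t))"
      by (simp add: smooth_on_def Ck_on_inverse_sqrt)
    show "(f \<circ> cinv c) ` (snd c ` (U \<inter> fst c)) \<subseteq> {0<..}"
      using pos by (auto simp: cinv_chart[OF c])
  qed
  then show "smooth_on (snd c ` (U \<inter> fst c)) ((\<lambda>p. inverse (sqrt (f p))) \<circ> cinv c)"
    by (simp add: comp_def)
qed

text \<open>Scaling, addition and subtraction are the instances with a zero field or a constant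
  factor. The combination is also the one in the first slot of the connection axiom.\<close>

lemma smooth_vf_axpy:
  assumes f: "smooth_fun A U f" and X: "smooth_vf A U X" and Y: "smooth_vf A U Y"
  shows "smooth_vf A U (\<lambda>p. f p *\<^sub>R X p + Y p)"
  unfolding smooth_vf_def
proof
  fix c assume "c \<in> A"
  then have c: "smooth_chart A c" by (rule atlas_smooth_chart)
  have o: "open (snd c ` (U \<inter> fst c))" by (rule open_image[OF c U])
  have "smooth_on (snd c ` (U \<inter> fst c)) (\<lambda>x. (f \<circ> cinv c) x *\<^sub>R rep A c X x + rep A c Y x)"
    by (intro smooth_on_add[OF o] smooth_on_bounded_bilinear[OF o bounded_bilinear_scaleR]
        smooth_fun_chart[OF f U c] smooth_vf_chart[OF X U c] smooth_vf_chart[OF Y U c])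
  then show "smooth_on (snd c ` (U \<inter> fst c)) (rep A c (\<lambda>p. f p *\<^sub>R X p + Y p))"
    by (rule smooth_on_cong[OF o])
      (auto simp: rep_chart[OF c] cinv_chart[OF c] linear_add[OF linear_coord[OF c]] linear_scale[OF linear_coord[OF c]])
qed

lemma smooth_vf_zero: "smooth_vf A U (\<lambda>p. 0)"
  unfolding smooth_vf_def
proof
  fix c assume "c \<in> A"
  then have c: "smooth_chart A c" by (rule atlas_smooth_chart)
  show "smooth_on (snd c ` (U \<inter> fst c)) (rep A c (\<lambda>p. 0))"
    by (rule smooth_on_cong[OF open_image[OF c U] smooth_on_const[of _ 0]])
      (auto simp: rep_chart[OF c] linear_0[OF linear_coord[OF c]])
qed

lemma smooth_vf_scale: "smooth_fun A U f \<Longrightarrow> smooth_vf A U X \<Longrightarrow> smooth_vf A U (\<lambda>p. f p *\<^sub>R X p)"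
  using smooth_vf_axpy[OF _ _ smooth_vf_zero] by simp

lemma smooth_vf_add: "smooth_vf A U X \<Longrightarrow> smooth_vf A U Y \<Longrightarrow> smooth_vf A U (\<lambda>p. X p + Y p)"
  using smooth_vf_axpy[OF smooth_fun_const[of U 1]] by simp

lemma smooth_vf_diff: "smooth_vf A U X \<Longrightarrow> smooth_vf A U Y \<Longrightarrow> smooth_vf A U (\<lambda>p. X p - Y p)"
  using smooth_vf_axpy[OF smooth_fun_const[of U "-1"], of Y X] by simp

lemma smooth_vf_sum:
  assumes "finite I" "\<And>i. i \<in> I \<Longrightarrow> smooth_vf A U (X i)"
  shows "smooth_vf A U (\<lambda>p. \<Sum>i\<in>I. X i p)"
  using assms by (induction I) (simp_all add: smooth_vf_zero smooth_vf_add)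

end

lemma smooth_vf_tvec:
  assumes c: "smooth_chart A c"
  shows "smooth_vf A (fst c) (\<lambda>q. tvec A c q v)"
  by (rule smooth_vf_if_chart[OF c open_chart_dom[OF c] subset_refl
        smooth_on_cong[OF open_chart_inter[OF c open_chart_dom[OF c] subset_refl] smooth_on_const[of _ v]]])
    (auto simp: rep_chart[OF c] coord_tvec[OF c])

lemma smooth_fun_coord:
  assumes c: "smooth_chart A c" and X: "smooth_vf A U X" and "open U"
  shows "smooth_fun A (U \<inter> fst c) (\<lambda>q. coord A c q (X q) \<bullet> b)"
proof (rule smooth_fun_if_chart[OF c])
  have o: "open (snd c ` (U \<inter> fst c))" by (rule open_image[OF c \<open>open U\<close>])
  have "smooth_on (snd c ` (U \<inter> fst c)) (\<lambda>x. rep A c X x \<bullet> b)"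
    by (rule smooth_on_bounded_linear[OF o bounded_linear_inner_left smooth_vf_chart[OF X \<open>open U\<close> c]])
  then show "smooth_on (snd c ` (U \<inter> fst c)) ((\<lambda>q. coord A c q (X q) \<bullet> b) \<circ> cinv c)"
    by (simp add: rep_def comp_def)
qed (use \<open>open U\<close> open_chart_dom[OF c] in auto)

lemma coord_frame_expansion:
  assumes "smooth_chart A c" "q \<in> fst c"
  shows "v = (\<Sum>b\<in>Basis. (coord A c q v \<bullet> b) *\<^sub>R tvec A c q b)"
proof -
  interpret linear "tvec A c q" by (rule linear_tvec[OF assms])
  have "v = tvec A c q (\<Sum>b\<in>Basis. (coord A c q v \<bullet> b) *\<^sub>R b)"
    by (simp only: euclidean_representation tvec_coord[OF assms])
  then show ?thesis by (simp only: sum scale)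
qed

section \<open>Directional derivatives and Lie brackets in arbitrary charts\<close>

text \<open>\<open>vderiv\<close> is defined in the chart \<open>pref A p\<close>; the chain rule
  moves it to \<open>c\<close>, where the direction becomes \<open>coord A c p v\<close>.\<close>

lemma vderiv_chart:
  assumes f: "smooth_fun A U f" "open U" "p \<in> U" and c: "smooth_chart A c" "p \<in> fst c"
  shows "vderiv A p v f = frechet_derivative (f \<circ> cinv c) (at (snd c p)) (coord A c p v)"
proof -
  let ?b = "pref A p"
  let ?W = "U \<inter> fst ?b \<inter> fst c"
  have oW: "open ?W"
    using open_chart_dom[OF c(1)] open_chart_dom[OF pref_smooth_chart] f(2) by (intro open_Int) auto
  have 1: "(snd c \<circ> cinv ?b) (snd ?b p) = snd c p"
    using cinv_chart[OF pref_smooth_chart pref_in(2)] by simp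
  have "((f \<circ> cinv c) has_derivative frechet_derivative (f \<circ> cinv c) (at (snd c p))) (at (snd c p))"
    by (rule smooth_on_has_derivative[OF smooth_fun_chart[OF f(1,2) c(1)]]) (use f c in auto)
  then have "((\<lambda>x. (f \<circ> cinv c) ((snd c \<circ> cinv ?b) x)) has_derivative
      (\<lambda>v. frechet_derivative (f \<circ> cinv c) (at (snd c p)) (dtrans ?b c p v))) (at (snd ?b p))"
    by (intro has_derivative_compose[OF has_derivative_transition[OF pref_smooth_chart c(1) pref_in(2) c(2)]])
      (simp only: 1)
  then have "((f \<circ> cinv ?b) has_derivative
      (\<lambda>v. frechet_derivative (f \<circ> cinv c) (at (snd c p)) (dtrans ?b c p v))) (at (snd ?b p))"
  proof (rule has_derivative_transform_within_open)
    show "open (snd ?b ` ?W)"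
      by (rule open_chart_inter[OF pref_smooth_chart oW]) auto
    show "snd ?b p \<in> snd ?b ` ?W" using f c pref_in(2) by auto
  qed (auto simp: cinv_chart[OF c(1)] cinv_chart[OF pref_smooth_chart])
  then show ?thesis
    unfolding vderiv_def coord_dtrans by (simp only: frechet_derivative_eqI)
qed

text \<open>The vector \<open>R y\<close> moves with the base point, so the product rule gives a
  second derivative of \<open>F\<close> besides the derivative of \<open>R\<close>. This governs how
  derivatives of components of vector fields change between charts.\<close>

lemma has_derivative_apply_derivative:
  fixes F :: "'e \<Rightarrow> 'e"
  assumes "open S" and F: "smooth_on S F" and x: "x \<in> S" and R: "(R has_derivative R') (at x)"
  shows "((\<lambda>y. frechet_derivative F (at y) (R y)) has_derivative
    (\<lambda>u. frechet_derivative (\<lambda>y. frechet_derivative F (at y) (R x)) (at x) u +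
         frechet_derivative F (at x) (R' u))) (at x)"
proof -
  let ?d = "\<lambda>y. frechet_derivative F (at y)" and ?D = "\<lambda>b. frechet_derivative (\<lambda>y. frechet_derivative F (at y) b) (at x)"
  have d: "?d y w = (\<Sum>b\<in>Basis. (w \<bullet> b) *\<^sub>R ?d y b)" if "y \<in> S" for y w
    by (rule frechet_derivative_Basis[OF smooth_on_differentiable[OF F that]])
  have D: "((\<lambda>y. ?d y b) has_derivative ?D b) (at x)" for b
    by (rule smooth_on_has_derivative[OF smooth_on_frechet_derivative[OF F] x])
  have 1: "((\<lambda>y. ?d y w) has_derivative (\<lambda>u. \<Sum>b\<in>Basis. (w \<bullet> b) *\<^sub>R ?D b u)) (at x)" for w
    by (rule has_derivative_transform_within_open[OF
          has_derivative_sum[OF has_derivative_scaleR_right[OF D]] \<open>open S\<close> x d[symmetric]])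
  have "((\<lambda>y. \<Sum>b\<in>Basis. (R y \<bullet> b) *\<^sub>R ?d y b) has_derivative
    (\<lambda>u. \<Sum>b\<in>Basis. (R x \<bullet> b) *\<^sub>R ?D b u + (R' u \<bullet> b) *\<^sub>R ?d x b)) (at x)"
    by (intro has_derivative_sum has_derivative_scaleR[OF has_derivative_inner_left[OF R] D])
  then have "((\<lambda>y. ?d y (R y)) has_derivative
    (\<lambda>u. \<Sum>b\<in>Basis. (R x \<bullet> b) *\<^sub>R ?D b u + (R' u \<bullet> b) *\<^sub>R ?d x b)) (at x)"
    by (rule has_derivative_transform_within_open[OF _ \<open>open S\<close> x d[symmetric]])
  moreover have "(\<lambda>u. \<Sum>b\<in>Basis. (R x \<bullet> b) *\<^sub>R ?D b u + (R' u \<bullet> b) *\<^sub>R ?d x b) =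
     (\<lambda>u. ?D (R x) u + ?d x (R' u))"
    unfolding frechet_derivative_eqI[OF 1, of "R x"] d[OF x, of "R' _"] by (simp add: sum.distrib)
  ultimately show ?thesis by (simp only:)
qed

text \<open>The change from \<open>pref A p\<close> to \<open>c\<close> adds to each of the two
  derivatives the second derivative of the transition map at \<open>X p\<close> and
  \<open>Y p\<close>. By its symmetry these contributions cancel in the difference.\<close>

lemma lie_bracket_chart:
  assumes X: "smooth_vf A U X" and Y: "smooth_vf A U Y" and U: "open U" "p \<in> U"
    and c: "smooth_chart A c" "p \<in> fst c"
  shows "coord A c p (lie_bracket A X Y p) =
    frechet_derivative (rep A c Y) (at (snd c p)) (coord A c p (X p)) -
    frechet_derivative (rep A c X) (at (snd c p)) (coord A c p (Y p))"
proof -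
  let ?b = "pref A p"
  define F where "F = snd c \<circ> cinv ?b"
  define x where "x = snd ?b p"
  define W where "W = U \<inter> fst ?b \<inter> fst c"
  define S where "S = snd ?b ` W"
  have oW: "open W"
    unfolding W_def using open_chart_dom[OF c(1)] open_chart_dom[OF pref_smooth_chart] U(1)
    by (intro open_Int) auto
  have S: "open S"
    unfolding S_def by (rule open_chart_inter[OF pref_smooth_chart oW]) (auto simp: W_def)
  have xS: "x \<in> S" unfolding S_def x_def W_def using U c pref_in(2) by auto
  have F: "smooth_on S F"
    unfolding F_def S_def
    by (rule smooth_on_subset[OF smooth_on_transition[OF pref_smooth_chart c(1)]]) (auto simp: W_def)
  have Fx: "F x = snd c p"
    by (simp add: F_def x_def cinv_chart[OF pref_smooth_chart pref_in(2)])
  have dF: "frechet_derivative F (at x) = coord A c p"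
    by (simp add: coord_def F_def x_def)
  have repx: "rep A ?b Z x = Z p" for Z
    unfolding x_def by (simp add: rep_chart[OF pref_smooth_chart pref_in(2)] coord_pref)
  \<comment> \<open>Two expressions for the components of \<open>Z\<close> in the chart
    \<open>c\<close>, read at \<open>F y\<close>, are differentiated at \<open>x\<close> and
    compared: the composite with \<open>F\<close>, and the derivative of \<open>F\<close> applied to
    the components in \<open>?b\<close>.\<close>
  have key: "frechet_derivative (rep A c Z) (at (snd c p)) (coord A c p u) =
      frechet_derivative (\<lambda>y. frechet_derivative F (at y) (Z p)) (at x) u +
      coord A c p (frechet_derivative (rep A ?b Z) (at x) u)" if Z: "smooth_vf A U Z" for Z u
  proof -
    have "smooth_on S (rep A ?b Z)"
      unfolding S_def by (rule smooth_on_subset[OF smooth_vf_chart[OF Z U(1) pref_smooth_chart]]) (auto simp: W_def)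
    then have R: "(rep A ?b Z has_derivative frechet_derivative (rep A ?b Z) (at x)) (at x)"
      by (rule smooth_on_has_derivative[OF _ xS])
    have "(rep A c Z has_derivative frechet_derivative (rep A c Z) (at (F x))) (at (F x))"
      unfolding Fx by (rule smooth_on_has_derivative[OF smooth_vf_chart[OF Z U(1) c(1)]]) (use U c in auto)
    from has_derivative_compose[OF smooth_on_has_derivative[OF F xS] this]
    have "((\<lambda>y. rep A c Z (F y)) has_derivative
       (\<lambda>u. frechet_derivative (rep A c Z) (at (snd c p)) (coord A c p u))) (at x)"
      unfolding Fx dF .
    then have "((\<lambda>y. frechet_derivative F (at y) (rep A ?b Z y)) has_derivative
       (\<lambda>u. frechet_derivative (rep A c Z) (at (snd c p)) (coord A c p u))) (at x)"
    proof (rule has_derivative_transform_within_open[OF _ S xS])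
      fix y assume "y \<in> S"
      then obtain q where q: "y = snd ?b q" "q \<in> W" by (auto simp: S_def)
      have qb: "q \<in> fst ?b" and qc: "q \<in> fst c" using q by (auto simp: W_def)
      have "F y = snd c q" by (simp add: F_def q cinv_chart[OF pref_smooth_chart qb])
      moreover have "frechet_derivative F (at y) = dtrans ?b c q"
        by (simp add: F_def q dtrans_def)
      ultimately show "rep A c Z (F y) = frechet_derivative F (at y) (rep A ?b Z y)"
        by (simp add: rep_chart[OF c(1) qc] q(1) rep_chart[OF pref_smooth_chart qb]
            dtrans_coord[OF pref_smooth_chart qb c(1) qc])
    qed
    from has_derivative_unique[OF this has_derivative_apply_derivative[OF S F xS R]]
    show ?thesis unfolding repx dF by metis
  qed
  have "lie_bracket A X Y p = frechet_derivative (rep A ?b Y) (at x) (X p) - frechet_derivative (rep A ?b X) (at x) (Y p)"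
    by (simp add: lie_bracket_def Let_def x_def)
  then show ?thesis
    unfolding key[OF X] key[OF Y] second_derivative_symmetric[OF S F xS, of "Y p" "X p"]
    by (simp add: linear_diff[OF linear_coord[OF c]])
qed

text \<open>Both fields have constant components in \<open>c\<close>, so both terms of the bracket
  formula in that chart vanish.\<close>

lemma lie_bracket_coordinate_fields:
  assumes c: "smooth_chart A c" "p \<in> fst c"
  shows "lie_bracket A (\<lambda>q. tvec A c q v) (\<lambda>q. tvec A c q w) p = 0"
proof -
  have "frechet_derivative (rep A c (\<lambda>q. tvec A c q v)) (at (snd c p)) = (\<lambda>h. 0)" for v
    by (rule frechet_derivative_eqI,
        rule has_derivative_transform_within_open[OF has_derivative_const[of v], of "snd c ` fst c"])
      (use c open_chart_inter[OF c(1) open_chart_dom[OF c(1)]] in \<open>auto simp: rep_chart[OF c(1)] coord_tvec[OF c(1)]\<close>)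
  then have "coord A c p (lie_bracket A (\<lambda>q. tvec A c q v) (\<lambda>q. tvec A c q w) p) = coord A c p 0"
    using lie_bracket_chart[OF smooth_vf_tvec[OF c(1)] smooth_vf_tvec[OF c(1)] open_chart_dom[OF c(1)] c(2) c]
    by (simp add: linear_0[OF linear_coord[OF c]])
  then show ?thesis using inj_coord[OF c] by (simp add: inj_def)
qed

end

section \<open>Connections\<close>

context smooth_mfd begin

lemma vderiv_eqI:
  assumes "((f \<circ> cinv (pref A p)) has_derivative f') (at (snd (pref A p) p))"
  shows "vderiv A p v f = f' v"
  unfolding vderiv_def by (simp only: frechet_derivative_eqI[OF assms])

lemma vderiv_local_const:
  assumes "open U" "p \<in> U" "\<And>q. q \<in> U \<Longrightarrow> f q = r"
  shows "vderiv A p v f = 0"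
proof (rule vderiv_eqI)
  let ?b = "pref A p"
  show "((f \<circ> cinv ?b) has_derivative (\<lambda>v. 0)) (at (snd ?b p))"
  proof (rule has_derivative_transform_within_open[OF has_derivative_const[of r]])
    show "open (snd ?b ` (U \<inter> fst ?b))" by (rule open_image[OF pref_smooth_chart assms(1)])
    show "snd ?b p \<in> snd ?b ` (U \<inter> fst ?b)" using assms(2) pref_in(2) by auto
  qed (auto simp: cinv_chart[OF pref_smooth_chart] assms(3))
qed

lemma vderiv_add:
  assumes "open U" "p \<in> U" and f: "smooth_fun A U f" and h: "smooth_fun A U h"
  shows "vderiv A p v (\<lambda>q. f q + h q) = vderiv A p v f + vderiv A p v h"
proof -
  let ?b = "pref A p"
  have *: "((f \<circ> cinv ?b) has_derivative frechet_derivative (f \<circ> cinv ?b) (at (snd ?b p))) (at (snd ?b p))"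
    if "smooth_fun A U f" for f
    by (rule smooth_on_has_derivative[OF smooth_fun_chart[OF that assms(1) pref_smooth_chart]])
      (use assms(2) pref_in(2) in auto)
  have "(((\<lambda>q. f q + h q) \<circ> cinv ?b) has_derivative (\<lambda>v. frechet_derivative (f \<circ> cinv ?b) (at (snd ?b p)) v +
       frechet_derivative (h \<circ> cinv ?b) (at (snd ?b p)) v)) (at (snd ?b p))"
    using has_derivative_add[OF *[OF f] *[OF h]] by (simp add: comp_def)
  from vderiv_eqI[OF this] show ?thesis by (simp add: vderiv_def)
qed

end

locale connection = smooth_mfd A
  for A :: "('m::topological_space, 'e::euclidean_space) chart set" +
  fixes nb :: "('m \<Rightarrow> 'e) \<Rightarrow> ('m \<Rightarrow> 'e) \<Rightarrow> 'm \<Rightarrow> 'e"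
  assumes conn: "linear_connection A nb"
begin

context
  fixes U :: "'m set" assumes U: "open U"
begin

lemma smooth_nb: "smooth_vf A U X \<Longrightarrow> smooth_vf A U Y \<Longrightarrow> smooth_vf A U (nb X Y)"
  using conn[unfolded linear_connection_def, rule_format, of U X X Y Y "\<lambda>q. 0"]
    U smooth_fun_const[of U 0] by blast

lemma nb_axpy:
  assumes "smooth_vf A U X" "smooth_vf A U X'" "smooth_vf A U Y" "smooth_fun A U f" "p \<in> U"
  shows "nb (\<lambda>q. f q *\<^sub>R X q + X' q) Y p = f p *\<^sub>R nb X Y p + nb X' Y p"
  using conn[unfolded linear_connection_def, rule_format, of U X X' Y Y f] U assms by blast

lemma nb_add:
  assumes "smooth_vf A U X" "smooth_vf A U Y" "smooth_vf A U Y'" "p \<in> U"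
  shows "nb X (\<lambda>q. Y q + Y' q) p = nb X Y p + nb X Y' p"
  using conn[unfolded linear_connection_def, rule_format, of U X X Y Y' "\<lambda>q. 0"]
    U smooth_fun_const[of U 0] assms by blast

lemma nb_leibniz:
  assumes "smooth_vf A U X" "smooth_vf A U Y" "smooth_fun A U f" "p \<in> U"
  shows "nb X (\<lambda>q. f q *\<^sub>R Y q) p = vderiv A p (X p) f *\<^sub>R Y p + f p *\<^sub>R nb X Y p"
  using conn[unfolded linear_connection_def, rule_format, of U X X Y Y f] U assms by blast

section \<open>Locality and tensoriality of connections\<close>

lemma nb_cong_left:
  assumes X: "smooth_vf A U X" and X': "smooth_vf A U X'" and Y: "smooth_vf A U Y"
    and eq: "\<And>q. q \<in> U \<Longrightarrow> X q = X' q" and p: "p \<in> U"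
  shows "nb X Y p = nb X' Y p"
proof -
  define f :: "'m \<Rightarrow> real" where "f q = (if q \<in> U then 0 else 1)" for q
  have f: "smooth_fun A U f"
    by (rule smooth_fun_cong[OF U smooth_fun_const[of U 0]]) (simp add: f_def)
  have "(\<lambda>q. f q *\<^sub>R (X q - X' q) + X' q) = X"
    by (rule ext) (simp add: f_def eq)
  then have "nb X Y p = f p *\<^sub>R nb (\<lambda>q. X q - X' q) Y p + nb X' Y p"
    using nb_axpy[OF smooth_vf_diff[OF U X X'] X' Y f p] by (simp only:)
  then show ?thesis by (simp add: f_def p)
qed

lemma nb_cong_right:
  assumes X: "smooth_vf A U X" and Y: "smooth_vf A U Y" and Y': "smooth_vf A U Y'"
    and eq: "\<And>q. q \<in> U \<Longrightarrow> Y q = Y' q" and p: "p \<in> U"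
  shows "nb X Y p = nb X Y' p"
proof -
  define f :: "'m \<Rightarrow> real" where "f q = (if q \<in> U then 0 else 1)" for q
  have f: "smooth_fun A U f"
    by (rule smooth_fun_cong[OF U smooth_fun_const[of U 0]]) (simp add: f_def)
  have d: "smooth_vf A U (\<lambda>q. Y q - Y' q)" by (rule smooth_vf_diff[OF U Y Y'])
  have "(\<lambda>q. f q *\<^sub>R (Y q - Y' q) + Y' q) = Y"
    by (rule ext) (simp add: f_def eq)
  then have "nb X Y p = nb X (\<lambda>q. f q *\<^sub>R (Y q - Y' q)) p + nb X Y' p"
    using nb_add[OF X smooth_vf_scale[OF U f d] Y' p] by (simp only:)
  \<comment> \<open>The Leibniz term vanishes too: the derivative of \<open>f\<close> multiplies
    \<open>Y p - Y' p\<close>, which is zero.\<close>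
  then show ?thesis
    by (simp only: nb_leibniz[OF X d f p]) (simp add: f_def p eq)
qed

lemma nb_zero_left:
  assumes Y: "smooth_vf A U Y" and p: "p \<in> U"
  shows "nb (\<lambda>q. 0) Y p = 0"
  using nb_axpy[OF smooth_vf_zero[OF U] smooth_vf_zero[OF U] Y smooth_fun_const[of U 1] p] by simp

lemma nb_zero_right:
  assumes X: "smooth_vf A U X" and p: "p \<in> U"
  shows "nb X (\<lambda>q. 0) p = 0"
  using nb_add[OF X smooth_vf_zero[OF U] smooth_vf_zero[OF U] p] by simp

lemma nb_sum_left:
  assumes "finite I" "\<And>i. i \<in> I \<Longrightarrow> smooth_fun A U (f i)" "\<And>i. i \<in> I \<Longrightarrow> smooth_vf A U (X i)"
    and Y: "smooth_vf A U Y" and p: "p \<in> U"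
  shows "nb (\<lambda>q. \<Sum>i\<in>I. f i q *\<^sub>R X i q) Y p = (\<Sum>i\<in>I. f i p *\<^sub>R nb (X i) Y p)"
  using assms(1-3)
proof (induction I)
  case empty
  then show ?case by (simp add: nb_zero_left[OF Y p])
next
  case (insert i I)
  have "smooth_vf A U (\<lambda>q. \<Sum>i\<in>I. f i q *\<^sub>R X i q)"
    by (intro smooth_vf_sum[OF U] smooth_vf_scale[OF U]) (use insert in auto)
  then have "nb (\<lambda>q. f i q *\<^sub>R X i q + (\<Sum>i\<in>I. f i q *\<^sub>R X i q)) Y p =
     f i p *\<^sub>R nb (X i) Y p + nb (\<lambda>q. \<Sum>i\<in>I. f i q *\<^sub>R X i q) Y p"
    using insert by (intro nb_axpy Y p) auto
  then show ?case using insert by simp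
qed

lemma nb_sum_right:
  assumes X: "smooth_vf A U X" and "finite I" "\<And>i. i \<in> I \<Longrightarrow> smooth_vf A U (Y i)" and p: "p \<in> U"
  shows "nb X (\<lambda>q. \<Sum>i\<in>I. Y i q) p = (\<Sum>i\<in>I. nb X (Y i) p)"
  using assms(2,3)
proof (induction I)
  case empty
  then show ?case by (simp add: nb_zero_right[OF X p])
next
  case (insert i I)
  have "smooth_vf A U (\<lambda>q. \<Sum>i\<in>I. Y i q)"
    by (intro smooth_vf_sum[OF U]) (use insert in auto)
  then have "nb X (\<lambda>q. Y i q + (\<Sum>i\<in>I. Y i q)) p = nb X (Y i) p + nb X (\<lambda>q. \<Sum>i\<in>I. Y i q) p"
    using insert by (intro nb_add X p) auto
  then show ?case using insert by simp
qed

end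

text \<open>Expand \<open>X\<close> in coordinate fields on the overlap with the chart; linearity
  over functions in the first slot leaves only the coefficients at \<open>p\<close>.\<close>

lemma nb_chart_left:
  assumes U: "open U" "p \<in> U" and X: "smooth_vf A U X" and Y: "smooth_vf A U Y"
    and c: "smooth_chart A c" "p \<in> fst c"
  shows "nb X Y p = (\<Sum>b\<in>Basis. (coord A c p (X p) \<bullet> b) *\<^sub>R nb (\<lambda>q. tvec A c q b) Y p)"
proof -
  let ?W = "U \<inter> fst c"
  have W: "open ?W" "p \<in> ?W" using U c open_chart_dom[OF c(1)] by auto
  have X': "smooth_vf A ?W X" and Y': "smooth_vf A ?W Y"
    by (rule smooth_vf_subset[OF X], simp) (rule smooth_vf_subset[OF Y], simp)
  have f: "smooth_fun A ?W (\<lambda>q. coord A c q (X q) \<bullet> b)" for b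
    by (rule smooth_fun_coord[OF c(1) X U(1)])
  have t: "smooth_vf A ?W (\<lambda>q. tvec A c q b)" for b
    by (rule smooth_vf_subset[OF smooth_vf_tvec[OF c(1)]]) simp
  have "nb X Y p = nb (\<lambda>q. \<Sum>b\<in>Basis. (coord A c q (X q) \<bullet> b) *\<^sub>R tvec A c q b) Y p"
  proof (rule nb_cong_left[OF W(1) X' _ Y' _ W(2)])
    show "smooth_vf A ?W (\<lambda>q. \<Sum>b\<in>Basis. (coord A c q (X q) \<bullet> b) *\<^sub>R tvec A c q b)"
      by (intro smooth_vf_sum[OF W(1) finite_Basis] smooth_vf_scale[OF W(1) f t])
  qed (use coord_frame_expansion[OF c(1)] in blast)
  then show ?thesis
    by (simp only: nb_sum_left[OF W(1) finite_Basis f t Y' W(2)])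
qed

lemma nb_tensorial_left:
  assumes "open U" "p \<in> U" "smooth_vf A U X" "smooth_vf A U X'" "smooth_vf A U Y" "X p = X' p"
  shows "nb X Y p = nb X' Y p"
  using nb_chart_left[OF assms(1,2,3,5) pref_smooth_chart pref_in(2)]
    nb_chart_left[OF assms(1,2,4,5) pref_smooth_chart pref_in(2)] assms(6) by simp

end

section \<open>The contorsion as a tensor\<close>

locale two_connections = connection A nb + bar: connection A nbbar
  for A :: "('m::topological_space, 'e::euclidean_space) chart set" and nb nbbar
begin

text \<open>Both connections differentiate the coefficients of \<open>Y\<close> in the same way, so
  the Leibniz terms cancel and \<open>Y\<close> enters only through its value at
  \<open>p\<close>.\<close>

lemma difference_chart_right:
  assumes U: "open U" "p \<in> U" and X: "smooth_vf A U X" and Y: "smooth_vf A U Y"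
    and c: "smooth_chart A c" "p \<in> fst c"
  shows "nbbar X Y p - nb X Y p = (\<Sum>b\<in>Basis. (coord A c p (Y p) \<bullet> b) *\<^sub>R
     (nbbar X (\<lambda>q. tvec A c q b) p - nb X (\<lambda>q. tvec A c q b) p))"
proof -
  let ?W = "U \<inter> fst c" and ?f = "\<lambda>b q. coord A c q (Y q) \<bullet> b" and ?t = "\<lambda>b q. tvec A c q b"
  have W: "open ?W" "p \<in> ?W" using U c open_chart_dom[OF c(1)] by auto
  have X': "smooth_vf A ?W X" and Y': "smooth_vf A ?W Y"
    by (rule smooth_vf_subset[OF X], simp) (rule smooth_vf_subset[OF Y], simp)
  have f: "smooth_fun A ?W (?f b)" for b
    by (rule smooth_fun_coord[OF c(1) Y U(1)])
  have t: "smooth_vf A ?W (?t b)" for b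
    by (rule smooth_vf_subset[OF smooth_vf_tvec[OF c(1)]]) simp
  have ft: "smooth_vf A ?W (\<lambda>q. ?f b q *\<^sub>R ?t b q)" for b
    by (rule smooth_vf_scale[OF W(1) f t])
  have e: "Y q = (\<Sum>b\<in>Basis. ?f b q *\<^sub>R ?t b q)" if "q \<in> ?W" for q
    using coord_frame_expansion[OF c(1), of q "Y q"] that by blast
  have s: "smooth_vf A ?W (\<lambda>q. \<Sum>b\<in>Basis. ?f b q *\<^sub>R ?t b q)"
    by (intro smooth_vf_sum[OF W(1) finite_Basis] ft)
  have 1: "nb X Y p = (\<Sum>b\<in>Basis. vderiv A p (X p) (?f b) *\<^sub>R ?t b p + ?f b p *\<^sub>R nb X (?t b) p)"
    by (simp only: nb_cong_right[OF W(1) X' Y' s e W(2)] nb_sum_right[OF W(1) X' finite_Basis ft W(2)]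
        nb_leibniz[OF W(1) X' t f W(2)])
  have 2: "nbbar X Y p = (\<Sum>b\<in>Basis. vderiv A p (X p) (?f b) *\<^sub>R ?t b p + ?f b p *\<^sub>R nbbar X (?t b) p)"
    by (simp only: bar.nb_cong_right[OF W(1) X' Y' s e W(2)] bar.nb_sum_right[OF W(1) X' finite_Basis ft W(2)]
        bar.nb_leibniz[OF W(1) X' t f W(2)])
  show ?thesis
    unfolding 1 2 sum_subtractf[symmetric] by (simp add: scaleR_diff_right)
qed

lemma tvec_pref: "tvec A (pref A p) p v = v"
  using tvec_coord[OF pref_smooth_chart pref_in(2), of p v] by (simp add: coord_pref)

lemma contorsion_eq:
  assumes U: "open U" "p \<in> U" and X: "smooth_vf A U X" and Y: "smooth_vf A U Y"
  shows "contorsion A nbbar nb p (X p) (Y p) = nbbar X Y p - nb X Y p"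
proof -
  let ?c = "pref A p"
  let ?W = "U \<inter> fst ?c"
  note c = pref_smooth_chart[of p] pref_in(2)[of p]
  have W: "open ?W" "p \<in> ?W" using U c open_chart_dom[OF c(1)] by auto
  have X': "smooth_vf A ?W X" and Y': "smooth_vf A ?W Y"
    by (rule smooth_vf_subset[OF X], simp) (rule smooth_vf_subset[OF Y], simp)
  have cf: "smooth_vf A ?W (const_field A p v)" for v
    unfolding const_field_def[abs_def]
    by (rule smooth_vf_subset[OF smooth_vf_tvec[OF c(1)]]) simp
  have cp: "const_field A p v p = v" for v
    by (simp add: const_field_def tvec_pref)
  \<comment> \<open>The second field can be exchanged only in the difference of the connections, the
    first one in each connection separately.\<close>
  have "nbbar X Y p - nb X Y p = nbbar X (const_field A p (Y p)) p - nb X (const_field A p (Y p)) p"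
    by (simp only: difference_chart_right[OF W X' Y' c] difference_chart_right[OF W X' cf c] cp)
  also have "\<dots> = contorsion A nbbar nb p (X p) (Y p)"
    unfolding contorsion_def
    by (simp only: nb_tensorial_left[OF W X' cf cf cp[symmetric]] bar.nb_tensorial_left[OF W X' cf cf cp[symmetric]])
  finally show ?thesis by simp
qed

text \<open>In each of the two expansions one argument appears only through its basis coefficients
  and the other factors do not involve it, so linearity in that slot can be read off.\<close>

lemma bilinear_contorsion: "bilinear (contorsion A nbbar nb p)"
proof -
  let ?c = "pref A p"
  note c = pref_smooth_chart[of p] pref_in(2)[of p]
  have W: "open (fst ?c)" by (rule open_chart_dom[OF c(1)])
  have cf: "smooth_vf A (fst ?c) (const_field A p v)" for v
    unfolding const_field_def[abs_def] by (rule smooth_vf_tvec[OF c(1)])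
  have cp: "coord A ?c p (const_field A p v p) = v" for v
    by (simp add: const_field_def tvec_pref coord_pref)
  have 1: "contorsion A nbbar nb p x y = (\<Sum>b\<in>Basis. (x \<bullet> b) *\<^sub>R
     (nbbar (\<lambda>q. tvec A ?c q b) (const_field A p y) p - nb (\<lambda>q. tvec A ?c q b) (const_field A p y) p))" for x y
    unfolding contorsion_def nb_chart_left[OF W c(2) cf cf c] bar.nb_chart_left[OF W c(2) cf cf c] cp
      sum_subtractf[symmetric] scaleR_diff_right by (rule refl)
  have 2: "contorsion A nbbar nb p x y = (\<Sum>b\<in>Basis. (y \<bullet> b) *\<^sub>R
     (nbbar (const_field A p x) (\<lambda>q. tvec A ?c q b) p - nb (const_field A p x) (\<lambda>q. tvec A ?c q b) p))" for x y
    unfolding contorsion_def difference_chart_right[OF W c(2) cf cf c] cp by (rule refl)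
  have "linear (\<lambda>x. contorsion A nbbar nb p x y)" for y
    unfolding 1 by (rule linearI) (simp_all add: inner_add_left scaleR_left_distrib sum.distrib scaleR_sum_right)
  moreover have "linear (contorsion A nbbar nb p x)" for x
    by (rule linearI; unfold 2) (simp_all add: inner_add_left scaleR_left_distrib sum.distrib scaleR_sum_right)
  ultimately show ?thesis by (simp add: bilinear_def)
qed

end

section \<open>Frames and orthogonal distributions\<close>

lemma inner_formD:
  assumes "inner_form h"
  shows "linear (\<lambda>x. h x y)" "linear (h x)" "h x y = h y x" "x \<noteq> 0 \<Longrightarrow> h x x > 0"
  using assms by (auto simp: inner_form_def bilinear_def)

lemma inner_form_self_eq_0:
  assumes "inner_form h" "h x x = 0" shows "x = 0"
  using inner_formD(4)[OF assms(1), of x] assms(2) by force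

lemma inner_form_orthonormal_independent:
  fixes k :: nat
  assumes h: "inner_form h"
    and on: "\<And>a b. a \<in> {1..k} \<Longrightarrow> b \<in> {1..k} \<Longrightarrow> h (E a) (E b) = (if a = b then 1 else 0)"
  shows "independent (E ` {1..k})" "card (E ` {1..k}) = k"
proof -
  have inj: "inj_on E {1..k}"
  proof (rule inj_onI)
    fix a b assume ab: "a \<in> {1..k}" "b \<in> {1..k}" "E a = E b"
    show "a = b" using on[OF ab(1,1)] on[OF ab(1,2)] ab(3) by (simp split: if_splits)
  qed
  then show "card (E ` {1..k}) = k" by (simp add: card_image)
  show "independent (E ` {1..k})"
    unfolding dependent_def
  proof
    assume "\<exists>v\<in>E ` {1..k}. v \<in> span (E ` {1..k} - {v})"
    then obtain a where a: "a \<in> {1..k}" "E a \<in> span (E ` {1..k} - {E a})" by blast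
    have "subspace {v. h v (E a) = 0}"
      by (auto simp: subspace_def linear_0[OF inner_formD(1)[OF h]] linear_add[OF inner_formD(1)[OF h]]
          linear_scale[OF inner_formD(1)[OF h]])
    moreover have "E ` {1..k} - {E a} \<subseteq> {v. h v (E a) = 0}"
      using on[OF _ a(1)] by auto
    ultimately have "E a \<in> {v. h v (E a) = 0}"
      using span_minimal a(2) by blast
    then show False using on[OF a(1,1)] by simp
  qed
qed

text \<open>Orthonormal vectors are independent, so \<open>k\<close> of them span \<open>V\<close>.
  The vectors that equal their own expansion form a subspace, and it contains every
  \<open>E a\<close>.\<close>

lemma orthonormal_expansion:
  fixes k :: nat and V :: "'e::euclidean_space set"
  assumes h: "inner_form h" and V: "subspace V" "dim V = k" and EV: "\<And>a. a \<in> {1..k} \<Longrightarrow> E a \<in> V"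
    and on: "\<And>a b. a \<in> {1..k} \<Longrightarrow> b \<in> {1..k} \<Longrightarrow> h (E a) (E b) = (if a = b then 1 else 0)"
    and v: "v \<in> V"
  shows "v = (\<Sum>a=1..k. h v (E a) *\<^sub>R E a)"
proof -
  note ind = inner_form_orthonormal_independent[OF h on]
  have "V \<subseteq> span (E ` {1..k})"
    using ind V(2) EV by (intro card_ge_dim_independent) auto
  then have vs: "v \<in> span (E ` {1..k})" using v by blast
  have lin: "linear (\<lambda>v. \<Sum>a=1..k. h v (E a) *\<^sub>R E a)"
    by (rule linearI) (simp_all add: linear_add[OF inner_formD(1)[OF h]] linear_scale[OF inner_formD(1)[OF h]]
        scaleR_left_distrib sum.distrib scaleR_sum_right)
  have "subspace {v. v = (\<Sum>a=1..k. h v (E a) *\<^sub>R E a)}"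
    using linear_subspace_kernel[OF linear_compose_sub[OF linear_ident lin]] by (simp only: right_minus_eq)
  moreover have "E ` {1..k} \<subseteq> {v. v = (\<Sum>a=1..k. h v (E a) *\<^sub>R E a)}"
  proof (clarify)
    fix a assume a: "a \<in> {1..k}"
    have "(\<Sum>b=1..k. h (E a) (E b) *\<^sub>R E b) = (\<Sum>b=1..k. if a = b then E b else 0)"
    proof (rule sum.cong[OF refl])
      fix b assume "b \<in> {1..k}"
      then show "h (E a) (E b) *\<^sub>R E b = (if a = b then E b else 0)" by (simp only: on[OF a] split: if_split) simp
    qed
    also have "\<dots> = E a" using a by (simp add: sum.delta)
    finally show "E a = (\<Sum>b=1..k. h (E a) (E b) *\<^sub>R E b)" ..
  qed
  ultimately have "v \<in> {v. v = (\<Sum>a=1..k. h v (E a) *\<^sub>R E a)}"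
    by (intro span_minimal[THEN subsetD, OF _ _ vs])
  then show ?thesis by (rule CollectD)
qed

text \<open>Otherwise \<open>k - 1\<close> vectors would span a space of dimension \<open>k\<close>.
  Consequently no vector produced by orthogonalisation is zero.\<close>

lemma spanning_family_step:
  fixes X :: "nat \<Rightarrow> 'e::euclidean_space"
  assumes "dim (span (X ` {1..k})) = k" "m < k"
  shows "X (Suc m) \<notin> span (X ` {1..m})"
proof
  assume *: "X (Suc m) \<in> span (X ` {1..m})"
  have "X ` {1..k} \<subseteq> span (X ` ({1..k} - {Suc m}))"
  proof clarify
    fix a assume "a \<in> {1..k}"
    show "X a \<in> span (X ` ({1..k} - {Suc m}))"
    proof (cases "a = Suc m")
      case True
      have "span (X ` {1..m}) \<subseteq> span (X ` ({1..k} - {Suc m}))"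
        using assms(2) by (intro span_mono image_mono) auto
      then show ?thesis using True * by blast
    next
      case False
      then show ?thesis using \<open>a \<in> {1..k}\<close> by (intro span_base) auto
    qed
  qed
  then have "span (X ` {1..k}) \<subseteq> span (X ` ({1..k} - {Suc m}))"
    by (metis span_mono span_span)
  then have "dim (span (X ` {1..k})) \<le> card (X ` ({1..k} - {Suc m}))"
    by (intro dim_le_card) auto
  also have "\<dots> \<le> card ({1..k} - {Suc m})" by (rule card_image_le) simp
  also have "\<dots> < k" using assms(2) by simp
  finally show False using assms(1) by simp
qed

section \<open>Smooth orthonormal frames\<close>

locale riem_mfd = smooth_mfd A
  for A :: "('m::topological_space, 'e::euclidean_space) chart set" +
  fixes g :: "'m \<Rightarrow> 'e \<Rightarrow> 'e \<Rightarrow> real"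
  assumes riem: "riemannian_metric A g"
begin

lemma inner_form_g: "inner_form (g p)"
  using riem by (simp add: riemannian_metric_def)

lemmas linear_g_left = inner_formD(1)[OF inner_form_g]
lemmas linear_g_right = inner_formD(2)[OF inner_form_g]
lemmas g_sym = inner_formD(3)[OF inner_form_g]
lemmas g_pos = inner_formD(4)[OF inner_form_g]
lemmas g_self_eq_0 = inner_form_self_eq_0[OF inner_form_g]

lemmas g_left = linear_add[OF linear_g_left] linear_diff[OF linear_g_left] linear_scale[OF linear_g_left]
  linear_0[OF linear_g_left] linear_sum[OF linear_g_left] linear_neg[OF linear_g_left]
lemmas g_right = linear_add[OF linear_g_right] linear_diff[OF linear_g_right] linear_scale[OF linear_g_right]
  linear_0[OF linear_g_right] linear_sum[OF linear_g_right] linear_neg[OF linear_g_right]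

lemma smooth_g:
  "open U \<Longrightarrow> smooth_vf A U X \<Longrightarrow> smooth_vf A U Y \<Longrightarrow> smooth_fun A U (\<lambda>p. g p (X p) (Y p))"
  using riem by (simp add: riemannian_metric_def)

text \<open>\<open>orthonormal_frame\<close> with neighbourhood and rank made explicit, so that the
  neighbourhood can be shrunk and the relations are available at all of its points.\<close>

definition frame_on :: "'m set \<Rightarrow> nat \<Rightarrow> ('m \<Rightarrow> 'e set) \<Rightarrow> (nat \<Rightarrow> 'm \<Rightarrow> 'e) \<Rightarrow> bool" where
  "frame_on U k D E \<longleftrightarrow> (\<forall>a\<in>{1..k}. smooth_vf A U (E a)) \<and>
     (\<forall>q\<in>U. \<forall>a\<in>{1..k}. E a q \<in> D q \<and> (\<forall>b\<in>{1..k}. g q (E a q) (E b q) = (if a = b then 1 else 0)))"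

lemma frame_onD:
  assumes "frame_on U k D E"
  shows "a \<in> {1..k} \<Longrightarrow> smooth_vf A U (E a)"
    "a \<in> {1..k} \<Longrightarrow> q \<in> U \<Longrightarrow> E a q \<in> D q"
    "a \<in> {1..k} \<Longrightarrow> b \<in> {1..k} \<Longrightarrow> q \<in> U \<Longrightarrow> g q (E a q) (E b q) = (if a = b then 1 else 0)"
  using assms by (auto simp: frame_on_def)

lemma frame_on_subset: "frame_on U k D E \<Longrightarrow> V \<subseteq> U \<Longrightarrow> frame_on V k D E"
  unfolding frame_on_def using smooth_vf_subset[of A U _ V] by blast

text \<open>Gram-Schmidt at all points at once: the coefficients are smooth because the metric is,
  and normalisation is smooth because the orthogonalised field has no zero. The target is the span
  of the first \<open>m\<close> fields, so that the next field is known to lie outside it.\<close>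

lemma gram_schmidt:
  assumes U: "open U" and X: "\<And>a. a \<in> {1..k} \<Longrightarrow> smooth_vf A U (X a)"
    and dim: "\<And>q. q \<in> U \<Longrightarrow> dim (span ((\<lambda>a. X a q) ` {1..k})) = k"
  shows "m \<le> k \<Longrightarrow> \<exists>E. frame_on U m (\<lambda>q. span ((\<lambda>a. X a q) ` {1..m})) E"
proof (induction m)
  case 0
  then show ?case by (simp add: frame_on_def)
next
  case (Suc m)
  then obtain E where E: "frame_on U m (\<lambda>q. span ((\<lambda>a. X a q) ` {1..m})) E" by auto
  have k: "Suc m \<in> {1..k}" using Suc by auto
  define Y where "Y q = X (Suc m) q - (\<Sum>a=1..m. g q (X (Suc m) q) (E a q) *\<^sub>R E a q)" for q
  have Y: "smooth_vf A U Y"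
    unfolding Y_def[abs_def]
    by (intro smooth_vf_diff[OF U X[OF k]] smooth_vf_sum[OF U finite_atLeastAtMost]
        smooth_vf_scale[OF U smooth_g[OF U X[OF k]]] frame_onD(1)[OF E])
  have "Y q \<noteq> 0" if q: "q \<in> U" for q
  proof
    assume "Y q = 0"
    then have "X (Suc m) q = (\<Sum>a=1..m. g q (X (Suc m) q) (E a q) *\<^sub>R E a q)" by (simp add: Y_def)
    also have "\<dots> \<in> span ((\<lambda>a. X a q) ` {1..m})"
      by (intro span_sum span_scale frame_onD(2)[OF E] q)
    finally show False using spanning_family_step[OF dim[OF q], of m] Suc by simp
  qed
  then have Ypos: "g q (Y q) (Y q) > 0" if "q \<in> U" for q using that g_pos by blast
  define e where "e q = inverse (sqrt (g q (Y q) (Y q))) *\<^sub>R Y q" for q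
  have e: "smooth_vf A U e"
    unfolding e_def[abs_def]
    by (intro smooth_vf_scale[OF U] smooth_fun_inverse_sqrt[OF U] smooth_g[OF U] Y Ypos)
  have orth: "g q (Y q) (E b q) = 0" if q: "q \<in> U" and b: "b \<in> {1..m}" for q b
  proof -
    have "(\<Sum>a=1..m. g q (X (Suc m) q) (E a q) * g q (E a q) (E b q)) =
        (\<Sum>a=1..m. if b = a then g q (X (Suc m) q) (E a q) else 0)"
      by (rule sum.cong) (simp_all add: frame_onD(3)[OF E _ b q])
    then show ?thesis using b by (simp add: Y_def g_left sum.delta)
  qed
  have ee: "g q (e q) (e q) = 1" if q: "q \<in> U" for q
    using Ypos[OF q] by (simp add: e_def g_left g_right field_simps)
  define E' where "E' = E(Suc m := e)"
  have "frame_on U (Suc m) (\<lambda>q. span ((\<lambda>a. X a q) ` {1..Suc m})) E'"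
    unfolding frame_on_def
  proof (intro conjI ballI)
    fix a assume "a \<in> {1..Suc m}"
    then show "smooth_vf A U (E' a)"
      using e frame_onD(1)[OF E, of a] by (cases "a = Suc m") (auto simp: E'_def)
  next
    fix q a assume q: "q \<in> U" and a: "a \<in> {1..Suc m}"
    have sub: "span ((\<lambda>a. X a q) ` {1..m}) \<subseteq> span ((\<lambda>a. X a q) ` {1..Suc m})"
      by (intro span_mono image_mono) auto
    have Eb: "E b q \<in> span ((\<lambda>a. X a q) ` {1..Suc m})" if "b \<in> {1..m}" for b
      using frame_onD(2)[OF E that q] sub by blast
    show "E' a q \<in> span ((\<lambda>a. X a q) ` {1..Suc m})"
    proof (cases "a = Suc m")
      case True
      have "X (Suc m) q \<in> span ((\<lambda>a. X a q) ` {1..Suc m})" by (intro span_base) auto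
      then have "Y q \<in> span ((\<lambda>a. X a q) ` {1..Suc m})"
        unfolding Y_def by (intro span_diff span_sum span_scale Eb)
      then show ?thesis using True by (simp add: E'_def e_def span_scale)
    next
      case False
      then show ?thesis using Eb[of a] a by (simp add: E'_def)
    qed
    fix b assume b: "b \<in> {1..Suc m}"
    have eE: "g q (e q) (E c q) = 0" "g q (E c q) (e q) = 0" if "c \<in> {1..m}" for c
      using orth[OF q that] g_sym[of q "E c q" "Y q"] by (simp_all add: e_def g_left g_right)
    have "a = Suc m \<or> a \<in> {1..m}" "b = Suc m \<or> b \<in> {1..m}" using a b by auto
    then show "g q (E' a q) (E' b q) = (if a = b then 1 else 0)"
    proof (elim disjE)
      assume "a \<in> {1..m}" "b \<in> {1..m}"
      then show ?thesis using frame_onD(3)[OF E _ _ q, of a b] by (simp add: E'_def)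
    qed (simp_all add: E'_def ee[OF q] eE)
  qed
  then show ?case by blast
qed

lemma frame_on_exists:
  assumes "smooth_distribution A k D"
  obtains U E where "open U" "p \<in> U" "frame_on U k D E"
proof -
  have dim: "dim (D q) = k" for q using assms by (simp add: smooth_distribution_def)
  have "\<exists>U (X :: nat \<Rightarrow> 'm \<Rightarrow> 'e). open U \<and> p \<in> U \<and> (\<forall>a\<in>{1..k}. smooth_vf A U (X a)) \<and>
      (\<forall>q\<in>U. span ((\<lambda>a. X a q) ` {1..k}) = D q)"
    using assms unfolding smooth_distribution_def by (elim allE[of _ p] conjE)
  then obtain U X where U: "open U" "p \<in> U" and X': "\<forall>a\<in>{1..k}. smooth_vf A U (X a)"
    and sp': "\<forall>q\<in>U. span ((\<lambda>a. X a q) ` {1..k}) = D q"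
    by (elim exE conjE)
  note X = bspec[OF X'] and sp = bspec[OF sp']
  have "\<exists>E. frame_on U k (\<lambda>q. span ((\<lambda>a. X a q) ` {1..k})) E"
    by (rule gram_schmidt[OF U(1) X _ order_refl]) (simp_all only: sp dim)
  then obtain E where "frame_on U k (\<lambda>q. span ((\<lambda>a. X a q) ` {1..k})) E" by blast
  then have "frame_on U k D E"
    unfolding frame_on_def using sp by blast
  then show thesis using that U by blast
qed

text \<open>\<open>frame\<close> is a choice; existence of some orthonormal frame makes the chosen
  one orthonormal on a whole neighbourhood of \<open>p\<close>.\<close>

lemma frame_on_frame:
  assumes D: "smooth_distribution A k D"
  obtains U where "open U" "p \<in> U" "frame_on U k D (frame A g D p)"
proof -
  have dim: "dim (D p) = k" using D by (simp add: smooth_distribution_def)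
  have eq: "orthonormal_frame A g D p E \<longleftrightarrow> (\<exists>U. open U \<and> p \<in> U \<and> frame_on U k D E)" for E
    by (simp add: orthonormal_frame_def frame_on_def dim)
  obtain U E where "open U" "p \<in> U" "frame_on U k D E" by (rule frame_on_exists[OF D])
  then have "\<exists>E. orthonormal_frame A g D p E" unfolding eq by blast
  then have "orthonormal_frame A g D p (frame A g D p)"
    unfolding frame_def by (rule someI_ex)
  then show thesis unfolding eq using that by blast
qed

end

section \<open>Orthogonal splitting of the tangent spaces\<close>

locale split_mfd = riem_mfd A g
  for A :: "('m::topological_space, 'e::euclidean_space) chart set" and g +
  fixes D D' :: "'m \<Rightarrow> 'e set" and n m :: nat
  assumes D: "smooth_distribution A n D" and D': "smooth_distribution A m D'"
    and compl: "complementary_orthogonal g D D'"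
begin

text \<open>The two distributions enter symmetrically, so facts about \<open>D'\<close> are obtained
  from those about \<open>D\<close> by this exchange.\<close>

lemma split_swap: "split_mfd A g D' D m n"
proof unfold_locales
  show "complementary_orthogonal g D' D"
    unfolding complementary_orthogonal_def
  proof (intro allI conjI ballI)
    fix p
    have c: "D p \<inter> D' p = {0}" "{x + y |x y. x \<in> D p \<and> y \<in> D' p} = UNIV"
      "\<And>x y. x \<in> D p \<Longrightarrow> y \<in> D' p \<Longrightarrow> g p x y = 0"
      using compl by (simp_all add: complementary_orthogonal_def)
    show "D' p \<inter> D p = {0}" using c(1) by blast
    have "v \<in> {x + y |x y. x \<in> D' p \<and> y \<in> D p}" for v
    proof -
      have "v \<in> {x + y |x y. x \<in> D p \<and> y \<in> D' p}" using c(2) by simp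
      then obtain x y where xy: "x \<in> D p" "y \<in> D' p" "v = x + y" by blast
      then have "v = y + x" by (simp add: add.commute)
      then show ?thesis using xy(1,2) by blast
    qed
    then show "{x + y |x y. x \<in> D' p \<and> y \<in> D p} = UNIV" by blast
    show "g p x y = 0" if "x \<in> D' p" "y \<in> D p" for x y
      using c(3)[OF that(2,1)] g_sym[of p x y] by simp
  qed
qed (fact D D')+

lemma subspace_D: "subspace (D q)" and dim_D: "dim (D q) = n"
  using D by (simp_all add: smooth_distribution_def)

lemma orth: "x \<in> D q \<Longrightarrow> y \<in> D' q \<Longrightarrow> g q x y = 0"
  using compl by (simp add: complementary_orthogonal_def)

lemma orth': "x \<in> D q \<Longrightarrow> y \<in> D' q \<Longrightarrow> g q y x = 0"
  using orth[of x q y] g_sym[of q x y] by simp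

lemma decomp: obtains x y where "x \<in> D q" "y \<in> D' q" "v = x + y"
proof -
  have "v \<in> {x + y |x y. x \<in> D q \<and> y \<in> D' q}"
    using compl by (simp add: complementary_orthogonal_def)
  then show thesis using that by blast
qed

text \<open>The \<open>D'\<close>-part of \<open>v\<close> is orthogonal to itself and therefore
  zero.\<close>

lemma mem_DI:
  assumes "\<And>y. y \<in> D' q \<Longrightarrow> g q v y = 0"
  shows "v \<in> D q"
proof -
  obtain x y where xy: "x \<in> D q" "y \<in> D' q" "v = x + y" by (rule decomp)
  have "g q y y = 0" using assms[OF xy(2)] orth[OF xy(1,2)] by (simp add: xy(3) g_left)
  then show ?thesis using xy g_self_eq_0 by force
qed

text \<open>\<open>proj\<close> is a definite description. The \<open>D\<close>-part of the
  decomposition satisfies it, and positivity of \<open>g\<close> makes this vector the only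
  one.\<close>

lemma proj_D:
  shows "proj g D q v \<in> D q" and "w \<in> D q \<Longrightarrow> g q (proj g D q v) w = g q v w"
proof -
  obtain x y where xy: "x \<in> D q" "y \<in> D' q" "v = x + y" by (rule decomp)
  have "proj g D q v = x"
    unfolding proj_def
  proof (rule the_equality)
    show "x \<in> D q \<and> (\<forall>w\<in>D q. g q (v - x) w = 0)"
      using xy orth' by simp
  next
    fix u assume u: "u \<in> D q \<and> (\<forall>w\<in>D q. g q (v - u) w = 0)"
    have xu: "x - u \<in> D q" using u xy(1) subspace_D subspace_diff by blast
    have "g q (v - u) (x - u) = 0" using u xu by blast
    then have "g q (x - u) (x - u) = 0"
      using orth'[OF xu xy(2)] by (simp add: xy(3) g_left)
    then show "u = x" using g_self_eq_0 by force
  qed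
  then show "proj g D q v \<in> D q" and "w \<in> D q \<Longrightarrow> g q (proj g D q v) w = g q v w"
    using xy orth' by (simp_all add: g_left)
qed

lemma frame_expansion:
  assumes "frame_on U n D E" "q \<in> U" "v \<in> D q"
  shows "v = (\<Sum>a=1..n. g q v (E a q) *\<^sub>R E a q)"
  by (rule orthonormal_expansion[OF inner_form_g subspace_D dim_D _ _ assms(3)])
    (use frame_onD(2,3)[OF assms(1)] assms(2) in blast)+

lemma full_expansion:
  assumes E: "frame_on U n D E" and F: "frame_on U m D' F" and q: "q \<in> U"
  shows "v = (\<Sum>a=1..n. g q v (E a q) *\<^sub>R E a q) + (\<Sum>i=1..m. g q v (F i q) *\<^sub>R F i q)"
proof -
  obtain x y where xy: "x \<in> D q" "y \<in> D' q" "v = x + y" by (rule decomp)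
  have "(\<Sum>a=1..n. g q v (E a q) *\<^sub>R E a q) = (\<Sum>a=1..n. g q x (E a q) *\<^sub>R E a q)"
    by (rule sum.cong) (simp_all add: xy(3) g_left orth'[OF frame_onD(2)[OF E _ q] xy(2)])
  moreover have "(\<Sum>i=1..m. g q v (F i q) *\<^sub>R F i q) = (\<Sum>i=1..m. g q y (F i q) *\<^sub>R F i q)"
    by (rule sum.cong) (simp_all add: xy(3) g_left orth[OF xy(1) frame_onD(2)[OF F _ q]])
  ultimately show ?thesis
    by (simp only: frame_expansion[OF E q xy(1), symmetric]
        split_mfd.frame_expansion[OF split_swap F q xy(2), symmetric] xy(3))
qed

lemma inner_expansion:
  assumes E: "frame_on U n D E" and F: "frame_on U m D' F" and q: "q \<in> U"
  shows "g q v w = (\<Sum>a=1..n. g q v (E a q) * g q w (E a q)) + (\<Sum>i=1..m. g q v (F i q) * g q w (F i q))"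
proof -
  have "g q v w = g q ((\<Sum>a=1..n. g q v (E a q) *\<^sub>R E a q) + (\<Sum>i=1..m. g q v (F i q) *\<^sub>R F i q)) w"
    using full_expansion[OF E F q, of v] by (rule arg_cong)
  also have "\<dots> = (\<Sum>a=1..n. g q v (E a q) * g q (E a q) w) + (\<Sum>i=1..m. g q v (F i q) * g q (F i q) w)"
    by (simp add: g_left)
  finally show ?thesis by (simp only: g_sym[of q w])
qed

end

section \<open>Involutivity of integrable distributions\<close>

text \<open>For \<open>z\<close> orthogonal to \<open>W\<close> the function
  \<open>f y \<bullet> z\<close> is zero near \<open>x\<close>, so its derivative is zero. Taking
  for \<open>z\<close> the part of \<open>f' u\<close> orthogonal to \<open>W\<close> shows that
  this part vanishes.\<close>

lemma has_derivative_in_subspace: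
  fixes f :: "'a::real_normed_vector \<Rightarrow> 'b::euclidean_space"
  assumes f: "(f has_derivative f') (at x)" and S: "open S" "x \<in> S" and W: "subspace W"
    and fW: "\<And>y. y \<in> S \<Longrightarrow> f y \<in> W"
  shows "f' u \<in> W"
proof -
  have sp: "span W = W" using W by (simp add: span_eq_iff)
  obtain y z where yz: "y \<in> span W" "\<And>w. w \<in> span W \<Longrightarrow> orthogonal z w" "f' u = y + z"
    using orthogonal_subspace_decomp_exists[of W "f' u"] by metis
  have "((\<lambda>y. f y \<bullet> z) has_derivative (\<lambda>u. f' u \<bullet> z)) (at x)"
    by (rule has_derivative_inner_left[OF f])
  moreover have "((\<lambda>y. f y \<bullet> z) has_derivative (\<lambda>u. 0)) (at x)"
  proof (rule has_derivative_transform_within_open[OF has_derivative_const S])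
    fix y assume "y \<in> S"
    then show "0 = f y \<bullet> z" using yz(2)[of "f y"] fW[of y] sp by (simp add: orthogonal_def inner_commute)
  qed
  ultimately have "(\<lambda>u. f' u \<bullet> z) = (\<lambda>u. 0)" by (rule has_derivative_unique)
  then have "f' u \<bullet> z = 0" by metis
  moreover have "y \<bullet> z = 0" using yz(2)[OF yz(1)] by (simp add: orthogonal_def inner_commute)
  ultimately have "z = 0" by (simp add: yz(3) inner_add_left)
  then show ?thesis using yz sp by simp
qed

context smooth_mfd begin

text \<open>In a foliated chart \<open>D\<close> is a constant subspace \<open>W\<close>. Fields of
  \<open>D\<close> have components in \<open>W\<close>, and so do the derivatives of these
  components that make up the bracket.\<close>

lemma lie_bracket_in_distribution:
  assumes int: "integrable_distribution A D" and U: "open U" "p \<in> U"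
    and X: "smooth_vf A U X" and Y: "smooth_vf A U Y"
    and XD: "\<And>q. q \<in> U \<Longrightarrow> X q \<in> D q" and YD: "\<And>q. q \<in> U \<Longrightarrow> Y q \<in> D q"
  shows "lie_bracket A X Y p \<in> D p"
proof -
  from int obtain c W where c: "smooth_chart A c" "p \<in> fst c" and W: "subspace W"
    and cD: "\<And>q. q \<in> fst c \<Longrightarrow> coord A c q ` D q = W"
    unfolding integrable_distribution_def by metis
  let ?S = "snd c ` (U \<inter> fst c)"
  have S: "open ?S" "snd c p \<in> ?S" using open_image[OF c(1) U(1)] U c by auto
  have "frechet_derivative (rep A c Z) (at (snd c p)) u \<in> W"
    if Z: "smooth_vf A U Z" and ZD: "\<And>q. q \<in> U \<Longrightarrow> Z q \<in> D q" for Z u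
  proof (rule has_derivative_in_subspace[OF smooth_on_has_derivative[OF smooth_vf_chart[OF Z U(1) c(1)] S(2)] S W])
    fix y assume "y \<in> ?S"
    then obtain q where "y = snd c q" "q \<in> U" "q \<in> fst c" by blast
    then show "rep A c Z y \<in> W" using rep_chart[OF c(1), of q Z] cD[of q] ZD[of q] by blast
  qed
  then have "coord A c p (lie_bracket A X Y p) \<in> W"
    unfolding lie_bracket_chart[OF X Y U c] using W X Y XD YD by (intro subspace_diff) blast+
  then have "coord A c p (lie_bracket A X Y p) \<in> coord A c p ` D p" using cD[OF c(2)] by simp
  then show ?thesis using inj_image_mem_iff[OF inj_coord[OF c]] by blast
qed

end

section \<open>Second fundamental forms of the Levi-Civita connection\<close>

locale lc_split = split_mfd A g D D' n m
  for A :: "('m::topological_space, 'e::euclidean_space) chart set" and g D D' n m +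
  fixes nb :: "('m \<Rightarrow> 'e) \<Rightarrow> ('m \<Rightarrow> 'e) \<Rightarrow> 'm \<Rightarrow> 'e"
  assumes lc: "levi_civita A g nb"
begin

sublocale connection A nb
  by unfold_locales (use lc in \<open>simp add: levi_civita_def\<close>)

lemma lc_swap: "lc_split A g D' D m n nb"
  by (rule lc_split.intro[OF split_swap]) (unfold_locales, rule lc)

lemma nb_torsion:
  assumes "open U" "smooth_vf A U X" "smooth_vf A U Y" "p \<in> U"
  shows "lie_bracket A X Y p = nb X Y p - nb Y X p"
  using lc[unfolded levi_civita_def, THEN conjunct2, rule_format, of U X Y X p] assms by simp

lemma nb_metric:
  assumes "open U" "smooth_vf A U X" "smooth_vf A U Y" "smooth_vf A U Z" "p \<in> U"
  shows "vderiv A p (X p) (\<lambda>q. g q (Y q) (Z q)) = g p (nb X Y p) (Z p) + g p (Y p) (nb X Z p)"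
  using lc[unfolded levi_civita_def, THEN conjunct2, rule_format, of U X Y Z p] assms by simp

text \<open>A constant inner product has zero derivative, so \<open>nb X\<close> can be moved from
  one factor to the other at the cost of a sign.\<close>

lemma nb_metric_const:
  assumes "open U" "smooth_vf A U X" "smooth_vf A U Y" "smooth_vf A U Z" "p \<in> U"
    and "\<And>q. q \<in> U \<Longrightarrow> g q (Y q) (Z q) = r"
  shows "g p (nb X Y p) (Z p) = - g p (Y p) (nb X Z p)"
proof -
  have "vderiv A p (X p) (\<lambda>q. g q (Y q) (Z q)) = 0"
    using assms(1,5,6) by (rule vderiv_local_const)
  then show ?thesis using nb_metric[OF assms(1-5)] by linarith
qed

lemma smooth_lie_bracket:
  assumes "open U" "smooth_vf A U X" "smooth_vf A U Y"
  shows "smooth_vf A U (lie_bracket A X Y)"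
  by (rule smooth_vf_cong[OF assms(1) smooth_vf_diff[OF assms(1) smooth_nb[OF assms] smooth_nb[OF assms(1,3,2)]]])
    (simp add: nb_torsion[OF assms])

text \<open>The Leibniz terms lie in \<open>D\<close> and disappear when paired with
  \<open>\<nu>\<close>; the rest is bilinear in \<open>X p\<close> and \<open>Y p\<close>. This is
  the tensoriality of the second fundamental form of \<open>D\<close>.\<close>

lemma second_form_expansion:
  assumes U: "open U" "p \<in> U" and E: "frame_on U n D E"
    and X: "smooth_vf A U X" and Y: "smooth_vf A U Y"
    and XD: "\<And>q. q \<in> U \<Longrightarrow> X q \<in> D q" and YD: "\<And>q. q \<in> U \<Longrightarrow> Y q \<in> D q"
    and \<nu>: "\<nu> \<in> D' p"
  shows "g p (nb X Y p) \<nu> =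
    (\<Sum>b=1..n. \<Sum>c=1..n. g p (X p) (E b p) * g p (Y p) (E c p) * g p (nb (E b) (E c) p) \<nu>)"
proof -
  have sm: "smooth_fun A U (\<lambda>q. g q (Z q) (E b q))" if "b \<in> {1..n}" "smooth_vf A U Z" for Z b
    by (rule smooth_g[OF U(1) that(2) frame_onD(1)[OF E that(1)]])
  have ex: "smooth_vf A U (\<lambda>q. \<Sum>b=1..n. g q (Z q) (E b q) *\<^sub>R E b q)" if "smooth_vf A U Z" for Z
    by (intro smooth_vf_sum[OF U(1) finite_atLeastAtMost] smooth_vf_scale[OF U(1)] sm frame_onD(1)[OF E] that)
  have eX: "X q = (\<Sum>b=1..n. g q (X q) (E b q) *\<^sub>R E b q)" if "q \<in> U" for q
    by (rule frame_expansion[OF E that XD[OF that]])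
  have eY: "Y q = (\<Sum>b=1..n. g q (Y q) (E b q) *\<^sub>R E b q)" if "q \<in> U" for q
    by (rule frame_expansion[OF E that YD[OF that]])
  have 1: "nb X Y p = (\<Sum>b=1..n. g p (X p) (E b p) *\<^sub>R nb (E b) Y p)"
    using nb_cong_left[OF U(1) X ex[OF X] Y eX U(2)]
      nb_sum_left[OF U(1) finite_atLeastAtMost sm[OF _ X] frame_onD(1)[OF E] Y U(2)] by (rule trans)
  have 2: "g p (nb (E b) Y p) \<nu> = (\<Sum>c=1..n. g p (Y p) (E c p) * g p (nb (E b) (E c) p) \<nu>)"
    if b: "b \<in> {1..n}" for b
  proof -
    have "nb (E b) Y p = nb (E b) (\<lambda>q. \<Sum>c=1..n. g q (Y q) (E c q) *\<^sub>R E c q) p"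
      by (rule nb_cong_right[OF U(1) frame_onD(1)[OF E b] Y ex[OF Y] eY U(2)])
    also have "\<dots> = (\<Sum>c=1..n. nb (E b) (\<lambda>q. g q (Y q) (E c q) *\<^sub>R E c q) p)"
      by (intro nb_sum_right[OF U(1) frame_onD(1)[OF E b] finite_atLeastAtMost _ U(2)] smooth_vf_scale[OF U(1)]
          sm Y frame_onD(1)[OF E])
    finally have *: "nb (E b) Y p = (\<Sum>c=1..n. nb (E b) (\<lambda>q. g q (Y q) (E c q) *\<^sub>R E c q) p)" .
    have "g p (nb (E b) (\<lambda>q. g q (Y q) (E c q) *\<^sub>R E c q) p) \<nu> =
        g p (Y p) (E c p) * g p (nb (E b) (E c) p) \<nu>" if c: "c \<in> {1..n}" for c
      by (simp only: nb_leibniz[OF U(1) frame_onD(1)[OF E b] frame_onD(1)[OF E c] sm[OF c Y] U(2)])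
        (simp add: g_left orth[OF frame_onD(2)[OF E c U(2)] \<nu>])
    then show ?thesis unfolding * g_left by (intro sum.cong refl)
  qed
  show ?thesis
    unfolding 1 g_left by (intro sum.cong refl) (simp add: 2 sum_distrib_left mult.assoc)
qed

text \<open>\<open>mean_curvature\<close> uses a frame chosen anew at every point. The trace of the
  second form does not depend on the frame, so a single frame on \<open>U\<close> can serve at all
  points of \<open>U\<close>.\<close>

lemma mean_curvature_frame:
  assumes H: "mean_curvature A g nb D D' p = 0"
    and U: "open U" "p \<in> U" and E: "frame_on U n D E" and \<nu>: "\<nu> \<in> D' p"
  shows "(\<Sum>a=1..n. g p (nb (E a) (E a) p) \<nu>) = 0"
proof -
  let ?G = "frame A g D p"
  obtain V where V: "open V" "p \<in> V" "frame_on V n D ?G" by (rule frame_on_frame[OF D])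
  let ?W = "U \<inter> V"
  have W: "open ?W" "p \<in> ?W" using U V by auto
  have E': "frame_on ?W n D E" and G: "frame_on ?W n D ?G"
    by (rule frame_on_subset[OF E], simp) (rule frame_on_subset[OF V(3)], simp)
  have "0 = g p (mean_curvature A g nb D D' p) \<nu>" by (simp add: H g_left)
  also have "\<dots> = (\<Sum>a=1..n. g p (nb (?G a) (?G a) p) \<nu>)"
    by (simp add: mean_curvature_def Let_def dim_D g_left split_mfd.proj_D(2)[OF split_swap \<nu>])
  also have "\<dots> = (\<Sum>a=1..n. \<Sum>b=1..n. \<Sum>c=1..n. g p (?G a p) (E b p) * g p (?G a p) (E c p) * g p (nb (E b) (E c) p) \<nu>)"
    by (intro sum.cong refl second_form_expansion[OF W E' frame_onD(1)[OF G] frame_onD(1)[OF G]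
          frame_onD(2)[OF G] frame_onD(2)[OF G] \<nu>])
  also have "\<dots> = (\<Sum>b=1..n. \<Sum>a=1..n. \<Sum>c=1..n. g p (?G a p) (E b p) * g p (?G a p) (E c p) * g p (nb (E b) (E c) p) \<nu>)"
    by (rule sum.swap)
  also have "\<dots> = (\<Sum>b=1..n. \<Sum>c=1..n. \<Sum>a=1..n. g p (?G a p) (E b p) * g p (?G a p) (E c p) * g p (nb (E b) (E c) p) \<nu>)"
    by (rule sum.cong[OF refl]) (rule sum.swap)
  \<comment> \<open>Parseval in the frame \<open>?G\<close>: the sum over \<open>a\<close> is the
    inner product of \<open>E b\<close> and \<open>E c\<close>.\<close>
  also have "\<dots> = (\<Sum>b=1..n. \<Sum>c=1..n. g p (E b p) (E c p) * g p (nb (E b) (E c) p) \<nu>)"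
  proof (intro sum.cong refl)
    fix b c assume b: "b \<in> {1..n}" and c: "c \<in> {1..n}"
    have "g p (E b p) (E c p) = g p (\<Sum>a=1..n. g p (E b p) (?G a p) *\<^sub>R ?G a p) (E c p)"
      using frame_expansion[OF G W(2) frame_onD(2)[OF E' b W(2)]] by (rule arg_cong)
    also have "\<dots> = (\<Sum>a=1..n. g p (?G a p) (E b p) * g p (?G a p) (E c p))"
      by (simp add: g_left g_sym[of p "E b p"])
    finally show "(\<Sum>a=1..n. g p (?G a p) (E b p) * g p (?G a p) (E c p) * g p (nb (E b) (E c) p) \<nu>) =
        g p (E b p) (E c p) * g p (nb (E b) (E c) p) \<nu>"
      by (simp only: sum_distrib_right)
  qed
  also have "\<dots> = (\<Sum>b=1..n. \<Sum>c=1..n. if b = c then g p (nb (E b) (E c) p) \<nu> else 0)"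
    by (intro sum.cong refl) (simp add: frame_onD(3)[OF E' _ _ W(2)])
  also have "\<dots> = (\<Sum>b=1..n. g p (nb (E b) (E b) p) \<nu>)"
    by (intro sum.cong refl) (simp add: sum.delta)
  finally show ?thesis by simp
qed

text \<open>Without torsion the antisymmetric part is the bracket, which integrability keeps in
  \<open>D\<close>.\<close>

lemma second_form_symmetric:
  assumes int: "integrable_distribution A D" and U: "open U" "p \<in> U"
    and X: "smooth_vf A U X" and Y: "smooth_vf A U Y"
    and XD: "\<And>q. q \<in> U \<Longrightarrow> X q \<in> D q" and YD: "\<And>q. q \<in> U \<Longrightarrow> Y q \<in> D q"
    and \<nu>: "\<nu> \<in> D' p"
  shows "g p (nb X Y p) \<nu> = g p (nb Y X p) \<nu>"
proof -
  have "g p (lie_bracket A X Y p) \<nu> = 0"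
    by (rule orth[OF lie_bracket_in_distribution[OF int U X Y XD YD] \<nu>])
  then show ?thesis by (simp add: nb_torsion[OF U(1) X Y U(2)] g_left)
qed

end

section \<open>Mixed scalar curvature\<close>

lemma sum_antisymmetric:
  fixes f :: "'i \<Rightarrow> 'i \<Rightarrow> real"
  assumes "\<And>a b. a \<in> I \<Longrightarrow> b \<in> I \<Longrightarrow> f a b = - f b a"
  shows "(\<Sum>a\<in>I. \<Sum>b\<in>I. f a b) = 0"
proof -
  have "(\<Sum>a\<in>I. \<Sum>b\<in>I. f a b) = (\<Sum>a\<in>I. \<Sum>b\<in>I. - f b a)"
    by (intro sum.cong refl assms)
  also have "\<dots> = - (\<Sum>a\<in>I. \<Sum>b\<in>I. f b a)" by (simp add: sum_negf)
  also have "(\<Sum>a\<in>I. \<Sum>b\<in>I. f b a) = (\<Sum>a\<in>I. \<Sum>b\<in>I. f a b)" by (rule sum.swap)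
  finally show ?thesis by simp
qed

text \<open>\<open>h\<close> and \<open>k\<close> will be the second forms of \<open>D\<close> and
  \<open>D'\<close>, and \<open>\<alpha>\<close>, \<open>\<beta>\<close> the rotation coefficients
  of the frames. The first two sums come from a product of covariant derivatives, the last two from
  the bracket term of the curvature. A symmetric array paired with an antisymmetric one sums to
  zero, so only the squares survive.\<close>

lemma mixed_sum_identity:
  fixes h :: "'i \<Rightarrow> 'i \<Rightarrow> 'j \<Rightarrow> real" and k :: "'j \<Rightarrow> 'j \<Rightarrow> 'i \<Rightarrow> real"
  assumes h: "\<And>a b i. a \<in> I \<Longrightarrow> b \<in> I \<Longrightarrow> i \<in> J \<Longrightarrow> h a b i = h b a i"
    and k: "\<And>i j a. i \<in> J \<Longrightarrow> j \<in> J \<Longrightarrow> a \<in> I \<Longrightarrow> k i j a = k j i a"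
    and \<alpha>: "\<And>a i j. a \<in> I \<Longrightarrow> i \<in> J \<Longrightarrow> j \<in> J \<Longrightarrow> \<alpha> a i j = - \<alpha> a j i"
    and \<beta>: "\<And>i a b. i \<in> J \<Longrightarrow> a \<in> I \<Longrightarrow> b \<in> I \<Longrightarrow> \<beta> i a b = - \<beta> i b a"
  shows "(\<Sum>a\<in>I. \<Sum>i\<in>J. (\<Sum>b\<in>I. \<beta> i a b * - h a b i) + (\<Sum>j\<in>J. - k i j a * \<alpha> a i j) +
      ((\<Sum>b\<in>I. (- h a b i - \<beta> i a b) * h b a i) + (\<Sum>j\<in>J. (\<alpha> a i j + k i j a) * - k j i a))) =
    - (\<Sum>a\<in>I. \<Sum>i\<in>J. \<Sum>b\<in>I. (h a b i)\<^sup>2) - (\<Sum>a\<in>I. \<Sum>i\<in>J. \<Sum>j\<in>J. (k i j a)\<^sup>2)"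
proof -
  have 1: "(\<Sum>a\<in>I. \<Sum>i\<in>J. \<Sum>b\<in>I. \<beta> i a b * h a b i) = 0"
  proof -
    have "(\<Sum>a\<in>I. \<Sum>b\<in>I. \<beta> i a b * h a b i) = 0" if "i \<in> J" for i
    proof (rule sum_antisymmetric)
      fix a b assume "a \<in> I" "b \<in> I"
      then show "\<beta> i a b * h a b i = - (\<beta> i b a * h b a i)"
        using h[of a b i] \<beta>[of i a b] that by simp
    qed
    then show ?thesis by (subst sum.swap) simp
  qed
  have 2: "(\<Sum>a\<in>I. \<Sum>i\<in>J. \<Sum>j\<in>J. k i j a * \<alpha> a i j) = 0"
  proof -
    have "(\<Sum>i\<in>J. \<Sum>j\<in>J. k i j a * \<alpha> a i j) = 0" if "a \<in> I" for a
    proof (rule sum_antisymmetric)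
      fix i j assume "i \<in> J" "j \<in> J"
      then show "k i j a * \<alpha> a i j = - (k j i a * \<alpha> a j i)"
        using k[of i j a] \<alpha>[of a i j] that by simp
    qed
    then show ?thesis by simp
  qed
  have "(\<Sum>a\<in>I. \<Sum>i\<in>J. (\<Sum>b\<in>I. \<beta> i a b * - h a b i) + (\<Sum>j\<in>J. - k i j a * \<alpha> a i j) +
      ((\<Sum>b\<in>I. (- h a b i - \<beta> i a b) * h b a i) + (\<Sum>j\<in>J. (\<alpha> a i j + k i j a) * - k j i a))) =
    (\<Sum>a\<in>I. \<Sum>i\<in>J. (\<Sum>b\<in>I. - 2 * (\<beta> i a b * h a b i) - (h a b i)\<^sup>2) +
       (\<Sum>j\<in>J. - 2 * (k i j a * \<alpha> a i j) - (k i j a)\<^sup>2))"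
  proof (intro sum.cong refl)
    fix a i assume a: "a \<in> I" and i: "i \<in> J"
    have "(\<Sum>b\<in>I. \<beta> i a b * - h a b i) + (\<Sum>b\<in>I. (- h a b i - \<beta> i a b) * h b a i) =
      (\<Sum>b\<in>I. - 2 * (\<beta> i a b * h a b i) - (h a b i)\<^sup>2)"
      unfolding sum.distrib[symmetric]
      by (intro sum.cong refl) (simp add: h[OF _ a i] power2_eq_square algebra_simps)
    moreover have "(\<Sum>j\<in>J. - k i j a * \<alpha> a i j) + (\<Sum>j\<in>J. (\<alpha> a i j + k i j a) * - k j i a) =
      (\<Sum>j\<in>J. - 2 * (k i j a * \<alpha> a i j) - (k i j a)\<^sup>2)"
      unfolding sum.distrib[symmetric]
      by (intro sum.cong refl) (simp add: k[OF _ i a] power2_eq_square algebra_simps)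
    ultimately show "(\<Sum>b\<in>I. \<beta> i a b * - h a b i) + (\<Sum>j\<in>J. - k i j a * \<alpha> a i j) +
      ((\<Sum>b\<in>I. (- h a b i - \<beta> i a b) * h b a i) + (\<Sum>j\<in>J. (\<alpha> a i j + k i j a) * - k j i a)) =
      (\<Sum>b\<in>I. - 2 * (\<beta> i a b * h a b i) - (h a b i)\<^sup>2) + (\<Sum>j\<in>J. - 2 * (k i j a * \<alpha> a i j) - (k i j a)\<^sup>2)"
      by linarith
  qed
  also have "\<dots> = - 2 * (\<Sum>a\<in>I. \<Sum>i\<in>J. \<Sum>b\<in>I. \<beta> i a b * h a b i) - (\<Sum>a\<in>I. \<Sum>i\<in>J. \<Sum>b\<in>I. (h a b i)\<^sup>2)
     + (- 2 * (\<Sum>a\<in>I. \<Sum>i\<in>J. \<Sum>j\<in>J. k i j a * \<alpha> a i j) - (\<Sum>a\<in>I. \<Sum>i\<in>J. \<Sum>j\<in>J. (k i j a)\<^sup>2))"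
    by (simp only: sum.distrib sum_subtractf sum_distrib_left)
  finally show ?thesis unfolding 1 2 by simp
qed

section \<open>Mixed curvature of two harmonic foliations\<close>

locale harmonic_split = lc_split A g D D' n m nb
  for A :: "('m::topological_space, 'e::euclidean_space) chart set" and g D D' n m nb +
  assumes int: "integrable_distribution A D" and int': "integrable_distribution A D'"
    and H: "mean_curvature A g nb D D' p = 0" and H': "mean_curvature A g nb D' D p = 0"
begin

lemma harmonic_swap: "harmonic_split A g D' D m n nb"
  by (rule harmonic_split.intro[OF lc_swap]) (unfold_locales, rule int', rule int, rule H', rule H)

context
  fixes U :: "'m set" and p :: 'm and E F :: "nat \<Rightarrow> 'm \<Rightarrow> 'e"
  assumes U: "open U" "p \<in> U" and E: "frame_on U n D E" and F: "frame_on U m D' F"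
begin

private lemmas sE = frame_onD(1)[OF E]
private lemmas sF = frame_onD(1)[OF F]
private lemmas ED = frame_onD(2)[OF E]
private lemmas FD = frame_onD(2)[OF F]

lemma H_frame: "q \<in> U \<Longrightarrow> \<nu> \<in> D' q \<Longrightarrow> (\<Sum>a=1..n. g q (nb (E a) (E a) q) \<nu>) = 0"
  by (rule mean_curvature_frame[OF H U(1) _ E])

lemma H'_frame: "q \<in> U \<Longrightarrow> \<nu> \<in> D q \<Longrightarrow> (\<Sum>i=1..m. g q (nb (F i) (F i) q) \<nu>) = 0"
  by (rule lc_split.mean_curvature_frame[OF lc_swap H' U(1) _ F])

text \<open>Vanishing mean curvature removes the \<open>D'\<close>-part. Having this on all of
  \<open>U\<close> allows the field to be differentiated.\<close>

lemma H_field_mem: "q \<in> U \<Longrightarrow> (\<Sum>a=1..n. nb (E a) (E a) q) \<in> D q"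
  by (rule mem_DI) (simp only: g_left H_frame)

lemma H'_field_mem: "q \<in> U \<Longrightarrow> (\<Sum>i=1..m. nb (F i) (F i) q) \<in> D' q"
  by (rule split_mfd.mem_DI[OF split_swap]) (simp only: g_left H'_frame)

text \<open>The sum \<open>Hf\<close> of the \<open>nb (E a) (E a)\<close> is a field of
  \<open>D\<close>. Differentiating its orthogonality to \<open>F i\<close> moves the derivative
  onto \<open>F i\<close>, and the sum over \<open>i\<close> then pairs \<open>Hf\<close> with the
  mean curvature of \<open>D'\<close>.\<close>

lemma mixed_second_derivative_top:
  "(\<Sum>a=1..n. \<Sum>i=1..m. g p (nb (F i) (nb (E a) (E a)) p) (F i p)) = 0"
proof -
  define Hf where "Hf q = (\<Sum>a=1..n. nb (E a) (E a) q)" for q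
  have sEE: "smooth_vf A U (nb (E a) (E a))" if "a \<in> {1..n}" for a
    by (rule smooth_nb[OF U(1) sE[OF that] sE[OF that]])
  have sH: "smooth_vf A U Hf"
    unfolding Hf_def[abs_def] by (rule smooth_vf_sum[OF U(1) finite_atLeastAtMost sEE])
  have HfD: "Hf q \<in> D q" if "q \<in> U" for q
    unfolding Hf_def by (rule H_field_mem[OF that])
  have "(\<Sum>a=1..n. g p (nb (F i) (nb (E a) (E a)) p) (F i p)) = - g p (nb (F i) (F i) p) (Hf p)" if i: "i \<in> {1..m}" for i
  proof -
    have "(\<Sum>a=1..n. g p (nb (F i) (nb (E a) (E a)) p) (F i p)) = g p (nb (F i) Hf p) (F i p)"
      unfolding Hf_def[abs_def] by (simp only: nb_sum_right[OF U(1) sF[OF i] finite_atLeastAtMost sEE U(2)] g_left)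
    also have "\<dots> = - g p (Hf p) (nb (F i) (F i) p)"
      by (rule nb_metric_const[OF U(1) sF[OF i] sH sF[OF i] U(2)]) (rule orth[OF HfD FD[OF i]])
    finally show ?thesis by (simp only: g_sym[of p "Hf p"])
  qed
  then have "(\<Sum>i=1..m. \<Sum>a=1..n. g p (nb (F i) (nb (E a) (E a)) p) (F i p)) = - (\<Sum>i=1..m. g p (nb (F i) (F i) p) (Hf p))"
    by (simp add: sum_negf)
  also have "\<dots> = 0" using H'_frame[OF U(2) HfD[OF U(2)]] by simp
  finally show ?thesis by (subst sum.swap)
qed

text \<open>The equality of \<open>g (nb (F i) (E a)) (F i)\<close> and
  \<open>- g (E a) (nb (F i) (F i))\<close> is differentiated along \<open>E a\<close>. Summed over
  \<open>i\<close>, the right-hand side becomes the derivative of a product of \<open>E a\<close>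
  with a field of \<open>D'\<close>, which is zero.\<close>

lemma mixed_second_derivative_bot:
  assumes a: "a \<in> {1..n}"
  shows "(\<Sum>i=1..m. g p (nb (E a) (nb (F i) (E a)) p) (F i p)) =
    - (\<Sum>i=1..m. g p (nb (F i) (E a) p) (nb (E a) (F i) p))"
proof -
  define Hf where "Hf q = (\<Sum>i=1..m. nb (F i) (F i) q)" for q
  have sFF: "smooth_vf A U (nb (F i) (F i))" if "i \<in> {1..m}" for i
    by (rule smooth_nb[OF U(1) sF[OF that] sF[OF that]])
  have sFE: "smooth_vf A U (nb (F i) (E a))" if "i \<in> {1..m}" for i
    by (rule smooth_nb[OF U(1) sF[OF that] sE[OF a]])
  have sH: "smooth_vf A U Hf"
    unfolding Hf_def[abs_def] by (rule smooth_vf_sum[OF U(1) finite_atLeastAtMost sFF])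
  have HfD: "Hf q \<in> D' q" if "q \<in> U" for q
    unfolding Hf_def by (rule H'_field_mem[OF that])
  have each: "g p (nb (E a) (nb (F i) (E a)) p) (F i p) = - g p (nb (F i) (E a) p) (nb (E a) (F i) p)
     - (g p (nb (E a) (E a) p) (nb (F i) (F i) p) + g p (E a p) (nb (E a) (nb (F i) (F i)) p))"
    if i: "i \<in> {1..m}" for i
  proof -
    let ?f = "\<lambda>q. g q (nb (F i) (E a) q) (F i q)" and ?h = "\<lambda>q. g q (E a q) (nb (F i) (F i) q)"
    \<comment> \<open>Orthogonality of \<open>E a\<close> and \<open>F i\<close>, differentiated
      along \<open>F i\<close> at every point of \<open>U\<close>.\<close>
    have "?f q + ?h q = 0" if "q \<in> U" for q
      using nb_metric_const[OF U(1) sF[OF i] sE[OF a] sF[OF i] that orth[OF ED[OF a] FD[OF i]]] by simp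
    then have "vderiv A p (E a p) (\<lambda>q. ?f q + ?h q) = 0"
      by (rule vderiv_local_const[OF U])
    then have "vderiv A p (E a p) ?f + vderiv A p (E a p) ?h = 0"
      using vderiv_add[OF U smooth_g[OF U(1) sFE[OF i] sF[OF i]] smooth_g[OF U(1) sE[OF a] sFF[OF i]], of "E a p"]
      by simp
    then show ?thesis
      unfolding nb_metric[OF U(1) sE[OF a] sFE[OF i] sF[OF i] U(2)] nb_metric[OF U(1) sE[OF a] sE[OF a] sFF[OF i] U(2)]
      by linarith
  qed
  have "(\<Sum>i=1..m. g p (nb (E a) (E a) p) (nb (F i) (F i) p)) + (\<Sum>i=1..m. g p (E a p) (nb (E a) (nb (F i) (F i)) p))
     = g p (nb (E a) (E a) p) (Hf p) + g p (E a p) (nb (E a) Hf p)"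
    unfolding Hf_def[abs_def] by (simp only: nb_sum_right[OF U(1) sE[OF a] finite_atLeastAtMost sFF U(2)] g_right)
  also have "\<dots> = 0"
    using nb_metric_const[OF U(1) sE[OF a] sE[OF a] sH U(2) orth[OF ED[OF a] HfD]] by simp
  finally have 0: "(\<Sum>i=1..m. g p (nb (E a) (E a) p) (nb (F i) (F i) p) + g p (E a p) (nb (E a) (nb (F i) (F i)) p)) = 0"
    by (simp only: sum.distrib)
  have "(\<Sum>i=1..m. g p (nb (E a) (nb (F i) (E a)) p) (F i p)) =
    (\<Sum>i=1..m. - g p (nb (F i) (E a) p) (nb (E a) (F i) p)
     - (g p (nb (E a) (E a) p) (nb (F i) (F i) p) + g p (E a p) (nb (E a) (nb (F i) (F i)) p)))"
    by (intro sum.cong refl each)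
  also have "\<dots> = - (\<Sum>i=1..m. g p (nb (F i) (E a) p) (nb (E a) (F i) p))"
    by (simp only: sum_subtractf sum_negf 0 diff_0_right)
  finally show ?thesis .
qed

text \<open>Needed for the bracket of a field of \<open>D\<close> with a field of \<open>D'\<close>,
  which may have parts in both distributions.\<close>

lemma nb_full_expansion_left:
  assumes X: "smooth_vf A U X" and Y: "smooth_vf A U Y"
  shows "nb X Y p = (\<Sum>b=1..n. g p (X p) (E b p) *\<^sub>R nb (E b) Y p) + (\<Sum>j=1..m. g p (X p) (F j p) *\<^sub>R nb (F j) Y p)"
proof -
  let ?X1 = "\<lambda>q. \<Sum>b=1..n. g q (X q) (E b q) *\<^sub>R E b q" and ?X2 = "\<lambda>q. \<Sum>j=1..m. g q (X q) (F j q) *\<^sub>R F j q"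
  have f1: "smooth_fun A U (\<lambda>q. g q (X q) (E b q))" if "b \<in> {1..n}" for b
    by (rule smooth_g[OF U(1) X sE[OF that]])
  have f2: "smooth_fun A U (\<lambda>q. g q (X q) (F j q))" if "j \<in> {1..m}" for j
    by (rule smooth_g[OF U(1) X sF[OF that]])
  have s1: "smooth_vf A U ?X1"
    by (intro smooth_vf_sum[OF U(1) finite_atLeastAtMost] smooth_vf_scale[OF U(1)] f1 sE)
  have s2: "smooth_vf A U ?X2"
    by (intro smooth_vf_sum[OF U(1) finite_atLeastAtMost] smooth_vf_scale[OF U(1)] f2 sF)
  have "nb X Y p = nb (\<lambda>q. 1 *\<^sub>R ?X1 q + ?X2 q) Y p"
    by (rule nb_cong_left[OF U(1) X smooth_vf_axpy[OF U(1) smooth_fun_const s1 s2] Y _ U(2)])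
      (simp only: scaleR_one full_expansion[OF E F, symmetric])
  also have "\<dots> = 1 *\<^sub>R nb ?X1 Y p + nb ?X2 Y p"
    by (rule nb_axpy[OF U(1) s1 s2 Y smooth_fun_const U(2)])
  finally show ?thesis
    by (simp only: scaleR_one nb_sum_left[OF U(1) finite_atLeastAtMost f1 sE Y U(2)] nb_sum_left[OF U(1) finite_atLeastAtMost f2 sF Y U(2)])
qed

text \<open>After summation one of the two second-derivative terms vanishes and the other is a
  product of first derivatives. The bracket term is of the same kind because the torsion is zero, so
  everything reduces to an identity between arrays of coefficients.\<close>

lemma levi_civita_mixed_curvature:
  "(\<Sum>a=1..n. \<Sum>i=1..m. g p (curv A nb (E a) (F i) (E a) p) (F i p)) =
   - (\<Sum>a=1..n. \<Sum>i=1..m. \<Sum>b=1..n. (g p (nb (E a) (E b) p) (F i p))\<^sup>2)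
   - (\<Sum>a=1..n. \<Sum>i=1..m. \<Sum>j=1..m. (g p (nb (F i) (F j) p) (E a p))\<^sup>2)"
proof -
  \<comment> \<open>The first derivatives of the frames enter through four arrays: the second forms
    \<open>h\<close> and \<open>k\<close>, the rotation \<open>\<alpha>\<close> of the frame
    \<open>F\<close> along \<open>E\<close>, and the rotation \<open>\<beta>\<close> of
    \<open>E\<close> along \<open>F\<close>.\<close>
  define h where "h a b i = g p (nb (E a) (E b) p) (F i p)" for a b i
  define k where "k i j a = g p (nb (F i) (F j) p) (E a p)" for i j a
  define \<alpha> where "\<alpha> a i j = g p (nb (E a) (F i) p) (F j p)" for a i j
  define \<beta> where "\<beta> i a b = g p (nb (F i) (E a) p) (E b p)" for i a b
  have h': "g p (nb (E a) (F i) p) (E b p) = - h a b i" if "a \<in> {1..n}" "b \<in> {1..n}" "i \<in> {1..m}" for a b i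
    unfolding h_def g_sym[of p _ "F i p"]
    by (rule nb_metric_const[OF U(1) sE[OF that(1)] sF[OF that(3)] sE[OF that(2)] U(2)])
      (rule orth'[OF ED[OF that(2)] FD[OF that(3)]])
  have k': "g p (nb (F i) (E a) p) (F j p) = - k i j a" if "i \<in> {1..m}" "j \<in> {1..m}" "a \<in> {1..n}" for i j a
    unfolding k_def g_sym[of p _ "E a p"]
    by (rule nb_metric_const[OF U(1) sF[OF that(1)] sE[OF that(3)] sF[OF that(2)] U(2)])
      (rule orth[OF ED[OF that(3)] FD[OF that(2)]])
  have each: "g p (curv A nb (E a) (F i) (E a) p) (F i p) =
      g p (nb (F i) (nb (E a) (E a)) p) (F i p) - g p (nb (E a) (nb (F i) (E a)) p) (F i p)
      + ((\<Sum>b=1..n. (- h a b i - \<beta> i a b) * h b a i) + (\<Sum>j=1..m. (\<alpha> a i j + k i j a) * - k j i a))"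
    if a: "a \<in> {1..n}" and i: "i \<in> {1..m}" for a i
  proof -
    let ?L = "lie_bracket A (E a) (F i)"
    have L: "?L p = nb (E a) (F i) p - nb (F i) (E a) p"
      by (rule nb_torsion[OF U(1) sE[OF a] sF[OF i] U(2)])
    have "g p (nb ?L (E a) p) (F i p) =
      (\<Sum>b=1..n. g p (?L p) (E b p) * g p (nb (E b) (E a) p) (F i p)) +
      (\<Sum>j=1..m. g p (?L p) (F j p) * g p (nb (F j) (E a) p) (F i p))"
      unfolding nb_full_expansion_left[OF smooth_lie_bracket[OF U(1) sE[OF a] sF[OF i]] sE[OF a]]
      by (simp only: g_left)  (simp only: real_scaleR_def)
    also have "\<dots> = (\<Sum>b=1..n. (- h a b i - \<beta> i a b) * h b a i) + (\<Sum>j=1..m. (\<alpha> a i j + k i j a) * - k j i a)"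
    proof (intro arg_cong2[of _ _ _ _ "(+)"] sum.cong refl)
      fix b assume b: "b \<in> {1..n}"
      show "g p (?L p) (E b p) * g p (nb (E b) (E a) p) (F i p) = (- h a b i - \<beta> i a b) * h b a i"
        by (simp only: L g_left h'[OF a b i] h_def[symmetric] \<beta>_def[symmetric])
    next
      fix j assume j: "j \<in> {1..m}"
      show "g p (?L p) (F j p) * g p (nb (F j) (E a) p) (F i p) = (\<alpha> a i j + k i j a) * - k j i a"
        by (simp only: L g_left k'[OF i j a] k'[OF j i a] \<alpha>_def[symmetric]) simp
    qed
    finally show ?thesis by (simp only: curv_def g_left)
  qed
  have inner: "g p (nb (F i) (E a) p) (nb (E a) (F i) p) = (\<Sum>b=1..n. \<beta> i a b * - h a b i) + (\<Sum>j=1..m. - k i j a * \<alpha> a i j)"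
    if a: "a \<in> {1..n}" and i: "i \<in> {1..m}" for a i
    by (rule trans[OF inner_expansion[OF E F U(2)]], intro arg_cong2[of _ _ _ _ "(+)"] sum.cong refl)
      (simp_all only: h'[OF a _ i] k'[OF i _ a] \<alpha>_def \<beta>_def)
  let ?B = "\<lambda>a i. (\<Sum>b=1..n. \<beta> i a b * - h a b i) + (\<Sum>j=1..m. - k i j a * \<alpha> a i j)"
  have Q: "(\<Sum>a=1..n. \<Sum>i=1..m. g p (nb (E a) (nb (F i) (E a)) p) (F i p)) = - (\<Sum>a=1..n. \<Sum>i=1..m. ?B a i)"
  proof -
    have "(\<Sum>i=1..m. g p (nb (E a) (nb (F i) (E a)) p) (F i p)) = - (\<Sum>i=1..m. ?B a i)" if a: "a \<in> {1..n}" for a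
    proof -
      have "(\<Sum>i=1..m. g p (nb (F i) (E a) p) (nb (E a) (F i) p)) = (\<Sum>i=1..m. ?B a i)"
        by (rule sum.cong[OF refl]) (rule inner[OF a])
      then show ?thesis using mixed_second_derivative_bot[OF a] by (simp only:)
    qed
    then have "(\<Sum>a=1..n. \<Sum>i=1..m. g p (nb (E a) (nb (F i) (E a)) p) (F i p)) = (\<Sum>a=1..n. - (\<Sum>i=1..m. ?B a i))"
      by (rule sum.cong[OF refl])
    then show ?thesis by (simp only: sum_negf)
  qed
  let ?C = "\<lambda>a i. (\<Sum>b=1..n. (- h a b i - \<beta> i a b) * h b a i) + (\<Sum>j=1..m. (\<alpha> a i j + k i j a) * - k j i a)"
  have "(\<Sum>a=1..n. \<Sum>i=1..m. g p (curv A nb (E a) (F i) (E a) p) (F i p)) =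
    (\<Sum>a=1..n. \<Sum>i=1..m. g p (nb (F i) (nb (E a) (E a)) p) (F i p) - g p (nb (E a) (nb (F i) (E a)) p) (F i p) + ?C a i)"
    by (intro sum.cong refl each)
  also have "\<dots> = 0 - (\<Sum>a=1..n. \<Sum>i=1..m. g p (nb (E a) (nb (F i) (E a)) p) (F i p)) + (\<Sum>a=1..n. \<Sum>i=1..m. ?C a i)"
    by (simp only: sum.distrib sum_subtractf mixed_second_derivative_top)
  also have "(\<Sum>a=1..n. \<Sum>i=1..m. g p (nb (E a) (nb (F i) (E a)) p) (F i p)) = - (\<Sum>a=1..n. \<Sum>i=1..m. ?B a i)"
    by (rule Q)
  also have "0 - - (\<Sum>a=1..n. \<Sum>i=1..m. ?B a i) + (\<Sum>a=1..n. \<Sum>i=1..m. ?C a i) =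
    (\<Sum>a=1..n. \<Sum>i=1..m. ?B a i + ?C a i)"
    unfolding sum.distrib by simp
  also have "\<dots> = - (\<Sum>a=1..n. \<Sum>i=1..m. \<Sum>b=1..n. (h a b i)\<^sup>2) - (\<Sum>a=1..n. \<Sum>i=1..m. \<Sum>j=1..m. (k i j a)\<^sup>2)"
  proof (rule mixed_sum_identity)
    show "h a b i = h b a i" if "a \<in> {1..n}" "b \<in> {1..n}" "i \<in> {1..m}" for a b i
      unfolding h_def
      by (rule second_form_symmetric[OF int U sE[OF that(1)] sE[OF that(2)] ED[OF that(1)] ED[OF that(2)] FD[OF that(3) U(2)]])
    show "k i j a = k j i a" if "i \<in> {1..m}" "j \<in> {1..m}" "a \<in> {1..n}" for i j a
      unfolding k_def
      by (rule lc_split.second_form_symmetric[OF lc_swap int' U sF[OF that(1)] sF[OF that(2)] FD[OF that(1)] FD[OF that(2)] ED[OF that(3) U(2)]])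
    show "\<alpha> a i j = - \<alpha> a j i" if "a \<in> {1..n}" "i \<in> {1..m}" "j \<in> {1..m}" for a i j
      unfolding \<alpha>_def g_sym[of p "nb (E a) (F j) p"]
      by (rule nb_metric_const[OF U(1) sE[OF that(1)] sF[OF that(2)] sF[OF that(3)] U(2) frame_onD(3)[OF F that(2,3)]])
    show "\<beta> i a b = - \<beta> i b a" if "i \<in> {1..m}" "a \<in> {1..n}" "b \<in> {1..n}" for i a b
      unfolding \<beta>_def g_sym[of p "nb (F i) (E b) p"]
      by (rule nb_metric_const[OF U(1) sF[OF that(1)] sE[OF that(2)] sE[OF that(3)] U(2) frame_onD(3)[OF E that(2,3)]])
  qed
  finally show ?thesis by (simp only: h_def k_def)
qed

end

end

section \<open>Effect of the contorsion on the mixed curvature\<close>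

text \<open>The last two assumptions say that the contorsion in direction \<open>x\<close> has
  values in the distribution containing \<open>x\<close>. They are the conditions on the adjoint,
  rewritten for the contorsion itself.\<close>

locale adapted_split = harmonic_split A g D D' n m nb + two_connections A nb nbbar
  for A :: "('m::topological_space, 'e::euclidean_space) chart set" and g D D' n m nb nbbar +
  assumes T_DD': "x \<in> D p \<Longrightarrow> y \<in> D' p \<Longrightarrow> contorsion A nbbar nb p x y = 0"
    and T_D'D: "x \<in> D p \<Longrightarrow> y \<in> D' p \<Longrightarrow> contorsion A nbbar nb p y x = 0"
    and T_D: "x \<in> D p \<Longrightarrow> y \<in> D' p \<Longrightarrow> g p (contorsion A nbbar nb p x z) y = 0"
    and T_D': "x \<in> D p \<Longrightarrow> y \<in> D' p \<Longrightarrow> g p (contorsion A nbbar nb p y z) x = 0"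
begin

lemma adapted_swap: "adapted_split A g D' D m n nb nbbar"
  by (rule adapted_split.intro[OF harmonic_swap two_connections_axioms])
    (unfold_locales; rule T_DD' T_D'D T_D T_D'; assumption)

lemma nbbar_eq:
  assumes "open U" "q \<in> U" "smooth_vf A U X" "smooth_vf A U Y"
  shows "nbbar X Y q = nb X Y q + contorsion A nbbar nb q (X q) (Y q)"
  by (simp add: contorsion_eq[OF assms])

lemma linear_contorsion: "linear (contorsion A nbbar nb p x)" "linear (\<lambda>x. contorsion A nbbar nb p x y)"
  using bilinear_contorsion[of p] by (auto simp: bilinear_def)

context
  fixes U :: "'m set" and p :: 'm and E F :: "nat \<Rightarrow> 'm \<Rightarrow> 'e"
  assumes U: "open U" "p \<in> U" and E: "frame_on U n D E" and F: "frame_on U m D' F"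
begin

private lemmas sE = frame_onD(1)[OF E]
private lemmas sF = frame_onD(1)[OF F]
private lemmas ED = frame_onD(2)[OF E]
private lemmas FD = frame_onD(2)[OF F]

text \<open>Inserting the contorsion \<open>T\<close> leaves two kinds of terms: products of
  \<open>nb (F i) (F i)\<close> with \<open>T (E a) (E a)\<close>, a vector of \<open>D\<close>, and
  \<open>T (F i)\<close> applied to \<open>nb (E a) (E a)\<close>. They need not vanish singly. The
  sum over \<open>i\<close> removes the former by harmonicity of \<open>D'\<close>; the sum over
  \<open>a\<close> removes the latter, because it applies \<open>T (F i)\<close> to a vector of
  \<open>D\<close>.\<close>

lemma mixed_curvature_eq:
  "(\<Sum>a=1..n. \<Sum>i=1..m. g p (curv A nbbar (E a) (F i) (E a) p) (F i p)) =
   (\<Sum>a=1..n. \<Sum>i=1..m. g p (curv A nb (E a) (F i) (E a) p) (F i p))"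
proof -
  let ?T = "contorsion A nbbar nb"
  \<comment> \<open>Written as a difference of covariant derivatives, so that smoothness is
    immediate; the values are those of the contorsion.\<close>
  define S where "S a q = nbbar (E a) (E a) q - nb (E a) (E a) q" for a q
  have S_eq: "S a q = ?T q (E a q) (E a q)" if "a \<in> {1..n}" "q \<in> U" for a q
    unfolding S_def by (rule contorsion_eq[OF U(1) that(2) sE[OF that(1)] sE[OF that(1)], symmetric])
  have SD: "S a q \<in> D q" if "a \<in> {1..n}" "q \<in> U" for a q
    unfolding S_eq[OF that] by (rule mem_DI) (rule T_D[OF ED[OF that]])
  have TD: "?T q x z \<in> D q" if "x \<in> D q" for q x z
    by (rule mem_DI) (rule T_D[OF that])
  have each: "g p (curv A nbbar (E a) (F i) (E a) p) (F i p) = g p (curv A nb (E a) (F i) (E a) p) (F i p)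
      - g p (nb (F i) (F i) p) (S a p) + g p (?T p (F i p) (nb (E a) (E a) p)) (F i p)"
    if a: "a \<in> {1..n}" and i: "i \<in> {1..m}" for a i
  proof -
    have sEE: "smooth_vf A U (nb (E a) (E a))" by (rule smooth_nb[OF U(1) sE[OF a] sE[OF a]])
    have sEE': "smooth_vf A U (nbbar (E a) (E a))" by (rule bar.smooth_nb[OF U(1) sE[OF a] sE[OF a]])
    have sS: "smooth_vf A U (S a)"
      unfolding S_def[abs_def] by (rule smooth_vf_diff[OF U(1) sEE' sEE])
    have sFE: "smooth_vf A U (nb (F i) (E a))" by (rule smooth_nb[OF U(1) sF[OF i] sE[OF a]])
    have sFE': "smooth_vf A U (nbbar (F i) (E a))" by (rule bar.smooth_nb[OF U(1) sF[OF i] sE[OF a]])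
    have sL: "smooth_vf A U (lie_bracket A (E a) (F i))" by (rule smooth_lie_bracket[OF U(1) sE[OF a] sF[OF i]])
    note e = ED[OF a U(2)] and f = FD[OF i U(2)]
    have 1: "g p (nbbar (F i) (nbbar (E a) (E a)) p) (F i p) = g p (nb (F i) (nb (E a) (E a)) p) (F i p)
      - g p (nb (F i) (F i) p) (S a p) + g p (?T p (F i p) (nb (E a) (E a) p)) (F i p)"
    proof -
      have "nb (F i) (nbbar (E a) (E a)) p = nb (F i) (\<lambda>q. nb (E a) (E a) q + S a q) p"
        by (rule nb_cong_right[OF U(1) sF[OF i] sEE' smooth_vf_add[OF U(1) sEE sS] _ U(2)]) (simp add: S_def)
      also have "\<dots> = nb (F i) (nb (E a) (E a)) p + nb (F i) (S a) p"
        by (rule nb_add[OF U(1) sF[OF i] sEE sS U(2)])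
      finally have "nbbar (F i) (nbbar (E a) (E a)) p = nb (F i) (nb (E a) (E a)) p + nb (F i) (S a) p
        + ?T p (F i p) (nbbar (E a) (E a) p)"
        by (simp only: nbbar_eq[OF U sF[OF i] sEE'])
      moreover have "nbbar (E a) (E a) p = nb (E a) (E a) p + S a p" by (simp add: S_def)
      moreover have "?T p (F i p) (nb (E a) (E a) p + S a p) = ?T p (F i p) (nb (E a) (E a) p)"
        by (simp add: linear_add[OF linear_contorsion(1)] T_D'D[OF SD[OF a U(2)] f])
      moreover have "g p (nb (F i) (S a) p) (F i p) = - g p (S a p) (nb (F i) (F i) p)"
        by (rule nb_metric_const[OF U(1) sF[OF i] sS sF[OF i] U(2)]) (rule orth[OF SD[OF a] FD[OF i]])
      ultimately show ?thesis by (simp add: g_left g_sym[of p "S a p"])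
    qed
    have 2: "g p (nbbar (E a) (nbbar (F i) (E a)) p) (F i p) = g p (nb (E a) (nb (F i) (E a)) p) (F i p)"
    proof -
      \<comment> \<open>Mixed values of the contorsion vanish on all of \<open>U\<close>, so the
        inner derivatives agree as fields there.\<close>
      have "nbbar (E a) (nbbar (F i) (E a)) p = nbbar (E a) (nb (F i) (E a)) p"
        by (rule bar.nb_cong_right[OF U(1) sE[OF a] sFE' sFE _ U(2)])
          (simp add: nbbar_eq[OF U(1) _ sF[OF i] sE[OF a]] T_D'D[OF ED[OF a] FD[OF i]])
      also have "\<dots> = nb (E a) (nb (F i) (E a)) p + ?T p (E a p) (nb (F i) (E a) p)"
        by (rule nbbar_eq[OF U sE[OF a] sFE])
      finally show ?thesis by (simp add: g_left T_D[OF e f])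
    qed
    have 3: "g p (nbbar (lie_bracket A (E a) (F i)) (E a) p) (F i p) = g p (nb (lie_bracket A (E a) (F i)) (E a) p) (F i p)"
    proof -
      \<comment> \<open>The \<open>D\<close>-part of the bracket contributes a value in
        \<open>D\<close>, orthogonal to \<open>F i\<close>; the \<open>D'\<close>-part contributes a
        mixed value, which is zero.\<close>
      obtain x y where xy: "x \<in> D p" "y \<in> D' p" "lie_bracket A (E a) (F i) p = x + y" by (rule decomp)
      have "g p (?T p (x + y) (E a p)) (F i p) = 0"
        by (simp add: linear_add[OF linear_contorsion(2)] T_D'D[OF e xy(2)] T_D[OF xy(1) f])
      then show ?thesis by (simp add: nbbar_eq[OF U sL sE[OF a]] g_left xy(3))
    qed
    show ?thesis by (simp only: curv_def g_left 1 2 3)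
  qed
  have Z1: "(\<Sum>a=1..n. \<Sum>i=1..m. g p (nb (F i) (F i) p) (S a p)) = 0"
    by (rule sum.neutral, rule ballI, rule H'_frame[OF U E F U(2) SD[OF _ U(2)]])
  have Z2: "(\<Sum>a=1..n. \<Sum>i=1..m. g p (?T p (F i p) (nb (E a) (E a) p)) (F i p)) = 0"
  proof -
    have "(\<Sum>a=1..n. g p (?T p (F i p) (nb (E a) (E a) p)) (F i p)) = 0" if i: "i \<in> {1..m}" for i
    proof -
      have "(\<Sum>a=1..n. g p (?T p (F i p) (nb (E a) (E a) p)) (F i p)) = g p (?T p (F i p) (\<Sum>a=1..n. nb (E a) (E a) p)) (F i p)"
        by (simp only: linear_sum[OF linear_contorsion(1)] g_left)
      also have "\<dots> = 0"
        by (simp only: T_D'D[OF H_field_mem[OF U E F U(2)] FD[OF i U(2)]] g_left)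
      finally show ?thesis .
    qed
    then show ?thesis by (subst sum.swap) simp
  qed
  have "(\<Sum>a=1..n. \<Sum>i=1..m. g p (curv A nbbar (E a) (F i) (E a) p) (F i p)) =
    (\<Sum>a=1..n. \<Sum>i=1..m. g p (curv A nb (E a) (F i) (E a) p) (F i p)
      - g p (nb (F i) (F i) p) (S a p) + g p (?T p (F i p) (nb (E a) (E a) p)) (F i p))"
    by (intro sum.cong refl each)
  then show ?thesis by (simp only: sum.distrib sum_subtractf Z1 Z2 diff_0_right add_0_right)
qed

end

text \<open>One half of the mixed scalar curvature is minus a sum of squares. The other half is
  estimated by the same formula with \<open>D\<close> and \<open>D'\<close> exchanged, so no
  symmetry of the curvature of \<open>nbbar\<close> is invoked. As both halves are at most zero,
  nonnegativity makes every square vanish.\<close>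

lemma second_forms_vanish:
  assumes S: "mixed_scalar_curvature A g nbbar D D' p \<ge> 0"
  obtains U E F where "open U" "p \<in> U" "frame_on U n D E" "frame_on U m D' F"
    "\<And>a b i. a \<in> {1..n} \<Longrightarrow> b \<in> {1..n} \<Longrightarrow> i \<in> {1..m} \<Longrightarrow> g p (nb (E a) (E b) p) (F i p) = 0"
    "\<And>a i j. a \<in> {1..n} \<Longrightarrow> i \<in> {1..m} \<Longrightarrow> j \<in> {1..m} \<Longrightarrow> g p (nb (F i) (F j) p) (E a p) = 0"
proof -
  let ?E = "frame A g D p" and ?F = "frame A g D' p"
  obtain U1 where U1: "open U1" "p \<in> U1" "frame_on U1 n D ?E" by (rule frame_on_frame[OF D])
  obtain U2 where U2: "open U2" "p \<in> U2" "frame_on U2 m D' ?F" by (rule frame_on_frame[OF D'])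
  let ?U = "U1 \<inter> U2"
  have U: "open ?U" "p \<in> ?U" using U1 U2 by auto
  have E: "frame_on ?U n D ?E" and F: "frame_on ?U m D' ?F"
    by (rule frame_on_subset[OF U1(3)], simp) (rule frame_on_subset[OF U2(3)], simp)
  let ?h = "\<Sum>a=1..n. \<Sum>i=1..m. \<Sum>b=1..n. (g p (nb (?E a) (?E b) p) (?F i p))\<^sup>2"
  let ?k = "\<Sum>a=1..n. \<Sum>i=1..m. \<Sum>j=1..m. (g p (nb (?F i) (?F j) p) (?E a p))\<^sup>2"
  have dims: "dim (D p) = n" "dim (D' p) = m"
    by (rule dim_D) (rule split_mfd.dim_D[OF split_swap])
  have 1: "(\<Sum>a=1..n. \<Sum>i=1..m. g p (curv A nbbar (?E a) (?F i) (?E a) p) (?F i p)) = - ?h - ?k"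
    using mixed_curvature_eq[OF U E F] levi_civita_mixed_curvature[OF U E F] by simp
  have 2: "(\<Sum>i=1..m. \<Sum>a=1..n. g p (curv A nbbar (?F i) (?E a) (?F i) p) (?E a p)) \<le> 0"
    unfolding adapted_split.mixed_curvature_eq[OF adapted_swap U F E]
      harmonic_split.levi_civita_mixed_curvature[OF harmonic_swap U F E]
    by (rule order_trans[OF diff_mono[of _ 0 0]]) (simp_all add: sum_nonneg)
  have "(\<Sum>a=1..n. \<Sum>i=1..m. g p (curv A nbbar (?F i) (?E a) (?F i) p) (?E a p)) \<le> 0"
    by (subst sum.swap) (rule 2)
  moreover have "0 \<le> (\<Sum>a=1..n. \<Sum>i=1..m. g p (curv A nbbar (?E a) (?F i) (?E a) p) (?F i p)) +
      (\<Sum>a=1..n. \<Sum>i=1..m. g p (curv A nbbar (?F i) (?E a) (?F i) p) (?E a p))"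
    using S by (simp add: mixed_scalar_curvature_def Let_def dims sum.distrib)
  ultimately have le: "?h + ?k \<le> 0" using 1 by linarith
  have h0: "?h \<ge> 0" and k0: "?k \<ge> 0" by (intro sum_nonneg; simp)+
  have h: "?h = 0" and k: "?k = 0" using le h0 k0 by linarith+
  have "g p (nb (?E a) (?E b) p) (?F i p) = 0" if "a \<in> {1..n}" "b \<in> {1..n}" "i \<in> {1..m}" for a b i
  proof -
    have "(\<Sum>i=1..m. \<Sum>b=1..n. (g p (nb (?E a) (?E b) p) (?F i p))\<^sup>2) = 0"
      using h that by (subst (asm) sum_nonneg_eq_0_iff) (auto intro!: sum_nonneg)
    then have "(\<Sum>b=1..n. (g p (nb (?E a) (?E b) p) (?F i p))\<^sup>2) = 0"
      using that by (subst (asm) sum_nonneg_eq_0_iff) (auto intro!: sum_nonneg)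
    then show ?thesis
      using that by (subst (asm) sum_nonneg_eq_0_iff) auto
  qed
  moreover have "g p (nb (?F i) (?F j) p) (?E a p) = 0" if "a \<in> {1..n}" "i \<in> {1..m}" "j \<in> {1..m}" for a i j
  proof -
    have "(\<Sum>i=1..m. \<Sum>j=1..m. (g p (nb (?F i) (?F j) p) (?E a p))\<^sup>2) = 0"
      using k that by (subst (asm) sum_nonneg_eq_0_iff) (auto intro!: sum_nonneg)
    then have "(\<Sum>j=1..m. (g p (nb (?F i) (?F j) p) (?E a p))\<^sup>2) = 0"
      using that by (subst (asm) sum_nonneg_eq_0_iff) (auto intro!: sum_nonneg)
    then show ?thesis
      using that by (subst (asm) sum_nonneg_eq_0_iff) auto
  qed
  ultimately show thesis using that U E F by blast
qed

end

text \<open>Vanishing in one frame at \<open>p\<close> extends to all local fields because the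
  second forms are tensors.\<close>

lemma (in adapted_split) totally_geodesic:
  assumes S: "mixed_scalar_curvature A g nbbar D D' p \<ge> 0" and U: "open U" "p \<in> U"
    and X: "smooth_vf A U X" and Y: "smooth_vf A U Y"
  shows "(\<And>q. q \<in> U \<Longrightarrow> X q \<in> D q) \<Longrightarrow> (\<And>q. q \<in> U \<Longrightarrow> Y q \<in> D q) \<Longrightarrow> \<nu> \<in> D' p \<Longrightarrow> g p (nb X Y p) \<nu> = 0"
    and "(\<And>q. q \<in> U \<Longrightarrow> X q \<in> D' q) \<Longrightarrow> (\<And>q. q \<in> U \<Longrightarrow> Y q \<in> D' q) \<Longrightarrow> \<nu> \<in> D p \<Longrightarrow> g p (nb X Y p) \<nu> = 0"
proof -
  obtain V E F where V: "open V" "p \<in> V" and E: "frame_on V n D E" and F: "frame_on V m D' F"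
    and h: "\<And>a b i. a \<in> {1..n} \<Longrightarrow> b \<in> {1..n} \<Longrightarrow> i \<in> {1..m} \<Longrightarrow> g p (nb (E a) (E b) p) (F i p) = 0"
    and k: "\<And>a i j. a \<in> {1..n} \<Longrightarrow> i \<in> {1..m} \<Longrightarrow> j \<in> {1..m} \<Longrightarrow> g p (nb (F i) (F j) p) (E a p) = 0"
  proof (rule second_forms_vanish[OF S])
    fix V E F
    assume "open V" "p \<in> V" "frame_on V n D E" "frame_on V m D' F"
      "\<And>a b i. a \<in> {1..n} \<Longrightarrow> b \<in> {1..n} \<Longrightarrow> i \<in> {1..m} \<Longrightarrow> g p (nb (E a) (E b) p) (F i p) = 0"
      "\<And>a i j. a \<in> {1..n} \<Longrightarrow> i \<in> {1..m} \<Longrightarrow> j \<in> {1..m} \<Longrightarrow> g p (nb (F i) (F j) p) (E a p) = 0"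
    then show ?thesis by (rule that)
  qed
  let ?W = "U \<inter> V"
  have W: "open ?W" "p \<in> ?W" using U V by auto
  have E': "frame_on ?W n D E" and F': "frame_on ?W m D' F"
    by (rule frame_on_subset[OF E], simp) (rule frame_on_subset[OF F], simp)
  have X': "smooth_vf A ?W X" and Y': "smooth_vf A ?W Y"
    by (rule smooth_vf_subset[OF X], simp) (rule smooth_vf_subset[OF Y], simp)
  {
    assume XD: "\<And>q. q \<in> U \<Longrightarrow> X q \<in> D q" and YD: "\<And>q. q \<in> U \<Longrightarrow> Y q \<in> D q" and \<nu>: "\<nu> \<in> D' p"
    have "g p (nb (E b) (E c) p) \<nu> = 0" if "b \<in> {1..n}" "c \<in> {1..n}" for b c
    proof -
      have "g p (nb (E b) (E c) p) \<nu> = g p (nb (E b) (E c) p) (\<Sum>i=1..m. g p \<nu> (F i p) *\<^sub>R F i p)"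
        using split_mfd.frame_expansion[OF split_swap F V(2) \<nu>] by (rule arg_cong)
      also have "\<dots> = 0" by (simp add: g_right h[OF that])
      finally show ?thesis .
    qed
    then show "g p (nb X Y p) \<nu> = 0"
      using second_form_expansion[OF W E' X' Y' _ _ \<nu>] XD YD by simp
  next
    assume XD: "\<And>q. q \<in> U \<Longrightarrow> X q \<in> D' q" and YD: "\<And>q. q \<in> U \<Longrightarrow> Y q \<in> D' q" and \<nu>: "\<nu> \<in> D p"
    have "g p (nb (F b) (F c) p) \<nu> = 0" if "b \<in> {1..m}" "c \<in> {1..m}" for b c
    proof -
      have "g p (nb (F b) (F c) p) \<nu> = g p (nb (F b) (F c) p) (\<Sum>a=1..n. g p \<nu> (E a p) *\<^sub>R E a p)"
        using frame_expansion[OF E V(2) \<nu>] by (rule arg_cong)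
      also have "\<dots> = 0" by (simp add: g_right k[OF _ that])
      finally show ?thesis .
    qed
    then show "g p (nb X Y p) \<nu> = 0"
      using lc_split.second_form_expansion[OF lc_swap W F' X' Y' _ _ \<nu>] XD YD by simp
  }
qed

section \<open>Splitting\<close>

text \<open>Isolates what the splitting uses of the curvature argument: both second forms vanish.
  They are stated for local fields so that coordinate fields can be inserted.\<close>

locale geodesic_split = lc_split A g D D' n m nb
  for A :: "('m::topological_space, 'e::euclidean_space) chart set" and g D D' n m nb +
  assumes geod: "open U \<Longrightarrow> p \<in> U \<Longrightarrow> smooth_vf A U X \<Longrightarrow> smooth_vf A U Y \<Longrightarrow>
      (\<And>q. q \<in> U \<Longrightarrow> X q \<in> D q) \<Longrightarrow> (\<And>q. q \<in> U \<Longrightarrow> Y q \<in> D q) \<Longrightarrow> \<nu> \<in> D' p \<Longrightarrow> g p (nb X Y p) \<nu> = 0"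
    and geod': "open U \<Longrightarrow> p \<in> U \<Longrightarrow> smooth_vf A U X \<Longrightarrow> smooth_vf A U Y \<Longrightarrow>
      (\<And>q. q \<in> U \<Longrightarrow> X q \<in> D' q) \<Longrightarrow> (\<And>q. q \<in> U \<Longrightarrow> Y q \<in> D' q) \<Longrightarrow> \<nu> \<in> D p \<Longrightarrow> g p (nb X Y p) \<nu> = 0"
begin

lemma geodesic_swap: "geodesic_split A g D' D m n nb"
  by (rule geodesic_split.intro[OF lc_swap]) (unfold_locales, fact geod', fact geod)

text \<open>Coordinate fields commute, so differentiating \<open>v\<close> along \<open>w\<close> is
  the same as differentiating \<open>w\<close> along \<open>v\<close>. The product of the result
  with \<open>v'\<close> is minus the product of \<open>w\<close> with the derivative of
  \<open>v'\<close> along \<open>v\<close>, which is a value of the second form of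
  \<open>D\<close>.\<close>

lemma metric_component_derivative:
  assumes c: "smooth_chart A c" "q \<in> fst c"
    and v: "\<And>r. r \<in> fst c \<Longrightarrow> tvec A c r v \<in> D r" and v': "\<And>r. r \<in> fst c \<Longrightarrow> tvec A c r v' \<in> D r"
    and w: "\<And>r. r \<in> fst c \<Longrightarrow> tvec A c r w \<in> D' r"
  shows "frechet_derivative ((\<lambda>r. g r (tvec A c r v) (tvec A c r v')) \<circ> cinv c) (at (snd c q)) w = 0"
proof -
  let ?X = "\<lambda>r. tvec A c r w" and ?Y = "\<lambda>r. tvec A c r v" and ?Z = "\<lambda>r. tvec A c r v'"
  have U: "open (fst c)" by (rule open_chart_dom[OF c(1)])
  note s = smooth_vf_tvec[OF c(1)]
  have comm: "nb ?X (\<lambda>r. tvec A c r u) q = nb (\<lambda>r. tvec A c r u) ?X q" for u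
    using nb_torsion[OF U s s c(2), of w u] by (simp add: lie_bracket_coordinate_fields[OF c])
  have zero: "g q (nb ?X (\<lambda>r. tvec A c r u) q) (tvec A c q u') = 0"
    if u: "\<And>r. r \<in> fst c \<Longrightarrow> tvec A c r u \<in> D r" and u': "\<And>r. r \<in> fst c \<Longrightarrow> tvec A c r u' \<in> D r" for u u'
  proof -
    have "g q (nb (\<lambda>r. tvec A c r u) ?X q) (tvec A c q u') = - g q (tvec A c q w) (nb (\<lambda>r. tvec A c r u) (\<lambda>r. tvec A c r u') q)"
      by (rule nb_metric_const[OF U s s s c(2)]) (rule orth'[OF u' w])
    also have "\<dots> = - g q (nb (\<lambda>r. tvec A c r u) (\<lambda>r. tvec A c r u') q) (tvec A c q w)"
      by (simp only: g_sym[of q "tvec A c q w"])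
    also have "\<dots> = 0" using geod[OF U c(2) s s u u' w[OF c(2)]] by simp
    finally show ?thesis by (simp only: comm)
  qed
  have "vderiv A q (tvec A c q w) (\<lambda>r. g r (?Y r) (?Z r)) = g q (nb ?X ?Y q) (?Z q) + g q (?Y q) (nb ?X ?Z q)"
    by (rule nb_metric[OF U s s s c(2)])
  also have "\<dots> = 0"
    using zero[OF v v'] zero[OF v' v] by (simp add: g_sym[of q "tvec A c q v"])
  finally show ?thesis
    by (simp only: vderiv_chart[OF smooth_g[OF U s s] U c(2) c] coord_tvec[OF c])
qed

end

section \<open>Charts obtained from diffeomorphisms\<close>

text \<open>\<open>cinv\<close> is defined by \<open>inv_into\<close>; it agrees on the image with
  the explicit inverse \<open>\<psi>\<close> and inherits its continuity.\<close>

lemma is_chartI: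
  assumes "open U" "open (\<phi> ` U)" "continuous_on U \<phi>" "continuous_on (\<phi> ` U) \<psi>"
    and inv: "\<And>q. q \<in> U \<Longrightarrow> \<psi> (\<phi> q) = q"
  shows "is_chart (U, \<phi>)" and "\<And>y. y \<in> \<phi> ` U \<Longrightarrow> cinv (U, \<phi>) y = \<psi> y"
proof -
  have inj: "inj_on \<phi> U" by (rule inj_on_inverseI[of U \<psi> \<phi>]) (rule inv)
  have c: "cinv (U, \<phi>) (\<phi> q) = q" if "q \<in> U" for q
    using inv_into_f_f[OF inj that] by (simp add: cinv_def)
  show eq: "cinv (U, \<phi>) y = \<psi> y" if "y \<in> \<phi> ` U" for y
  proof -
    obtain q where "q \<in> U" "y = \<phi> q" using \<open>y \<in> \<phi> ` U\<close> by blast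
    then show ?thesis by (simp only: c inv)
  qed
  have "continuous_on (\<phi> ` U) (cinv (U, \<phi>))"
    by (rule continuous_on_eq[OF assms(4) eq[symmetric]])
  then have "homeomorphism U (\<phi> ` U) \<phi> (cinv (U, \<phi>))"
    by (rule homeomorphismI[OF assms(3)]) (auto simp only: c)
  then show "is_chart (U, \<phi>)"
    using assms(1,2) by (simp add: is_chart_def)
qed

context smooth_mfd begin

text \<open>The transitions to and from an atlas chart are those of \<open>c\<close> composed with
  \<open>G\<close> and \<open>\<Phi>\<close>, hence smooth.\<close>

lemma smooth_chart_diffeomorphism:
  assumes c: "smooth_chart A c" and S: "open S" "S \<subseteq> snd c ` fst c" and V: "open V"
    and hom: "homeomorphism S V \<Phi> G" and \<Phi>: "smooth_on S \<Phi>" and G: "smooth_on V G"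
  defines "U \<equiv> fst c \<inter> snd c -` S"
  shows "smooth_chart A (U, \<lambda>q. \<Phi> (snd c q))" "(\<lambda>q. \<Phi> (snd c q)) ` U = V"
    "\<And>q v. q \<in> U \<Longrightarrow> coord A (U, \<lambda>q. \<Phi> (snd c q)) q v = frechet_derivative \<Phi> (at (snd c q)) (coord A c q v)"
proof -
  let ?\<phi> = "\<lambda>q. \<Phi> (snd c q)" and ?\<psi> = "\<lambda>y. cinv c (G y)"
  let ?d = "(U, ?\<phi>)"
  note ic = is_chartD[OF smooth_chart_is_chart[OF c]]
  have GV: "G y \<in> S" "\<Phi> (G y) = y" if "y \<in> V" for y
    using hom that by (auto simp: homeomorphism_def)
  have PS: "\<Phi> x \<in> V" "G (\<Phi> x) = x" if "x \<in> S" for x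
    using hom that by (auto simp: homeomorphism_def)
  have oU: "open U"
    unfolding U_def by (rule continuous_open_preimage[OF ic(6,1) S(1)])
  have Uc: "U \<subseteq> fst c" by (auto simp: U_def)
  have Gc: "cinv c (G y) \<in> U" "snd c (cinv c (G y)) = G y" if "y \<in> V" for y
    using GV(1)[OF that] S(2) ic(4,5)[of "G y"] by (auto simp: U_def)
  show im: "?\<phi> ` U = V"
  proof
    show "?\<phi> ` U \<subseteq> V" using PS(1) by (auto simp: U_def)
    show "V \<subseteq> ?\<phi> ` U"
    proof
      fix y assume y: "y \<in> V"
      have "y = \<Phi> (snd c (cinv c (G y)))" using Gc(2)[OF y] GV(2)[OF y] by simp
      then show "y \<in> ?\<phi> ` U" using Gc(1)[OF y] by blast
    qed
  qed
  have inv: "?\<psi> (?\<phi> q) = q" if "q \<in> U" for q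
    using that PS(2) ic(3)[of q] by (simp add: U_def)
  have oV: "open (?\<phi> ` U)" by (simp only: im V)
  have cont1: "continuous_on U ?\<phi>"
    by (rule continuous_on_compose2[OF smooth_on_continuous[OF \<Phi>] continuous_on_subset[OF ic(6) Uc]])
      (auto simp: U_def)
  have cont2: "continuous_on (?\<phi> ` U) ?\<psi>"
    unfolding im
    by (rule continuous_on_compose2[OF ic(7) smooth_on_continuous[OF G]]) (use GV(1) S(2) in blast)
  note d = is_chartI[OF oU oV cont1 cont2 inv]
  have cinvd: "cinv ?d y = cinv c (G y)" if "y \<in> V" for y
    using d(2)[of y] that im by blast
  have trans: "smooth_transition ?d c' \<and> smooth_transition c' ?d" if "c' \<in> A" for c'
  proof
    have c': "smooth_chart A c'" by (rule atlas_smooth_chart[OF that])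
    let ?W = "U \<inter> fst c'"
    have W: "open ?W" using oU open_chart_dom[OF c'] by blast
    have oc: "open (snd c ` ?W)" by (rule open_chart_inter[OF c W]) (use Uc in blast)
    have oc': "open (snd c' ` ?W)" by (rule open_chart_inter[OF c' W]) blast
    have od: "open (?\<phi> ` ?W)"
    proof -
      have "?\<phi> ` ?W = snd ?d ` (fst c' \<inter> fst ?d)" by auto
      then show ?thesis using open_chart_image[OF d(1) open_chart_dom[OF c']] by simp
    qed
    have sub: "snd c ` ?W \<subseteq> S" by (auto simp: U_def)
    have subV: "?\<phi> ` ?W \<subseteq> V" using im by blast
    have t1: "smooth_on (snd c ` ?W) (snd c' \<circ> cinv c)"
      by (rule smooth_on_subset[OF smooth_on_transition[OF c c']]) (use Uc in blast)
    have t2: "smooth_on (snd c' ` ?W) (snd c \<circ> cinv c')"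
      by (rule smooth_on_subset[OF smooth_on_transition[OF c' c]]) (use Uc in blast)
    have "G ` (?\<phi> ` ?W) \<subseteq> snd c ` ?W"
      using PS(2) by (auto simp: U_def)
    from smooth_on_compose[OF od oc smooth_on_subset[OF G subV] t1 this]
    have "smooth_on (?\<phi> ` ?W) (\<lambda>y. (snd c' \<circ> cinv c) (G y))" .
    then have "smooth_on (?\<phi> ` ?W) (snd c' \<circ> cinv ?d)"
      by (rule smooth_on_cong[OF od]) (use cinvd subV in \<open>simp add: subset_iff\<close>)
    then show "smooth_transition ?d c'" by (simp add: smooth_transition_def)
    have "(snd c \<circ> cinv c') ` (snd c' ` ?W) \<subseteq> S"
      using cinv_chart[OF c'] by (auto simp: U_def)
    from smooth_on_compose[OF oc' S(1) t2 \<Phi> this]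
    have "smooth_on (snd c' ` ?W) (\<lambda>x. \<Phi> ((snd c \<circ> cinv c') x))" .
    then show "smooth_transition c' ?d"
      unfolding smooth_transition_def by (simp add: comp_def Int_commute)
  qed
  show sd: "smooth_chart A ?d"
    unfolding smooth_chart_def using d(1) trans by blast
  fix q v assume q: "q \<in> U"
  have qc: "q \<in> fst c" "q \<in> fst ?d" using q Uc by auto
  have "((snd ?d \<circ> cinv c) has_derivative frechet_derivative \<Phi> (at (snd c q))) (at (snd c q))"
  proof (rule has_derivative_transform_within_open[OF smooth_on_has_derivative[OF \<Phi>] S(1)])
    fix x assume "x \<in> S"
    then show "\<Phi> x = (snd ?d \<circ> cinv c) x" using S(2) ic(4)[of x] by auto
  qed (use q in \<open>auto simp: U_def\<close>)
  then have "dtrans c ?d q = frechet_derivative \<Phi> (at (snd c q))"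
    unfolding dtrans_def by (rule frechet_derivative_eqI)
  then show "coord A ?d q v = frechet_derivative \<Phi> (at (snd c q)) (coord A c q v)"
    using dtrans_coord[OF c qc(1) sd qc(2), of v] by simp
qed

end

section \<open>A chart adapted to both foliations\<close>

lemma exists_linear_with_kernel:
  fixes W :: "'e::euclidean_space set"
  assumes W: "subspace W" "dim W + DIM('a) = DIM('e)"
  obtains P :: "'e \<Rightarrow> 'a::euclidean_space" where "linear P" "\<And>x. P x = 0 \<longleftrightarrow> x \<in> W"
proof -
  \<comment> \<open>\<open>P\<close> is the adjoint of a linear map onto the orthogonal complement of \<open>W\<close>.\<close>
  let ?C = "{y \<in> UNIV. \<forall>x\<in>W. orthogonal x y}"
  have sC: "subspace ?C" using subspace_orthogonal_to_vectors[of W] by simp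
  have "dim ?C + dim W = dim (UNIV :: 'e set)"
    by (rule dim_subspace_orthogonal_to_vectors[OF W(1) subspace_UNIV]) simp
  then have "dim ?C = DIM('a)" using W(2) by simp
  then have d: "dim (UNIV :: 'a set) = dim ?C" by simp
  obtain j :: "'a \<Rightarrow> 'e" where j: "linear j" "j ` UNIV = ?C"
    by (rule isometries_subspaces[OF subspace_UNIV sC d])
  have "adjoint j x = 0 \<longleftrightarrow> x \<in> W" for x
  proof
    assume 0: "adjoint j x = 0"
    have xC: "x \<bullet> y = 0" if y: "y \<in> ?C" for y
    proof -
      obtain u where "y = j u" using y j(2) by blast
      then show ?thesis using adjoint_works[OF j(1), of u x] 0 by (simp add: inner_commute)
    qed
    obtain y z where yz: "y \<in> span W" "\<And>w. w \<in> span W \<Longrightarrow> orthogonal z w" "x = y + z"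
      using orthogonal_subspace_decomp_exists[of W x] by metis
    have "z \<in> ?C" using yz(2) span_base by (auto simp: orthogonal_def inner_commute)
    then have "x \<bullet> z = 0" by (rule xC)
    moreover have "y \<bullet> z = 0" using yz(2)[OF yz(1)] by (simp add: orthogonal_def inner_commute)
    ultimately have "z = 0" by (simp add: yz(3) inner_add_left)
    then show "x \<in> W" using yz(1,3) span_eq_iff[THEN iffD2, OF W(1)] by simp
  next
    assume x: "x \<in> W"
    have 0: "u \<bullet> adjoint j x = 0" for u
    proof -
      have "j u \<in> ?C" using j(2) by blast
      then show ?thesis using x adjoint_works[OF j(1), of u x]
        by (simp add: orthogonal_def inner_commute)
    qed
    show "adjoint j x = 0" using 0[of "adjoint j x"] by simp
  qed
  then show thesis using that adjoint_linear[OF j(1)] by blast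
qed

text \<open>In tangent vectors, the kernel of the derivative of \<open>\<Phi>\<close> at
  \<open>p\<close> is the intersection of \<open>D p\<close> and \<open>D' p\<close>. It is trivial,
  so \<open>\<Phi>\<close> is a local diffeomorphism.\<close>

lemma product_chart:
  fixes A :: "('m::topological_space, 'a::euclidean_space \<times> 'b::euclidean_space) chart set"
  assumes "split_mfd A g D D' DIM('a) DIM('b)"
    and int: "integrable_distribution A D" and int': "integrable_distribution A D'"
  shows "\<exists>U \<phi> V1 V2. smooth_chart A (U, \<phi>) \<and> p \<in> U \<and> \<phi> ` U = V1 \<times> V2 \<and>
    open V1 \<and> convex V1 \<and> open V2 \<and> convex V2 \<and>
    (\<forall>q\<in>U. coord A (U, \<phi>) q ` D q = UNIV \<times> {0} \<and> coord A (U, \<phi>) q ` D' q = {0} \<times> UNIV)"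
proof -
  interpret split_mfd A g D D' "DIM('a)" "DIM('b)" by fact
  obtain c W where c: "smooth_chart A c" "p \<in> fst c" and W: "subspace W"
    and cD: "\<And>q. q \<in> fst c \<Longrightarrow> coord A c q ` D q = W"
    using int unfolding integrable_distribution_def by metis
  obtain c' W' where c': "smooth_chart A c'" "p \<in> fst c'" and W': "subspace W'"
    and cD': "\<And>q. q \<in> fst c' \<Longrightarrow> coord A c' q ` D' q = W'"
    using int' unfolding integrable_distribution_def by metis
  \<comment> \<open>As the kernel \<open>W\<close> has the dimension of the first factor, the linear
    map killing it takes values in the second factor, and conversely for \<open>W'\<close>.\<close>
  have "dim W = DIM('a)"
    using dim_image_eq[OF linear_coord[OF c] inj_on_subset[OF inj_coord[OF c] subset_UNIV], of "D p"]
    by (simp add: cD[OF c(2)] dim_D)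
  then have dW: "dim W + DIM('b) = DIM('a \<times> 'b)" by simp
  have "dim W' = DIM('b)"
    using dim_image_eq[OF linear_coord[OF c'] inj_on_subset[OF inj_coord[OF c'] subset_UNIV], of "D' p"]
    by (simp add: cD'[OF c'(2)] split_mfd.dim_D[OF split_swap])
  then have dW': "dim W' + DIM('a) = DIM('a \<times> 'b)" by simp
  obtain P2 :: "'a \<times> 'b \<Rightarrow> 'b" where P2: "linear P2" "\<And>x. P2 x = 0 \<longleftrightarrow> x \<in> W"
    using exists_linear_with_kernel[OF W dW] by metis
  obtain P1 :: "'a \<times> 'b \<Rightarrow> 'a" where P1: "linear P1" "\<And>x. P1 x = 0 \<longleftrightarrow> x \<in> W'"
    using exists_linear_with_kernel[OF W' dW'] by metis
  have bl: "bounded_linear P1" "bounded_linear P2"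
    using P1(1) P2(1) by (simp_all add: linear_conv_bounded_linear)
  define N where "N = fst c \<inter> fst c'"
  have N: "open N" "N \<subseteq> fst c" "N \<subseteq> fst c'" "p \<in> N"
    unfolding N_def using open_chart_dom[OF c(1)] open_chart_dom[OF c'(1)] c(2) c'(2) by auto
  let ?S = "snd c ` N" and ?\<tau> = "snd c' \<circ> cinv c"
  have S: "open ?S" by (rule open_chart_inter[OF c(1) N(1,2)])
  \<comment> \<open>The leaves of \<open>D\<close> are the level sets of \<open>P2 \<circ> snd c\<close>, those of \<open>D'\<close> the level sets of
    \<open>P1 \<circ> snd c'\<close>; together these two maps form the product chart, here written in the chart \<open>c\<close>.\<close>
  define \<Phi> where "\<Phi> x = (P1 (?\<tau> x), P2 x)" for x
  have "smooth_on ?S ?\<tau>"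
    by (rule smooth_on_subset[OF smooth_on_transition[OF c(1) c'(1)]]) (simp add: N_def)
  then have \<Phi>: "smooth_on ?S \<Phi>"
    unfolding \<Phi>_def[abs_def]
    by (intro smooth_on_Pair[OF S] smooth_on_bounded_linear[OF S bl(1)] smooth_on_bounded_linear[OF S bl(2)] smooth_on_ident)
  have d\<Phi>: "frechet_derivative \<Phi> (at (snd c q)) = (\<lambda>v. (P1 (dtrans c c' q v), P2 v))" if "q \<in> N" for q
  proof (rule frechet_derivative_eqI)
    have q: "q \<in> fst c" "q \<in> fst c'" using that N by auto
    show "(\<Phi> has_derivative (\<lambda>v. (P1 (dtrans c c' q v), P2 v))) (at (snd c q))"
      unfolding \<Phi>_def[abs_def]
      by (intro has_derivative_Pair bounded_linear.has_derivative[OF bl(1)] bounded_linear.has_derivative[OF bl(2)]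
          has_derivative_transition[OF c(1) c'(1) q] has_derivative_ident)
  qed
  have d\<Phi>_coord: "frechet_derivative \<Phi> (at (snd c q)) (coord A c q v) = (P1 (coord A c' q v), P2 (coord A c q v))"
    if "q \<in> N" for q v
  proof -
    have q: "q \<in> fst c" "q \<in> fst c'" using that N by auto
    show ?thesis by (simp add: d\<Phi>[OF that] dtrans_coord[OF c(1) q(1) c'(1) q(2)])
  qed
  have kerD: "P2 (coord A c q v) = 0 \<longleftrightarrow> v \<in> D q" and kerD': "P1 (coord A c' q v) = 0 \<longleftrightarrow> v \<in> D' q"
    if "q \<in> N" for q v
  proof -
    have q: "q \<in> fst c" "q \<in> fst c'" using that N by auto
    show "P2 (coord A c q v) = 0 \<longleftrightarrow> v \<in> D q"
      unfolding P2(2) cD[OF q(1), symmetric] by (rule inj_image_mem_iff[OF inj_coord[OF c(1) q(1)]])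
    show "P1 (coord A c' q v) = 0 \<longleftrightarrow> v \<in> D' q"
      unfolding P1(2) cD'[OF q(2), symmetric] by (rule inj_image_mem_iff[OF inj_coord[OF c'(1) q(2)]])
  qed
  have "inj (frechet_derivative \<Phi> (at (snd c p)))"
  proof -
    have "linear (frechet_derivative \<Phi> (at (snd c p)))"
      by (rule linear_frechet_derivative[OF smooth_on_differentiable[OF \<Phi>]]) (use N in blast)
    moreover have "u = 0" if u: "frechet_derivative \<Phi> (at (snd c p)) u = 0" for u
    proof -
      define v where "v = tvec A c p u"
      have uv: "u = coord A c p v" by (simp add: v_def coord_tvec[OF c])
      have "v \<in> D p" "v \<in> D' p"
        using u kerD[OF N(4), of v] kerD'[OF N(4), of v]
        unfolding uv d\<Phi>_coord[OF N(4)] by (simp_all add: prod_eq_iff)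
      then have "v = 0" using orth[of v p v] g_self_eq_0 by blast
      then show "u = 0" by (simp add: uv linear_0[OF linear_coord[OF c]])
    qed
    ultimately show ?thesis by (simp add: linear_injective_0)
  qed
  moreover have x0S: "snd c p \<in> ?S" using N(4) by blast
  ultimately obtain U' V G where U': "open U'" "U' \<subseteq> ?S" "snd c p \<in> U'" and V: "open V"
    and hom: "homeomorphism U' V \<Phi> G" and G: "smooth_on V G"
    using smooth_local_inverse[OF S \<Phi> x0S] by metis
  have "\<Phi> (snd c p) \<in> V" using hom U'(3) by (auto simp: homeomorphism_def)
  then obtain A1 A2 where A12: "open A1" "open A2" "\<Phi> (snd c p) \<in> A1 \<times> A2" "A1 \<times> A2 \<subseteq> V"
    by (rule open_prod_elim[OF V])
  obtain r1 where r1: "r1 > 0" "ball (fst (\<Phi> (snd c p))) r1 \<subseteq> A1"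
    using openE[OF A12(1), of "fst (\<Phi> (snd c p))"] A12(3) by (auto simp: mem_Times_iff)
  obtain r2 where r2: "r2 > 0" "ball (snd (\<Phi> (snd c p))) r2 \<subseteq> A2"
    using openE[OF A12(2), of "snd (\<Phi> (snd c p))"] A12(3) by (auto simp: mem_Times_iff)
  \<comment> \<open>Balls are chosen for their convexity: constancy of the metric along each factor
    will be derived from a vanishing derivative.\<close>
  let ?V1 = "ball (fst (\<Phi> (snd c p))) r1" and ?V2 = "ball (snd (\<Phi> (snd c p))) r2"
  let ?R = "U' \<inter> \<Phi> -` (?V1 \<times> ?V2)"
  have VV: "?V1 \<times> ?V2 \<subseteq> V" "open (?V1 \<times> ?V2)"
    using r1 r2 A12(4) by (auto intro!: open_Times)
  have oR: "open ?R"
    by (rule continuous_open_preimage[OF smooth_on_continuous[OF smooth_on_subset[OF \<Phi> U'(2)]] U'(1) VV(2)])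
  have "\<Phi> ` ?R = ?V1 \<times> ?V2"
  proof
    show "?V1 \<times> ?V2 \<subseteq> \<Phi> ` ?R"
    proof
      fix y assume y: "y \<in> ?V1 \<times> ?V2"
      then have "y \<in> V" using VV(1) by blast
      then have "G y \<in> U'" "\<Phi> (G y) = y" using hom by (auto simp: homeomorphism_def)
      then show "y \<in> \<Phi> ` ?R" using y by (intro image_eqI[of _ _ "G y"]) auto
    qed
  qed auto
  then have homR: "homeomorphism ?R (?V1 \<times> ?V2) \<Phi> G"
    using homeomorphism_of_subsets[OF hom, of ?R V] by simp
  have RS: "?R \<subseteq> snd c ` fst c" "?R \<subseteq> ?S" using U'(2) N(2) by blast+
  let ?U = "fst c \<inter> snd c -` ?R" and ?\<phi> = "\<lambda>q. \<Phi> (snd c q)"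
  note chart = smooth_chart_diffeomorphism[OF c(1) oR RS(1) VV(2) homR smooth_on_subset[OF \<Phi> RS(2)] smooth_on_subset[OF G VV(1)]]
  \<comment> \<open>\<open>snd c\<close> is injective on the domain of \<open>c\<close>, so a point
    of that domain whose image lies in the image of \<open>N\<close> belongs to
    \<open>N\<close>.\<close>
  have UN: "q \<in> N" if q: "q \<in> ?U" for q
  proof -
    obtain q' where "q' \<in> N" "snd c q = snd c q'" using q RS(2) by blast
    then show ?thesis using cinv_chart[OF c(1), of q] cinv_chart[OF c(1), of q'] q N(2) by auto
  qed
  define d where "d = (?U, ?\<phi>)"
  have d: "smooth_chart A d" unfolding d_def by (rule chart(1))
  have co: "coord A d q v = (P1 (coord A c' q v), P2 (coord A c q v))" if "q \<in> ?U" for q v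
    unfolding d_def chart(3)[OF that] by (rule d\<Phi>_coord[OF UN[OF that]])
  have im: "coord A d q ` D q = UNIV \<times> {0} \<and> coord A d q ` D' q = {0} \<times> UNIV" if q: "q \<in> ?U" for q
  proof -
    have qd: "q \<in> fst d" using q by (simp add: d_def)
    note ker = kerD[OF UN[OF q]] kerD'[OF UN[OF q]]
    have "coord A d q x \<in> UNIV \<times> {0}" if "x \<in> D q" for x
      using that by (simp add: co[OF q] ker mem_Times_iff)
    moreover have "coord A d q y \<in> {0} \<times> UNIV" if "y \<in> D' q" for y
      using that by (simp add: co[OF q] ker mem_Times_iff)
    \<comment> \<open>The tangent vector with components \<open>(u, 0)\<close> lies in
      \<open>D q\<close> because its second component, the value of \<open>P2\<close>, is
      zero.\<close>
    moreover have "(u, 0) \<in> coord A d q ` D q" for u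
    proof (rule image_eqI)
      show e: "(u, 0) = coord A d q (tvec A d q (u, 0))" by (rule coord_tvec[OF d qd, symmetric])
      then show "tvec A d q (u, 0) \<in> D q" unfolding co[OF q] prod.inject by (simp add: ker)
    qed
    moreover have "(0, w) \<in> coord A d q ` D' q" for w
    proof (rule image_eqI)
      show e: "(0, w) = coord A d q (tvec A d q (0, w))" by (rule coord_tvec[OF d qd, symmetric])
      then show "tvec A d q (0, w) \<in> D' q" unfolding co[OF q] prod.inject by (simp add: ker)
    qed
    ultimately show ?thesis by blast
  qed
  have "p \<in> ?U" using c(2) U'(3) r1(1) r2(1) by (simp add: mem_Times_iff)
  then show ?thesis
    using im unfolding d_def
    by (intro exI[of _ ?U] exI[of _ ?\<phi>] exI[of _ ?V1] exI[of _ ?V2] conjI ballI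
        chart(1,2) open_ball convex_ball) blast+
qed

section \<open>The local product metric\<close>

text \<open>In the product chart the mixed components of the metric vanish by orthogonality, and
  each diagonal block depends on its own factor only. The factor metrics are the blocks restricted
  to the two slices through \<open>p\<close>.\<close>

lemma geodesic_split_locally_splits:
  fixes A :: "('m::topological_space, 'a::euclidean_space \<times> 'b::euclidean_space) chart set"
  assumes geo: "geodesic_split A g D D' DIM('a) DIM('b) nb"
    and int: "integrable_distribution A D" and int': "integrable_distribution A D'"
  shows "locally_splits A g D D'"
  unfolding locally_splits_def
proof
  fix p
  interpret geodesic_split A g D D' "DIM('a)" "DIM('b)" nb by fact
  obtain U \<phi> V1 V2 where prod: "smooth_chart A (U, \<phi>) \<and> p \<in> U \<and> \<phi> ` U = V1 \<times> V2 \<and>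
      open V1 \<and> convex V1 \<and> open V2 \<and> convex V2 \<and>
      (\<forall>q\<in>U. coord A (U, \<phi>) q ` D q = UNIV \<times> {0} \<and> coord A (U, \<phi>) q ` D' q = {0} \<times> UNIV)"
    using product_chart[OF split_mfd_axioms int int', of p] by (elim exE)
  then have d: "smooth_chart A (U, \<phi>)" and p: "p \<in> U" and im: "\<phi> ` U = V1 \<times> V2"
    and V: "open V1" "convex V1" "open V2" "convex V2"
    and cD: "\<And>q. q \<in> U \<Longrightarrow> coord A (U, \<phi>) q ` D q = UNIV \<times> {0}"
    and cD': "\<And>q. q \<in> U \<Longrightarrow> coord A (U, \<phi>) q ` D' q = {0} \<times> UNIV"
    by simp_all
  let ?d = "(U, \<phi>)"
  have fd: "fst ?d = U" and sd: "snd ?d = \<phi>" by simp_all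
  have U: "open U" using open_chart_dom[OF d] by simp
  note lt = linear_tvec[OF d, unfolded fd] and ct = coord_tvec[OF d, unfolded fd] and tc = tvec_coord[OF d, unfolded fd]
  have tD: "tvec A ?d r (v, 0) \<in> D r" if r: "r \<in> U" for r v
  proof -
    have "(v, 0) \<in> coord A ?d r ` D r" by (simp add: cD[OF r])
    then obtain x where x: "x \<in> D r" "(v, 0) = coord A ?d r x" by (elim imageE)
    show ?thesis using x(1) by (simp only: x(2) tc[OF r])
  qed
  have tD': "tvec A ?d r (0, w) \<in> D' r" if r: "r \<in> U" for r w
  proof -
    have "(0, w) \<in> coord A ?d r ` D' r" by (simp add: cD'[OF r])
    then obtain x where x: "x \<in> D' r" "(0, w) = coord A ?d r x" by (elim imageE)
    show ?thesis using x(1) by (simp only: x(2) tc[OF r])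
  qed
  define f where "f v w r = g r (tvec A ?d r v) (tvec A ?d r w)" for v w r
  have inv: "cinv ?d (\<phi> q) = q" if "q \<in> U" for q
    using cinv_chart[OF d, of q] that by simp
  have inv': "cinv ?d z \<in> U" "\<phi> (cinv ?d z) = z" if "z \<in> V1 \<times> V2" for z
  proof -
    obtain q where "q \<in> U" "z = \<phi> q" using \<open>z \<in> V1 \<times> V2\<close> im by blast
    then show "cinv ?d z \<in> U" "\<phi> (cinv ?d z) = z" by (simp_all add: inv)
  qed
  have sf: "smooth_on (V1 \<times> V2) (f v w \<circ> cinv ?d)" for v w
  proof -
    have "smooth_fun A U (f v w)"
      unfolding f_def[abs_def] by (rule smooth_g[OF U]) (rule smooth_vf_tvec[OF d, unfolded fd])+
    from smooth_fun_chart[OF this U d] show ?thesis by (simp add: im)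
  qed
  have der: "((f v w \<circ> cinv ?d) has_derivative frechet_derivative (f v w \<circ> cinv ?d) (at z)) (at z)"
    if "z \<in> V1 \<times> V2" for v w z
    by (rule smooth_on_has_derivative[OF sf that])
  have d0: "frechet_derivative (f (v, 0) (w, 0) \<circ> cinv ?d) (at z) (0, u) = 0" if z: "z \<in> V1 \<times> V2" for v w u z
  proof -
    have q: "cinv ?d z \<in> fst ?d" using inv'(1)[OF z] by simp
    show ?thesis
      using metric_component_derivative[OF d q, of "(v, 0)" "(w, 0)" "(0, u)", unfolded fd sd inv'(2)[OF z]]
      by (simp add: tD tD' f_def[abs_def])
  qed
  have d0': "frechet_derivative (f (0, v) (0, w) \<circ> cinv ?d) (at z) (u, 0) = 0" if z: "z \<in> V1 \<times> V2" for v w u z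
  proof -
    have q: "cinv ?d z \<in> fst ?d" using inv'(1)[OF z] by simp
    show ?thesis
      using geodesic_split.metric_component_derivative[OF geodesic_swap d q, of "(0, v)" "(0, w)" "(u, 0)", unfolded fd sd inv'(2)[OF z]]
      by (simp add: tD tD' f_def[abs_def])
  qed
  obtain x0 y0 where xy0: "\<phi> p = (x0, y0)" by fastforce
  then have "(x0, y0) \<in> V1 \<times> V2" using p im by (metis imageI)
  then have x0: "x0 \<in> V1" and y0: "y0 \<in> V2" by auto
  \<comment> \<open>The derivative in the directions of \<open>V2\<close> is zero and
    \<open>V2\<close> is convex, so this block does not depend on the second coordinate.\<close>
  have const: "(f (v, 0) (w, 0) \<circ> cinv ?d) (x, y) = (f (v, 0) (w, 0) \<circ> cinv ?d) (x, y0)"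
    if x: "x \<in> V1" and y: "y \<in> V2" for v w x y
  proof -
    have "((\<lambda>y. (f (v, 0) (w, 0) \<circ> cinv ?d) (x, y)) has_derivative (\<lambda>h. 0)) (at y within V2)" if y: "y \<in> V2" for y
    proof -
      have "(Pair x has_derivative (\<lambda>h. (0, h))) (at y)"
        by (intro has_derivative_Pair has_derivative_const has_derivative_ident)
      from has_derivative_compose[OF this der[of "(x, y)" "(v, 0)" "(w, 0)"]]
      have "((\<lambda>y. (f (v, 0) (w, 0) \<circ> cinv ?d) (x, y)) has_derivative (\<lambda>h. 0)) (at y)"
        using x y by (simp add: d0)
      then show ?thesis by (rule has_derivative_at_withinI)
    qed
    from has_derivative_zero_constant[OF V(4) this] obtain k
      where "\<And>y. y \<in> V2 \<Longrightarrow> (f (v, 0) (w, 0) \<circ> cinv ?d) (x, y) = k" by blast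
    then show ?thesis using y y0 by simp
  qed
  have const': "(f (0, v) (0, w) \<circ> cinv ?d) (x, y) = (f (0, v) (0, w) \<circ> cinv ?d) (x0, y)"
    if x: "x \<in> V1" and y: "y \<in> V2" for v w x y
  proof -
    have "((\<lambda>x. (f (0, v) (0, w) \<circ> cinv ?d) (x, y)) has_derivative (\<lambda>h. 0)) (at x within V1)" if x: "x \<in> V1" for x
    proof -
      have "((\<lambda>x. (x, y)) has_derivative (\<lambda>h. (h, 0))) (at x)"
        by (intro has_derivative_Pair has_derivative_const has_derivative_ident)
      from has_derivative_compose[OF this der[of "(x, y)" "(0, v)" "(0, w)"]]
      have "((\<lambda>x. (f (0, v) (0, w) \<circ> cinv ?d) (x, y)) has_derivative (\<lambda>h. 0)) (at x)"
        using x y by (simp add: d0')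
      then show ?thesis by (rule has_derivative_at_withinI)
    qed
    from has_derivative_zero_constant[OF V(2) this] obtain k
      where "\<And>x. x \<in> V1 \<Longrightarrow> (f (0, v) (0, w) \<circ> cinv ?d) (x, y) = k" by blast
    then show ?thesis using x x0 by simp
  qed
  define g1 where "g1 x v w = (f (v, 0) (w, 0) \<circ> cinv ?d) (x, y0)" for x v w
  define g2 where "g2 y v w = (f (0, v) (0, w) \<circ> cinv ?d) (x0, y)" for y v w
  \<comment> \<open>\<open>j\<close> stands for the inclusion of either factor; its domain type is
    left general so that the fact serves both factor metrics.\<close>
  have inner: "inner_form (\<lambda>v w. f (j v) (j w) q)" if q: "q \<in> U" and j: "linear j" "\<And>v. j v = 0 \<Longrightarrow> v = 0"
    for q and j :: "'c::euclidean_space \<Rightarrow> 'a \<times> 'b"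
  proof -
    let ?j = "\<lambda>v. tvec A ?d q (j v)"
    have lj: "linear ?j" using linear_compose[OF j(1) lt[OF q]] by (simp add: comp_def)
    have "bilinear (\<lambda>v w. g q (?j v) (?j w))"
      unfolding bilinear_def
      using linear_compose[OF lj linear_g_right] linear_compose[OF lj linear_g_left] by (simp add: comp_def)
    moreover have "g q (?j v) (?j v) > 0" if "v \<noteq> 0" for v
    proof (rule g_pos)
      show "?j v \<noteq> 0"
      proof
        assume "?j v = 0"
        then have "j v = coord A ?d q 0" using ct[OF q, of "j v"] by simp
        then have "j v = 0" using linear_0[OF linear_coord[OF d]] q by simp
        then show False using j(2) that by blast
      qed
    qed
    ultimately show ?thesis unfolding inner_form_def f_def using g_sym by blast
  qed
  have m1: "metric_on V1 g1"
    unfolding metric_on_def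
  proof (intro conjI ballI allI)
    fix x assume "x \<in> V1"
    then show "inner_form (g1 x)"
      unfolding g1_def[abs_def] comp_def
      by (intro inner inv'(1) linearI) (simp_all add: y0 zero_prod_def)
  next
    fix v w
    have "smooth_on V1 (\<lambda>x. (x, y0))"
      by (intro smooth_on_Pair[OF V(1)] smooth_on_ident smooth_on_const)
    from smooth_on_compose[OF V(1) open_Times[OF V(1,3)] this sf]
    show "smooth_on V1 (\<lambda>x. g1 x v w)" unfolding g1_def using y0 by blast
  qed (fact V)
  have m2: "metric_on V2 g2"
    unfolding metric_on_def
  proof (intro conjI ballI allI)
    fix y assume "y \<in> V2"
    then show "inner_form (g2 y)"
      unfolding g2_def[abs_def] comp_def
      by (intro inner inv'(1) linearI) (simp_all add: x0 zero_prod_def)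
  next
    fix v w
    have "smooth_on V2 (\<lambda>y. (x0, y))"
      by (intro smooth_on_Pair[OF V(3)] smooth_on_ident smooth_on_const)
    from smooth_on_compose[OF V(3) open_Times[OF V(1,3)] this sf]
    show "smooth_on V2 (\<lambda>y. g2 y v w)" unfolding g2_def using x0 by blast
  qed (fact V)
  have split: "g q v w = g1 (fst (\<phi> q)) (fst (coord A ?d q v)) (fst (coord A ?d q w)) +
      g2 (snd (\<phi> q)) (snd (coord A ?d q v)) (snd (coord A ?d q w))" if q: "q \<in> U" for q v w
  proof -
    obtain x y where xy: "\<phi> q = (x, y)" by fastforce
    then have "(x, y) \<in> V1 \<times> V2" using q im by (metis imageI)
    then have xV: "x \<in> V1" and yV: "y \<in> V2" by auto
    have cq: "cinv ?d (x, y) = q" using inv[OF q] xy by simp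
    obtain v1 v2 where v: "coord A ?d q v = (v1, v2)" by fastforce
    obtain w1 w2 where w: "coord A ?d q w = (w1, w2)" by fastforce
    have e: "u = tvec A ?d q (u1, 0) + tvec A ?d q (0, u2)" if "coord A ?d q u = (u1, u2)" for u u1 u2
    proof -
      have "u = tvec A ?d q ((u1, 0) + (0, u2))" using tc[OF q, of u] that by simp
      then show ?thesis by (simp only: linear_add[OF lt[OF q]])
    qed
    have "g q v w = g q (tvec A ?d q (v1, 0)) (tvec A ?d q (w1, 0)) + g q (tvec A ?d q (0, v2)) (tvec A ?d q (0, w2))"
      unfolding arg_cong2[of _ _ _ _ "g q", OF e[OF v] e[OF w]]
      by (simp add: linear_add[OF linear_g_left] linear_add[OF linear_g_right] orth[OF tD[OF q] tD'[OF q]] orth'[OF tD[OF q] tD'[OF q]])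
    also have "g q (tvec A ?d q (v1, 0)) (tvec A ?d q (w1, 0)) = g1 x v1 w1"
      unfolding g1_def const[OF xV yV, symmetric] by (simp add: cq f_def)
    also have "g q (tvec A ?d q (0, v2)) (tvec A ?d q (0, w2)) = g2 y v2 w2"
      unfolding g2_def const'[OF xV yV, symmetric] by (simp add: cq f_def)
    finally show ?thesis by (simp add: xy v w)
  qed
  show "\<exists>U \<phi> V1 V2 g1 g2. smooth_chart A (U, \<phi>) \<and> p \<in> U \<and> \<phi> ` U = V1 \<times> V2 \<and>
        metric_on V1 g1 \<and> metric_on V2 g2 \<and>
        (\<forall>q\<in>U. let d\<phi> = coord A (U, \<phi>) q in
           (\<forall>v w. g q v w = g1 (fst (\<phi> q)) (fst (d\<phi> v)) (fst (d\<phi> w)) +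
                            g2 (snd (\<phi> q)) (snd (d\<phi> v)) (snd (d\<phi> w))) \<and>
           d\<phi> ` D q = UNIV \<times> {0} \<and> d\<phi> ` D' q = {0} \<times> UNIV)"
    unfolding Let_def
    by (intro exI[of _ U] exI[of _ \<phi>] exI[of _ V1] exI[of _ V2] exI[of _ g1] exI[of _ g2] conjI ballI allI
        d p im m1 m2 split cD cD')
qed

text \<open>\<open>tensor_adjoint\<close> is a definite description. A vector representing the
  functional is built from orthonormal frames of \<open>D\<close> and \<open>D'\<close>, and
  positivity of \<open>g\<close> makes it unique.\<close>

lemma (in split_mfd) tensor_adjoint_eq:
  assumes "linear (S p x)"
  shows "g p (tensor_adjoint g S p x y) z = g p (S p x z) y"
proof -
  obtain U E where U: "open U" "p \<in> U" "frame_on U n D E" by (rule frame_on_exists[OF D])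
  obtain V F where V: "open V" "p \<in> V" "frame_on V m D' F" by (rule frame_on_exists[OF D'])
  have E: "frame_on (U \<inter> V) n D E" and F: "frame_on (U \<inter> V) m D' F"
    by (rule frame_on_subset[OF U(3)], simp) (rule frame_on_subset[OF V(3)], simp)
  have pUV: "p \<in> U \<inter> V" using U V by simp
  let ?u = "(\<Sum>a=1..n. g p (S p x (E a p)) y *\<^sub>R E a p) + (\<Sum>i=1..m. g p (S p x (F i p)) y *\<^sub>R F i p)"
  have u: "g p ?u z = g p (S p x z) y" for z
  proof -
    have "g p (S p x z) y = g p (S p x ((\<Sum>a=1..n. g p z (E a p) *\<^sub>R E a p) + (\<Sum>i=1..m. g p z (F i p) *\<^sub>R F i p))) y"
      using full_expansion[OF E F pUV, of z] by (rule arg_cong)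
    also have "\<dots> = (\<Sum>a=1..n. g p z (E a p) * g p (S p x (E a p)) y) + (\<Sum>i=1..m. g p z (F i p) * g p (S p x (F i p)) y)"
      by (simp add: linear_add[OF assms] linear_sum[OF assms] linear_scale[OF assms] g_left)
    also have "\<dots> = g p ?u z"
      by (simp add: g_left g_sym[of p z] mult.commute)
    finally show ?thesis ..
  qed
  have "\<forall>z. g p (tensor_adjoint g S p x y) z = g p (S p x z) y"
    unfolding tensor_adjoint_def
  proof (rule theI)
    show "\<forall>z. g p ?u z = g p (S p x z) y" by (intro allI u)
  next
    fix w assume w: "\<forall>z. g p w z = g p (S p x z) y"
    have "g p (w - ?u) (w - ?u) = 0"
      unfolding linear_diff[OF linear_g_left] u w[rule_format] by simp
    then have "w - ?u = 0" by (rule g_self_eq_0)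
    then show "w = ?u" by (simp only: right_minus_eq)
  qed
  then show ?thesis by (rule spec)
qed

theorem theorem5:
  fixes A :: "('m::{t2_space, second_countable_topology},
                'a::euclidean_space \<times> 'b::euclidean_space) chart set"
    and g :: "'m \<Rightarrow> 'a \<times> 'b \<Rightarrow> 'a \<times> 'b \<Rightarrow> real"
    and nb nbbar :: "('m \<Rightarrow> 'a \<times> 'b) \<Rightarrow> ('m \<Rightarrow> 'a \<times> 'b) \<Rightarrow> 'm \<Rightarrow> 'a \<times> 'b"
    and Dtop Dbot :: "'m \<Rightarrow> ('a \<times> 'b) set"
    and T Tadj :: "'m \<Rightarrow> 'a \<times> 'b \<Rightarrow> 'a \<times> 'b \<Rightarrow> 'a \<times> 'b"
  assumes "connected (UNIV :: 'm set)"
    and "smooth_atlas A"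
    and "riemannian_metric A g"
    and "levi_civita A g nb"
    and "linear_connection A nbbar"
    and "complete_metric A g \<and> \<not> compact (UNIV :: 'm set) \<or> compact (UNIV :: 'm set)"
    and "smooth_distribution A DIM('a) Dtop"
    and "smooth_distribution A DIM('b) Dbot"
    and "complementary_orthogonal g Dtop Dbot"
    and "integrable_distribution A Dtop"
    and "integrable_distribution A Dbot"
    and "\<forall>p. mean_curvature A g nb Dtop Dbot p = 0"
    and "\<forall>p. mean_curvature A g nb Dbot Dtop p = 0"
    and T_def: "T = contorsion A nbbar nb"
    and Tadj_def: "Tadj = tensor_adjoint g T"
    and "\<forall>p. \<forall>x\<in>Dtop p. \<forall>y\<in>Dbot p.
           T p x y = 0 \<and> T p y x = 0 \<and> Tadj p x y = 0 \<and> Tadj p y x = 0"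
    and "L1_riemannian A g
           (\<lambda>p. sqrt (g p (xi_field A g Dtop Dbot T p) (xi_field A g Dtop Dbot T p)))"
    and "\<forall>p. g p (tensor_trace A g Dtop T p) (tensor_trace A g Dbot Tadj p) +
             g p (tensor_trace A g Dbot T p) (tensor_trace A g Dtop Tadj p) = 0"
    and "\<forall>p. mixed_scalar_curvature A g nbbar Dtop Dbot p \<ge> 0"
  shows "locally_splits A g Dtop Dbot"
proof -
  have base: "smooth_mfd A" "connection A nb" "connection A nbbar"
    using assms(2,4,5) by (auto simp: smooth_mfd_def connection_def connection_axioms_def levi_civita_def)
  interpret split_mfd A g Dtop Dbot "DIM('a)" "DIM('b)"
    by (intro split_mfd.intro riem_mfd.intro split_mfd_axioms.intro riem_mfd_axioms.intro base(1) assms(3,7,8,9))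
  have lc: "lc_split A g Dtop Dbot DIM('a) DIM('b) nb"
    by (intro lc_split.intro lc_split_axioms.intro split_mfd_axioms assms(4))
  have harm: "harmonic_split A g Dtop Dbot DIM('a) DIM('b) nb"
    using assms(10-13) by (intro harmonic_split.intro harmonic_split_axioms.intro lc) blast+
  interpret two: two_connections A nb nbbar
    by (intro two_connections.intro base(2,3))
  have T: "contorsion A nbbar nb p x y = 0" "contorsion A nbbar nb p y x = 0"
    "g p (contorsion A nbbar nb p x z) y = 0" "g p (contorsion A nbbar nb p y z) x = 0"
    if "x \<in> Dtop p" "y \<in> Dbot p" for p x y z
  proof -
    have lin: "linear (T p u)" for u
      using two.bilinear_contorsion[of p] unfolding T_def bilinear_def by blast
    \<comment> \<open>With \<open>z\<close> arbitrary, the vanishing of \<open>Tadj p u v\<close>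
      means that \<open>T p u\<close> takes all its values orthogonal to \<open>v\<close>.\<close>
    have adj: "g p (Tadj p u v) z = g p (T p u z) v" for u v z
      unfolding Tadj_def by (rule tensor_adjoint_eq[of T, OF lin])
    have 0: "T p x y = 0" "T p y x = 0" "Tadj p x y = 0" "Tadj p y x = 0"
      using assms(16) that by blast+
    show "contorsion A nbbar nb p x y = 0" "contorsion A nbbar nb p y x = 0"
      using 0 by (simp_all add: T_def)
    show "g p (contorsion A nbbar nb p x z) y = 0" "g p (contorsion A nbbar nb p y z) x = 0"
      using adj[of x y z] adj[of y x z] 0 by (simp_all add: T_def linear_0[OF linear_g_left])
  qed
  have adapted: "adapted_split A g Dtop Dbot DIM('a) DIM('b) nb nbbar"
    by (intro adapted_split.intro adapted_split_axioms.intro harm two.two_connections_axioms T)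
  have "mixed_scalar_curvature A g nbbar Dtop Dbot p \<ge> 0" for p
    using assms(19) by blast
  note geod = adapted_split.totally_geodesic[OF adapted this]
  have "geodesic_split A g Dtop Dbot DIM('a) DIM('b) nb"
    by (intro geodesic_split.intro geodesic_split_axioms.intro lc; rule geod; assumption)
  then show ?thesis
    using assms(10,11) by (rule geodesic_split_locally_splits)
qed

end
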